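(* Let $N\ge 3$ and $1<q<2<p<\infty$. Let $V:\mathbb R^N\to\mathbb R$ be a continuous function such that there is a constant $V_0>0$ with $V_0\le V(x)$ for all $x\in\mathbb R^N$, and such that $1/V\in L^1(\mathbb R^N)$. Then there exists $\Lambda_0>0$ such that for each $\lambda\in(0,\Lambda_0)$ the problem $$-\Delta u+V(x)u=|u|^{p-2}u+\lambda|u|^{q-2}u\quad\text{in }\mathbb R^N,\qquad u\in H^1(\mathbb R^N),\quad \int_{\mathbb R^N}V(x)|u|^2\,dx<\infty,$$ has at least one positive solution with negative energy, that is, a weak solution $u>0$ with $\mathcal I(u)<0$.
   Context: Let $E_V=\{u\in H^1(\mathbb R^N):\int_{\mathbb R^N}V(x)|u|^2\,dx<\infty\}$ with norm $\|u\|_{E_V}=\left(\int_{\mathbb R^N}|\nabla u|^2\,dx+\int_{\mathbb R^N}V(x)|u|^2\,dx\right)^{1/2}$, and let $\mathcal V=E_V\cap L^p(\mathbb R^N)$ with norm $\|u\|=\|u\|_{E_V}+\|u\|_{L^p(\mathbb R^N)}$. No upper bound is imposed on $p$. A (weak) solution is a function $u\in\mathcal V$ such that $\int_{\mathbb R^N}\nabla u\cdot\nabla\eta\,dx+\int_{\mathbb R^N}V(x)u\eta\,dx=\int_{\mathbb R^N}(|u|^{p-2}u+\lambda|u|^{q-2}u)\eta\,dx$ for all $\eta\in\mathcal V$. The energy of $u\in\mathcal V$ is $$\mathcal I(u)=\frac12\int_{\mathbb R^N}|\nabla u|^2\,dx+\frac12\int_{\mathbb R^N}V(x)|u|^2\,dx-\frac1p\int_{\mathbb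 R^N}|u|^p\,dx-\frac{\lambda}{q}\int_{\mathbb R^N}|u|^q\,dx .$$ *)

theory Defs
  imports "HOL-Analysis.Analysis"
begin

text \<open>
  Functions are real-valued Borel representatives; every Lebesgue class has one, so
  integration is with respect to \<^const>\<open>lborel\<close>.
\<close>

primrec C_k :: "nat \<Rightarrow> ('a::euclidean_space \<Rightarrow> real) \<Rightarrow> bool" where
  "C_k 0 f \<longleftrightarrow> continuous_on UNIV f"
| "C_k (Suc k) f \<longleftrightarrow> (\<forall>x. f differentiable (at x)) \<and>
     (\<forall>i\<in>Basis. C_k k (\<lambda>x. frechet_derivative f (at x) i))"

definition test_function :: "('a::euclidean_space \<Rightarrow> real) \<Rightarrow> bool" where
  "test_function \<phi> \<longleftrightarrow> (\<forall>k. C_k k \<phi>) \<and> compact (closure {x. \<phi> x \<noteq> 0})"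

definition locally_integrable :: "('a::euclidean_space \<Rightarrow> 'b::euclidean_space) \<Rightarrow> bool" where
  "locally_integrable f \<longleftrightarrow> f \<in> borel_measurable lborel \<and>
     (\<forall>K. compact K \<longrightarrow> set_integrable lborel K f)"

definition is_weak_gradient ::
    "('a::euclidean_space \<Rightarrow> real) \<Rightarrow> ('a \<Rightarrow> 'a) \<Rightarrow> bool" where
  "is_weak_gradient u g \<longleftrightarrow> locally_integrable u \<and> locally_integrable g \<and>
     (\<forall>\<phi>. test_function \<phi> \<longrightarrow> (\<forall>i\<in>Basis.
        (LINT x|lborel. u x * frechet_derivative \<phi> (at x) i) =
        - (LINT x|lborel. (g x \<bullet> i) * \<phi> x)))"

text \<open>
  Weak gradients are unique only up to null sets; the choice below is immaterial
  because \<open>weak_grad u\<close> occurs only under integrals.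
\<close>

definition weak_grad :: "('a::euclidean_space \<Rightarrow> real) \<Rightarrow> 'a \<Rightarrow> 'a" where
  "weak_grad u = (SOME g. is_weak_gradient u g)"

definition Lp_space :: "real \<Rightarrow> ('a::euclidean_space \<Rightarrow> real) set" where
  "Lp_space p = {u \<in> borel_measurable lborel. integrable lborel (\<lambda>x. \<bar>u x\<bar> powr p)}"

definition H1_space :: "('a::euclidean_space \<Rightarrow> real) set" where
  "H1_space = {u \<in> Lp_space 2. \<exists>g. is_weak_gradient u g \<and> integrable lborel (\<lambda>x. (norm (g x))\<^sup>2)}"

definition E_space :: "('a::euclidean_space \<Rightarrow> real) \<Rightarrow> ('a \<Rightarrow> real) set" where
  "E_space V = {u \<in> H1_space. integrable lborel (\<lambda>x. V x * \<bar>u x\<bar>\<^sup>2)}"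

definition V_space :: "('a::euclidean_space \<Rightarrow> real) \<Rightarrow> real \<Rightarrow> ('a \<Rightarrow> real) set" where
  "V_space V p = E_space V \<inter> Lp_space p"

definition weak_solution ::
    "('a::euclidean_space \<Rightarrow> real) \<Rightarrow> real \<Rightarrow> real \<Rightarrow> real \<Rightarrow> ('a \<Rightarrow> real) \<Rightarrow> bool" where
  "weak_solution V p q lam u \<longleftrightarrow> u \<in> V_space V p \<and> (\<forall>\<eta> \<in> V_space V p.
     (LINT x|lborel. weak_grad u x \<bullet> weak_grad \<eta> x) + (LINT x|lborel. V x * u x * \<eta> x) =
     (LINT x|lborel. (\<bar>u x\<bar> powr (p - 2) * u x + lam * \<bar>u x\<bar> powr (q - 2) * u x) * \<eta> x))"

definition energy ::
    "('a::euclidean_space \<Rightarrow> real) \<Rightarrow> real \<Rightarrow> real \<Rightarrow> real \<Rightarrow> ('a \<Rightarrow> real) \<Rightarrow> real" where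
  "energy V p q lam u =
     1 / 2 * (LINT x|lborel. (norm (weak_grad u x))\<^sup>2)
     + 1 / 2 * (LINT x|lborel. V x * \<bar>u x\<bar>\<^sup>2)
     - 1 / p * (LINT x|lborel. \<bar>u x\<bar> powr p)
     - lam / q * (LINT x|lborel. \<bar>u x\<bar> powr q)"

end

theory Submission
  imports Defs "HOL-Computational_Algebra.Polynomial"
begin

text \<open>
  The argument is monotone iteration between a constant supersolution \<open>M\<close> and explicit
  subsolutions. Everything happens between \<open>0\<close> and the small constant \<open>M\<close>, where a power of
  arbitrary size \<open>p\<close> is as harmless as a subcritical one.

  Put \<open>M = (2 * lam / V0) powr (1 / (2 - q))\<close>. For small \<open>lam\<close> this constant satisfies
  \<open>M powr (p - 1) + lam * M powr (q - 1) \<le> V0 * M\<close>, and since \<open>V0 \<le> V\<close> the constant function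
  \<open>M\<close> is a supersolution. The nonlinearity, truncated to \<open>[0, M]\<close>, becomes a bounded, continuous
  and nondecreasing function \<open>f\<close>. For a bounded right-hand side \<open>h\<close> the linear problem
  \<open>-\<Delta>u + V u = h\<close> is solved by orthogonal projection: integrability of \<open>1 / V\<close> says
  that \<open>h / sqrt V\<close> is square integrable, so \<open>\<integral> h \<eta>\<close> is the inner product of \<open>(h / sqrt V, 0)\<close>
  with \<open>(sqrt V \<eta>, \<nabla>\<eta>)\<close>, and one projects onto the closed subspace of all pairs
  \<open>(sqrt V u, \<nabla>u)\<close>. Solving repeatedly with right-hand side \<open>f\<close> of the previous
  iterate, starting from \<open>M\<close>, gives a decreasing sequence (\<open>monotone_iteration\<close>). Its pointwise
  limit \<open>u\<close> is a solution: by the linear stability estimate the iterates converge, with weight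
  \<open>V\<close> in mean square, to the solution \<open>v\<close> of the linear problem with right-hand side \<open>f u\<close>,
  so that \<open>v = u\<close> almost everywhere.

  The sublinear term makes the limit positive. For a bump \<open>F\<close> that is a high power of a smooth
  cut-off one has \<open>\<bar>\<Delta>F\<bar> + V F \<le> C * F powr (q - 1)\<close>, because each derivative costs only
  one power of the cut-off; as \<open>q - 1 < 1\<close>, a small multiple of \<open>F\<close> is a subsolution that is
  positive on any prescribed box (\<open>sublinear_subsolution\<close>). All iterates stay above all of these
  subsolutions, and the boxes exhaust the space. Finally, testing the equation with \<open>u\<close> itself
  gives \<open>(1/2 - 1/p) \<integral> u^p - lam (1/q - 1/2) \<integral> u^q\<close> for the energy, which is negative because
  \<open>u^p \<le> M powr (p - q) * u^q\<close> and \<open>M\<close> is small.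

  Order comparisons are made by testing with truncations \<open>max 0 (v - c)\<close>, whose weak gradient is
  the gradient of \<open>v\<close> cut off to \<open>{v > c}\<close> (\<open>truncation_weak_gradient\<close>). The
  reason is that difference quotients of \<open>v\<close> converge weakly in mean square to its weak derivative,
  while convexity of the truncation bounds its difference quotients from below for positive and
  from above for negative increments; the two limits meet.
\<close>

section \<open>Square-integrable maps\<close>

definition L2 :: "'a measure \<Rightarrow> ('a \<Rightarrow> 'b::euclidean_space) \<Rightarrow> bool" where
  "L2 M f \<longleftrightarrow> f \<in> borel_measurable M \<and> integrable M (\<lambda>x. (norm (f x))\<^sup>2)"

definition normsq :: "'a measure \<Rightarrow> ('a \<Rightarrow> 'b::euclidean_space) \<Rightarrow> real" where
  "normsq M f = (LINT x|M. (norm (f x))\<^sup>2)"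

lemma L2_measurable[measurable_dest]: "L2 M f \<Longrightarrow> f \<in> borel_measurable M"
  by (simp add: L2_def)

lemma normsq_nonneg: "0 \<le> normsq M f"
  by (simp add: normsq_def)

lemma L2_bound:
  assumes "f \<in> borel_measurable M" "integrable M g" "AE x in M. (norm (f x))\<^sup>2 \<le> g x"
  shows "L2 M f"
proof -
  have "integrable M (\<lambda>x. (norm (f x))\<^sup>2)"
  proof (rule Bochner_Integration.integrable_bound[OF assms(2)])
    show "(\<lambda>x. (norm (f x))\<^sup>2) \<in> borel_measurable M" using assms(1) by simp
    show "AE x in M. norm ((norm (f x))\<^sup>2) \<le> norm (g x)"
      using assms(3) by eventually_elim simp
  qed
  with assms(1) show ?thesis by (simp add: L2_def)
qed

lemma norm_diff_sq_le: "(norm (a - b))\<^sup>2 \<le> 2 * (norm a)\<^sup>2 + 2 * (norm b)\<^sup>2"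
  for a b :: "'b::real_inner"
proof -
  have "0 \<le> (norm (a + b))\<^sup>2" by simp
  moreover have "(norm (a + b))\<^sup>2 + (norm (a - b))\<^sup>2 = 2 * (norm a)\<^sup>2 + 2 * (norm b)\<^sup>2"
    unfolding power2_norm_eq_inner by (simp add: algebra_simps inner_commute)
  ultimately show ?thesis by linarith
qed

lemma norm_add_sq_le: "(norm (a + b))\<^sup>2 \<le> 2 * (norm a)\<^sup>2 + 2 * (norm b)\<^sup>2"
  for a b :: "'b::real_inner"
  using norm_diff_sq_le[of a "- b"] by simp

lemma L2_add:
  assumes "L2 M f" "L2 M g" shows "L2 M (\<lambda>x. f x + g x)"
proof (rule L2_bound)
  show "(\<lambda>x. f x + g x) \<in> borel_measurable M" using assms by (auto simp: L2_def)
  show "integrable M (\<lambda>x. 2 * (norm (f x))\<^sup>2 + 2 * (norm (g x))\<^sup>2)"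
    using assms by (auto simp: L2_def)
qed (simp add: norm_add_sq_le)

lemma L2_scaleR:
  assumes "L2 M f" shows "L2 M (\<lambda>x. c *\<^sub>R f x)"
  using assms by (auto simp: L2_def power_mult_distrib)

lemma L2_uminus: "L2 M f \<Longrightarrow> L2 M (\<lambda>x. - f x)"
  using L2_scaleR[of M f "-1"] by simp

lemma L2_diff: "L2 M f \<Longrightarrow> L2 M g \<Longrightarrow> L2 M (\<lambda>x. f x - g x)"
  using L2_add[OF _ L2_uminus, of M f g] by simp

lemma L2_inner_integrable:
  assumes "L2 M f" "L2 M g" shows "integrable M (\<lambda>x. f x \<bullet> g x)"
proof (rule Bochner_Integration.integrable_bound)
  show "integrable M (\<lambda>x. (norm (f x))\<^sup>2 + (norm (g x))\<^sup>2)"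
    using assms by (auto simp: L2_def)
  show "(\<lambda>x. f x \<bullet> g x) \<in> borel_measurable M" using assms by (auto simp: L2_def)
  have "norm (f x \<bullet> g x) \<le> (norm (f x))\<^sup>2 + (norm (g x))\<^sup>2" for x
  proof -
    have "norm (f x \<bullet> g x) \<le> norm (f x) * norm (g x)" by (simp add: Cauchy_Schwarz_ineq2)
    also have "\<dots> \<le> (norm (f x))\<^sup>2 + (norm (g x))\<^sup>2"
      using sum_squares_bound[of "norm (f x)" "norm (g x)"]
        mult_nonneg_nonneg[OF norm_ge_zero[of "f x"] norm_ge_zero[of "g x"]] by linarith
    finally show ?thesis .
  qed
  then show "AE x in M. norm (f x \<bullet> g x) \<le> norm ((norm (f x))\<^sup>2 + (norm (g x))\<^sup>2)"
    by (intro AE_I2) (metis abs_of_nonneg real_norm_def sum_power2_ge_zero)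
qed

lemma L2_mult_integrable:
  fixes f g :: "'a \<Rightarrow> real"
  shows "L2 M f \<Longrightarrow> L2 M g \<Longrightarrow> integrable M (\<lambda>x. f x * g x)"
  using L2_inner_integrable[of M f g] by simp

lemma normsq_add:
  assumes "L2 M f" "L2 M g"
  shows "normsq M (\<lambda>x. f x + t *\<^sub>R g x) = normsq M f + 2 * t * (LINT x|M. f x \<bullet> g x) + t\<^sup>2 * normsq M g"
proof -
  have "(norm (f x + t *\<^sub>R g x))\<^sup>2 = (norm (f x))\<^sup>2 + 2 * t * (f x \<bullet> g x) + t\<^sup>2 * (norm (g x))\<^sup>2" for x
    unfolding power2_norm_eq_inner
    by (simp add: algebra_simps inner_commute power2_eq_square)
  then show ?thesis
    using assms L2_inner_integrable[OF assms] by (simp add: normsq_def L2_def)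
qed

text \<open>
  This turns the minimality of a distance along every line into orthogonality.
\<close>

lemma zero_if_quadratic_bound:
  fixes b c :: real
  assumes "\<And>t. 2 * t * b \<le> t\<^sup>2 * c" shows "b = 0"
proof (rule ccontr)
  assume "b \<noteq> 0"
  \<comment> \<open>At \<open>t = e * b\<close> the quadratic term is at most half of the linear one.\<close>
  define e where "e = 1 / (\<bar>c\<bar> + 1)"
  have e: "e > 0" "e * c \<le> 1"
    by (auto simp: e_def divide_simps abs_if)
  have "2 * (e * b) * b \<le> (e * b)\<^sup>2 * c" using assms .
  then have "2 * e * b\<^sup>2 \<le> (e * b\<^sup>2) * (e * c)" by (simp add: power2_eq_square algebra_simps)
  also have "\<dots> \<le> (e * b\<^sup>2) * 1" by (intro mult_left_mono e) (use e in simp)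
  finally show False using e \<open>b \<noteq> 0\<close> by simp
qed

lemma L2_Cauchy_Schwarz:
  assumes "L2 M f" "L2 M g"
  shows "(LINT x|M. f x \<bullet> g x)\<^sup>2 \<le> normsq M f * normsq M g"
proof -
  let ?b = "LINT x|M. f x \<bullet> g x"
  have *: "0 \<le> normsq M f + 2 * t * ?b + t\<^sup>2 * normsq M g" for t
    using normsq_add[OF assms, of t] normsq_nonneg[of M] by metis
  show ?thesis
  proof (cases "normsq M g = 0")
    case True
    have "?b = 0"
    proof (rule ccontr)
      assume "?b \<noteq> 0"
      then show False using *[of "- (normsq M f + 1) / (2 * ?b)"] True by (simp add: field_simps)
    qed
    then show ?thesis using True by simp
  next
    case False
    then have "normsq M g > 0" using normsq_nonneg[of M g] by linarith
    then show ?thesis using *[of "- ?b / normsq M g"]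
      by (simp add: field_simps power2_eq_square)
  qed
qed

lemma normsq_diff_comm: "normsq M (\<lambda>x. f x - g x) = normsq M (\<lambda>x. g x - f x)"
  by (simp add: normsq_def norm_minus_commute)

lemma normsq_triangle:
  assumes "L2 M f" "L2 M g" "L2 M h"
  shows "normsq M (\<lambda>x. f x - h x) \<le> 2 * normsq M (\<lambda>x. f x - g x) + 2 * normsq M (\<lambda>x. g x - h x)"
proof -
  have "normsq M (\<lambda>x. f x - h x) \<le> (LINT x|M. 2 * (norm (f x - g x))\<^sup>2 + 2 * (norm (g x - h x))\<^sup>2)"
    unfolding normsq_def
  proof (rule integral_mono)
    show "integrable M (\<lambda>x. (norm (f x - h x))\<^sup>2)"
      using L2_diff[OF assms(1,3)] by (simp add: L2_def)
    show "integrable M (\<lambda>x. 2 * (norm (f x - g x))\<^sup>2 + 2 * (norm (g x - h x))\<^sup>2)"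
      using L2_diff[OF assms(1,2)] L2_diff[OF assms(2,3)] by (simp add: L2_def)
    show "(norm (f x - h x))\<^sup>2 \<le> 2 * (norm (f x - g x))\<^sup>2 + 2 * (norm (g x - h x))\<^sup>2" for x
      using norm_add_sq_le[of "f x - g x" "g x - h x"] by simp
  qed
  also have "\<dots> = 2 * normsq M (\<lambda>x. f x - g x) + 2 * normsq M (\<lambda>x. g x - h x)"
    using L2_diff[OF assms(1,2)] L2_diff[OF assms(2,3)] by (simp add: L2_def normsq_def)
  finally show ?thesis .
qed

lemma normsq_eq_zero_AE:
  assumes "L2 M f" "normsq M f = 0" shows "AE x in M. f x = 0"
  using assms integral_nonneg_eq_0_iff_AE[of M "\<lambda>x. (norm (f x))\<^sup>2"]
  by (simp add: L2_def normsq_def)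

lemma L2_inner_tendsto:
  assumes "\<And>n. L2 M (f n)" "L2 M g" "L2 M h" "(\<lambda>n. normsq M (\<lambda>x. f n x - g x)) \<longlonglongrightarrow> 0"
  shows "(\<lambda>n. LINT x|M. f n x \<bullet> h x) \<longlonglongrightarrow> (LINT x|M. g x \<bullet> h x)"
proof -
  have "(\<lambda>n. ((LINT x|M. f n x \<bullet> h x) - (LINT x|M. g x \<bullet> h x))\<^sup>2) \<longlonglongrightarrow> 0"
  proof (rule tendsto_sandwich)
    show "\<forall>\<^sub>F n in sequentially. 0 \<le> ((LINT x|M. f n x \<bullet> h x) - (LINT x|M. g x \<bullet> h x))\<^sup>2"
      by simp
    show "\<forall>\<^sub>F n in sequentially. ((LINT x|M. f n x \<bullet> h x) - (LINT x|M. g x \<bullet> h x))\<^sup>2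
        \<le> normsq M (\<lambda>x. f n x - g x) * normsq M h"
    proof (rule always_eventually, rule allI)
      fix n
      have "(LINT x|M. f n x \<bullet> h x) - (LINT x|M. g x \<bullet> h x) = (LINT x|M. (f n x - g x) \<bullet> h x)"
        using assms by (simp add: inner_diff_left L2_inner_integrable)
      then show "((LINT x|M. f n x \<bullet> h x) - (LINT x|M. g x \<bullet> h x))\<^sup>2
        \<le> normsq M (\<lambda>x. f n x - g x) * normsq M h"
        using L2_Cauchy_Schwarz[OF L2_diff[OF assms(1,2)] assms(3), of n] by simp
    qed
    show "(\<lambda>n. normsq M (\<lambda>x. f n x - g x) * normsq M h) \<longlonglongrightarrow> 0"
      using tendsto_mult_left_zero[OF assms(4)] .
  qed auto
  then have "(\<lambda>n. (LINT x|M. f n x \<bullet> h x) - (LINT x|M. g x \<bullet> h x)) \<longlonglongrightarrow> 0"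
    by (subst (asm) power_tendsto_0_iff) auto
  then show ?thesis by (simp add: LIM_zero_iff)
qed

text \<open>
  Consecutive distances decaying like \<open>4^(-k)\<close> (squared) make the increments \<open>d k\<close> absolutely
  summable almost everywhere, because \<open>2 * d k \<le> 2^k * (d k)^2 + 2^(-k)\<close> and the first
  summand has a finite integral.
\<close>

lemma L2_rapid_Cauchy_convergent_AE:
  fixes f :: "nat \<Rightarrow> 'a \<Rightarrow> 'b::euclidean_space"
  assumes "\<And>n. L2 M (f n)" and "\<And>k. normsq M (\<lambda>x. f (Suc k) x - f k x) \<le> (1/4)^k"
  shows "AE x in M. convergent (\<lambda>n. f n x)"
proof -
  note [measurable] = L2_measurable[OF assms(1)]
  define d where "d k x = norm (f (Suc k) x - f k x)" for k x
  have [measurable]: "d k \<in> borel_measurable M" for k unfolding d_def by measurable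
  have dint: "(\<integral>\<^sup>+ x. ennreal (2^k * (d k x)\<^sup>2) \<partial>M) \<le> ennreal ((1/2)^k)" for k
  proof -
    have "(\<integral>\<^sup>+ x. ennreal (2^k * (d k x)\<^sup>2) \<partial>M) = ennreal (LINT x|M. 2^k * (d k x)\<^sup>2)"
      using L2_diff[OF assms(1,1)] by (intro nn_integral_eq_integral) (auto simp: L2_def d_def)
    also have "(LINT x|M. 2^k * (d k x)\<^sup>2) = 2^k * normsq M (\<lambda>x. f (Suc k) x - f k x)"
      by (simp add: d_def normsq_def)
    also have "\<dots> \<le> 2^k * (1/4)^k" using assms(2) by (intro mult_left_mono) auto
    also have "\<dots> = (1/2)^k" by (simp add: power_mult_distrib[symmetric])
    finally show ?thesis by (simp add: ennreal_leI)
  qed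
  have "(\<integral>\<^sup>+ x. (\<Sum>k. ennreal (2^k * (d k x)\<^sup>2)) \<partial>M) = (\<Sum>k. \<integral>\<^sup>+ x. ennreal (2^k * (d k x)\<^sup>2) \<partial>M)"
    by (rule nn_integral_suminf) measurable
  also have "\<dots> \<le> (\<Sum>k. ennreal ((1/2)^k))"
    by (intro suminf_le dint) auto
  also have "\<dots> = ennreal (\<Sum>k. (1/2)^k)"
    by (intro suminf_ennreal2) (auto intro: summable_geometric)
  also have "\<dots> < \<infinity>" by simp
  finally have fin: "(\<integral>\<^sup>+ x. (\<Sum>k. ennreal (2^k * (d k x)\<^sup>2)) \<partial>M) \<noteq> \<infinity>" by simp
  have "AE x in M. (\<Sum>k. ennreal (2^k * (d k x)\<^sup>2)) \<noteq> \<infinity>"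
    by (rule nn_integral_PInf_AE[OF _ fin]) measurable
  then show ?thesis
  proof eventually_elim
    case (elim x)
    have s1: "summable (\<lambda>k. 2^k * (d k x)\<^sup>2)"
      using elim by (intro summable_suminf_not_top) (auto simp: infinity_ennreal_def)
    have s2: "summable (\<lambda>k. ((2^k * (d k x)\<^sup>2) + (1/2)^k) / 2)"
      using s1 by (intro summable_divide summable_add summable_geometric) auto
    have "summable (\<lambda>k. d k x)"
    proof (rule summable_comparison_test'[OF s2])
      fix k :: nat
      have "0 \<le> (2^k * d k x - 1)\<^sup>2 * (1/2)^k" by simp
      also have "\<dots> = 2^k * (d k x)\<^sup>2 + (1/2)^k - 2 * d k x"
        by (simp add: power2_eq_square algebra_simps power_divide)
      finally show "norm (d k x) \<le> ((2^k * (d k x)\<^sup>2) + (1/2)^k) / 2"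
        by (simp add: d_def)
    qed
    then have "summable (\<lambda>k. f (Suc k) x - f k x)"
      unfolding d_def by (rule summable_norm_cancel)
    then have "convergent (\<lambda>n. \<Sum>k<n. f (Suc k) x - f k x)"
      by (simp add: summable_iff_convergent)
    then have "convergent (\<lambda>n. f n x - f 0 x)"
      by (simp only: sum_lessThan_telescope[of "\<lambda>n. f n x"])
    then have "convergent (\<lambda>n. (f n x - f 0 x) + f 0 x)"
      by (intro convergent_add convergent_const)
    then show ?case by simp
  qed
qed

text \<open>
  Fatou's lemma in the form that identifies almost everywhere limits with mean square limits:
  applied to \<open>f n - f k\<close> with \<open>k\<close> running, it bounds the distance from \<open>f n\<close> to the limit.
\<close>

lemma normsq_Fatou:
  fixes f :: "nat \<Rightarrow> 'a \<Rightarrow> 'b::euclidean_space"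
  assumes "\<And>n. L2 M (f n)" "g \<in> borel_measurable M"
    and "AE x in M. (\<lambda>n. f n x) \<longlonglongrightarrow> g x" and "\<forall>\<^sub>F n in sequentially. normsq M (f n) \<le> c"
  shows "L2 M g" "normsq M g \<le> c"
proof -
  note [measurable] = L2_measurable[OF assms(1)] assms(2)
  have c: "c \<ge> 0"
    using assms(4) normsq_nonneg[of M]
    by (metis (mono_tags, lifting) eventually_False_sequentially eventually_mono order_trans)
  have *: "(\<integral>\<^sup>+ x. ennreal ((norm (f n x))\<^sup>2) \<partial>M) = ennreal (normsq M (f n))" for n
    using assms(1)[of n] by (simp add: nn_integral_eq_integral L2_def normsq_def)
  have "(\<integral>\<^sup>+ x. ennreal ((norm (g x))\<^sup>2) \<partial>M) = (\<integral>\<^sup>+ x. liminf (\<lambda>n. ennreal ((norm (f n x))\<^sup>2)) \<partial>M)"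
  proof (rule nn_integral_cong_AE)
    show "AE x in M. ennreal ((norm (g x))\<^sup>2) = liminf (\<lambda>n. ennreal ((norm (f n x))\<^sup>2))"
      using assms(3)
    proof eventually_elim
      case (elim x)
      have "(\<lambda>n. ennreal ((norm (f n x))\<^sup>2)) \<longlonglongrightarrow> ennreal ((norm (g x))\<^sup>2)"
        using elim by (intro tendsto_ennrealI tendsto_intros)
      from lim_imp_Liminf[OF _ this] show ?case by simp
    qed
  qed
  also have "\<dots> \<le> liminf (\<lambda>n. \<integral>\<^sup>+ x. ennreal ((norm (f n x))\<^sup>2) \<partial>M)"
    by (rule nn_integral_liminf) measurable
  also have "\<dots> \<le> ennreal c"
  proof (rule Liminf_le)
    show "\<forall>\<^sub>F n in sequentially. (\<integral>\<^sup>+ x. ennreal ((norm (f n x))\<^sup>2) \<partial>M) \<le> ennreal c"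
      using assms(4) by eventually_elim (simp add: * ennreal_leI)
  qed simp
  finally have le: "(\<integral>\<^sup>+ x. ennreal ((norm (g x))\<^sup>2) \<partial>M) \<le> ennreal c" .
  then have "integrable M (\<lambda>x. (norm (g x))\<^sup>2)"
    by (intro integrableI_bounded) (auto intro: le_less_trans)
  then show "L2 M g" by (simp add: L2_def)
  then have "ennreal (normsq M g) \<le> ennreal c"
    using le by (simp add: nn_integral_eq_integral L2_def normsq_def)
  then show "normsq M g \<le> c" using c by simp
qed

lemma L2_complete:
  fixes f :: "nat \<Rightarrow> 'a \<Rightarrow> 'b::euclidean_space"
  assumes f: "\<And>n. L2 M (f n)"
    and cau: "\<And>e. e > 0 \<Longrightarrow> \<exists>n0. \<forall>m\<ge>n0. \<forall>n\<ge>n0. normsq M (\<lambda>x. f m x - f n x) \<le> e"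
  obtains g where "L2 M g" "(\<lambda>n. normsq M (\<lambda>x. f n x - g x)) \<longlonglongrightarrow> 0"
proof -
  note [measurable] = L2_measurable[OF f]
  have "\<forall>k. \<exists>n0. \<forall>m\<ge>n0. \<forall>n\<ge>n0. normsq M (\<lambda>x. f m x - f n x) \<le> (1/4)^k"
    using cau by simp
  then obtain N where N: "\<And>k m n. m \<ge> N k \<Longrightarrow> n \<ge> N k \<Longrightarrow> normsq M (\<lambda>x. f m x - f n x) \<le> (1/4)^k"
    by metis
  \<comment> \<open>Summing makes \<open>r\<close> monotone while it stays above \<open>N\<close>.\<close>
  define r where "r k = (\<Sum>j\<le>k. N j) + k" for k
  have rN: "r k \<ge> N k" for k
    unfolding r_def by (rule trans_le_add1) (rule member_le_sum, auto)
  have rS: "r (Suc k) \<ge> r k" for k by (simp add: r_def)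
  have rk: "r k \<ge> k" for k by (simp add: r_def)
  have conv: "AE x in M. convergent (\<lambda>k. f (r k) x)"
    using N rN rS order_trans by (intro L2_rapid_Cauchy_convergent_AE f) blast
  define g where "g x = lim (\<lambda>k. f (r k) x)" for x
  have g[measurable]: "g \<in> borel_measurable M"
    unfolding g_def by (rule borel_measurable_lim_metric) measurable
  have lim: "AE x in M. (\<lambda>k. f (r k) x) \<longlonglongrightarrow> g x"
    using conv by eventually_elim (simp add: g_def convergent_LIMSEQ_iff)
  have key: "L2 M (\<lambda>x. f n x - g x) \<and> normsq M (\<lambda>x. f n x - g x) \<le> e"
    if "e > 0" "\<And>m k. m \<ge> n0 \<Longrightarrow> k \<ge> n0 \<Longrightarrow> normsq M (\<lambda>x. f m x - f k x) \<le> e" "n \<ge> n0" for e n0 n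
  proof -
    have a: "AE x in M. (\<lambda>k. f n x - f (r k) x) \<longlonglongrightarrow> f n x - g x"
      using lim by eventually_elim (intro tendsto_intros)
    have b: "\<forall>\<^sub>F k in sequentially. normsq M (\<lambda>x. f n x - f (r k) x) \<le> e"
      using eventually_ge_at_top[of n0]
    proof eventually_elim
      case (elim k)
      then show ?case using that rk[of k] by (meson order_trans)
    qed
    show ?thesis
      using normsq_Fatou[OF _ _ a b] L2_diff[OF f f] by (auto simp: f)
  qed
  have L2g: "L2 M g"
  proof -
    obtain n0 where "\<And>m k. m \<ge> n0 \<Longrightarrow> k \<ge> n0 \<Longrightarrow> normsq M (\<lambda>x. f m x - f k x) \<le> 1"
      using cau[of 1] by auto
    then have "L2 M (\<lambda>x. f n0 x - g x)" using key[of 1 n0 n0] by auto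
    then show ?thesis using L2_diff[OF f[of n0]] by fastforce
  qed
  have "(\<lambda>n. normsq M (\<lambda>x. f n x - g x)) \<longlonglongrightarrow> 0"
  proof (rule LIMSEQ_I)
    fix e :: real assume e: "e > 0"
    then obtain n0 where "\<And>m k. m \<ge> n0 \<Longrightarrow> k \<ge> n0 \<Longrightarrow> normsq M (\<lambda>x. f m x - f k x) \<le> e / 2"
      using cau[of "e / 2"] by auto
    then have "\<bar>normsq M (\<lambda>x. f n x - g x)\<bar> < e" if "n \<ge> n0" for n
      using key[of "e / 2" n0 n] e that normsq_nonneg[of M "\<lambda>x. f n x - g x"] by fastforce
    then show "\<exists>n0. \<forall>n\<ge>n0. norm (normsq M (\<lambda>x. f n x - g x) - 0) < e"
      by auto
  qed
  with L2g show thesis by (rule that)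
qed

lemma normsq_parallelogram:
  assumes "L2 M f" "L2 M g"
  shows "normsq M (\<lambda>x. f x - g x) = 2 * normsq M f + 2 * normsq M g - 4 * normsq M (\<lambda>x. (1/2) *\<^sub>R (f x + g x))"
proof -
  have "normsq M (\<lambda>x. f x + 1 *\<^sub>R g x) = normsq M f + 2 * (LINT x|M. f x \<bullet> g x) + normsq M g"
    using normsq_add[OF assms, of 1] by simp
  moreover have "normsq M (\<lambda>x. f x + (-1) *\<^sub>R g x) = normsq M f - 2 * (LINT x|M. f x \<bullet> g x) + normsq M g"
    using normsq_add[OF assms, of "-1"] by simp
  moreover have "4 * normsq M (\<lambda>x. (1/2) *\<^sub>R (f x + g x)) = normsq M (\<lambda>x. f x + g x)"
    by (simp add: normsq_def power_divide)
  ultimately show ?thesis by simp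
qed

text \<open>
  The projection onto the closure of a subspace \<open>S\<close>. A minimizing sequence is Cauchy by the
  parallelogram identity, and its limit realizes the distance. Returning the approximating
  sequence makes the theorem serve both density results and variational problems.
\<close>

theorem L2_projection:
  fixes h :: "'a \<Rightarrow> 'b::euclidean_space"
  assumes h: "L2 M h" and S: "\<And>f. f \<in> S \<Longrightarrow> L2 M f" and zero: "(\<lambda>x. 0) \<in> S"
    and add: "\<And>f g. f \<in> S \<Longrightarrow> g \<in> S \<Longrightarrow> (\<lambda>x. f x + g x) \<in> S"
    and scale: "\<And>f c. f \<in> S \<Longrightarrow> (\<lambda>x. c *\<^sub>R f x) \<in> S"
  obtains g s where "L2 M g" "\<And>n. s n \<in> S" "(\<lambda>n. normsq M (\<lambda>x. s n x - g x)) \<longlonglongrightarrow> 0"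
    "\<And>f. f \<in> S \<Longrightarrow> (LINT x|M. (h x - g x) \<bullet> f x) = 0"
proof -
  define D where "D = (\<lambda>f. normsq M (\<lambda>x. h x - f x)) ` S"
  define d where "d = Inf D"
  have bdd: "bdd_below D" unfolding D_def using normsq_nonneg[of M] by (intro bdd_belowI[of _ 0]) auto
  have ne: "D \<noteq> {}" using zero by (auto simp: D_def)
  have dle: "d \<le> normsq M (\<lambda>x. h x - f x)" if "f \<in> S" for f
    unfolding d_def using bdd that by (intro cInf_lower) (auto simp: D_def)
  have "\<exists>f\<in>S. normsq M (\<lambda>x. h x - f x) < d + inverse (real (Suc n))" for n
  proof -
    have "Inf D < d + inverse (real (Suc n))" by (simp add: d_def)
    then show ?thesis using cInf_lessD[OF ne] by (auto simp: D_def)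
  qed
  then obtain s where s: "\<And>n. s n \<in> S" "\<And>n. normsq M (\<lambda>x. h x - s n x) < d + inverse (real (Suc n))"
    by metis
  note sL = S[OF s(1)]
  have near: "normsq M (\<lambda>x. s m x - s n x) \<le> 2 * inverse (real (Suc m)) + 2 * inverse (real (Suc n))" for m n
  proof -
    have "(\<lambda>x. (1/2) *\<^sub>R (s m x + s n x)) \<in> S" by (intro scale add s(1))
    then have "d \<le> normsq M (\<lambda>x. h x - (1/2) *\<^sub>R (s m x + s n x))" by (rule dle)
    also have "(\<lambda>x. h x - (1/2) *\<^sub>R (s m x + s n x)) = (\<lambda>x. (1/2) *\<^sub>R ((h x - s m x) + (h x - s n x)))"
    proof
      fix x
      have "(1/2) *\<^sub>R ((h x - s m x) + (h x - s n x)) = (1/2) *\<^sub>R (h x + h x) - (1/2) *\<^sub>R (s m x + s n x)"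
        unfolding scaleR_diff_right[symmetric] by (rule arg_cong[where f="scaleR (1/2)"]) simp
      then show "h x - (1/2) *\<^sub>R (s m x + s n x) = (1/2) *\<^sub>R ((h x - s m x) + (h x - s n x))"
        unfolding scaleR_half_double by (rule sym)
    qed
    finally have "normsq M (\<lambda>x. (h x - s m x) - (h x - s n x)) \<le>
        2 * normsq M (\<lambda>x. h x - s m x) + 2 * normsq M (\<lambda>x. h x - s n x) - 4 * d"
      using normsq_parallelogram[OF L2_diff[OF h sL] L2_diff[OF h sL], of m n] by linarith
    moreover have "normsq M (\<lambda>x. (h x - s m x) - (h x - s n x)) = normsq M (\<lambda>x. s m x - s n x)"
      by (simp add: normsq_def norm_minus_commute)
    ultimately show ?thesis using s(2)[of m] s(2)[of n] by linarith
  qed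
  have "\<exists>n0. \<forall>m\<ge>n0. \<forall>n\<ge>n0. normsq M (\<lambda>x. s m x - s n x) \<le> e" if "e > 0" for e
  proof -
    obtain n0 where n0: "inverse (real (Suc n0)) < e / 4"
      using reals_Archimedean[of "e / 4"] \<open>e > 0\<close> by (metis divide_pos_pos zero_less_numeral)
    show ?thesis
    proof (intro exI[of _ n0] allI impI)
      fix m n assume "m \<ge> n0" "n \<ge> n0"
      then have "inverse (real (Suc m)) \<le> inverse (real (Suc n0))" "inverse (real (Suc n)) \<le> inverse (real (Suc n0))"
        by (auto intro!: le_imp_inverse_le)
      then show "normsq M (\<lambda>x. s m x - s n x) \<le> e" using near[of m n] n0 by linarith
    qed
  qed
  then obtain g where g: "L2 M g" "(\<lambda>n. normsq M (\<lambda>x. s n x - g x)) \<longlonglongrightarrow> 0"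
    by (rule L2_complete[OF sL])
  have "(LINT x|M. (h x - g x) \<bullet> f x) = 0" if f: "f \<in> S" for f
  proof (rule zero_if_quadratic_bound)
    fix t
    have "(\<lambda>n. normsq M (\<lambda>x. (h x - s n x) - (h x - g x))) \<longlonglongrightarrow> 0"
      using g(2) by (simp add: normsq_def norm_minus_commute)
    then have "(\<lambda>n. LINT x|M. (h x - s n x) \<bullet> f x) \<longlonglongrightarrow> (LINT x|M. (h x - g x) \<bullet> f x)"
      by (intro L2_inner_tendsto L2_diff h sL g(1) S f)
    then have lim: "(\<lambda>n. 2 * t * (LINT x|M. (h x - s n x) \<bullet> f x)) \<longlonglongrightarrow> 2 * t * (LINT x|M. (h x - g x) \<bullet> f x)"
      by (intro tendsto_intros)
    have lim2: "(\<lambda>n. inverse (real (Suc n)) + t\<^sup>2 * normsq M f) \<longlonglongrightarrow> 0 + t\<^sup>2 * normsq M f"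
      by (intro tendsto_intros LIMSEQ_inverse_real_of_nat)
    have "2 * t * (LINT x|M. (h x - s n x) \<bullet> f x) \<le> inverse (real (Suc n)) + t\<^sup>2 * normsq M f" for n
    proof -
      have "d \<le> normsq M (\<lambda>x. h x - (s n x + t *\<^sub>R f x))" by (intro dle add scale s(1) f)
      also have "\<dots> = normsq M (\<lambda>x. (h x - s n x) + (-t) *\<^sub>R f x)" by (simp add: algebra_simps)
      also have "\<dots> = normsq M (\<lambda>x. h x - s n x) - 2 * t * (LINT x|M. (h x - s n x) \<bullet> f x) + t\<^sup>2 * normsq M f"
        by (subst normsq_add) (auto intro: L2_diff h sL S f)
      finally show ?thesis using s(2)[of n] by linarith
    qed
    then show "2 * t * (LINT x|M. (h x - g x) \<bullet> f x) \<le> t\<^sup>2 * normsq M f"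
      using LIMSEQ_le[OF lim lim2] by auto
  qed
  with g s(1) show thesis by (intro that)
qed

section \<open>Smooth functions\<close>

lemma C_k_continuous: "C_k k f \<Longrightarrow> continuous_on UNIV f"
  by (cases k) (auto intro!: differentiable_imp_continuous_on simp: differentiable_on_def
      intro: differentiable_at_withinI)

lemma C_k_SucD: "C_k (Suc k) f \<Longrightarrow> C_k k f"
proof (induction k arbitrary: f)
  case 0
  then show ?case using C_k_continuous[of "Suc 0" f] by simp
qed auto

lemma C_k_const: "C_k k (\<lambda>x. c)"
  by (induction k arbitrary: c) (auto simp: frechet_derivative_const)

lemma C_k_add: "C_k k f \<Longrightarrow> C_k k g \<Longrightarrow> C_k k (\<lambda>x. f x + g x)"
proof (induction k arbitrary: f g)
  case 0
  then show ?case by (auto intro: continuous_intros)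
next
  case (Suc k)
  have "frechet_derivative (\<lambda>x. f x + g x) (at x) i =
      frechet_derivative f (at x) i + frechet_derivative g (at x) i" for x i
    using Suc.prems frechet_derivative_at[OF has_derivative_add[OF
      iffD1[OF frechet_derivative_works] iffD1[OF frechet_derivative_works]], of f x g, symmetric]
    by simp
  with Suc show ?case by (auto intro: derivative_intros)
qed

lemma frechet_derivative_mult_real:
  fixes f g :: "'a::euclidean_space \<Rightarrow> real"
  assumes "f differentiable (at x)" "g differentiable (at x)"
  shows "frechet_derivative (\<lambda>x. f x * g x) (at x) i =
      f x * frechet_derivative g (at x) i + frechet_derivative f (at x) i * g x"
  using frechet_derivative_at[OF has_derivative_mult[OF
      iffD1[OF frechet_derivative_works assms(1)] iffD1[OF frechet_derivative_works assms(2)]], symmetric]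
  by simp

lemma C_k_mult: "C_k k f \<Longrightarrow> C_k k g \<Longrightarrow> C_k k (\<lambda>x. f x * g x)"
proof (induction k arbitrary: f g)
  case 0
  then show ?case by (auto intro: continuous_intros)
next
  case (Suc k)
  have "frechet_derivative (\<lambda>x. f x * g x) (at x) i =
      f x * frechet_derivative g (at x) i + frechet_derivative f (at x) i * g x" for x i
    using Suc.prems by (simp add: frechet_derivative_mult_real)
  moreover have "C_k k f" "C_k k g" using Suc.prems by (auto dest!: C_k_SucD simp del: C_k.simps)
  ultimately show ?case using Suc.prems by (auto intro!: derivative_intros C_k_add Suc.IH)
qed

lemma frechet_derivative_translate:
  fixes f :: "'a::euclidean_space \<Rightarrow> real"
  assumes "f differentiable (at (x - c))"
  shows "(\<lambda>x. f (x - c)) differentiable (at x)"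
    "frechet_derivative (\<lambda>x. f (x - c)) (at x) = frechet_derivative f (at (x - c))"
proof -
  have "((\<lambda>x. f (x - c)) has_derivative frechet_derivative f (at (x - c))) (at x)"
  proof (rule has_derivative_compose[of "\<lambda>x. x - c" "\<lambda>h. h" x UNIV f "frechet_derivative f (at (x - c))"])
    show "((\<lambda>x. x - c) has_derivative (\<lambda>h. h)) (at x)" by (auto intro!: derivative_eq_intros)
    show "(f has_derivative frechet_derivative f (at (x - c))) (at (x - c))"
      using assms by (simp add: frechet_derivative_works)
  qed
  then show "(\<lambda>x. f (x - c)) differentiable (at x)"
    "frechet_derivative (\<lambda>x. f (x - c)) (at x) = frechet_derivative f (at (x - c))"
    by (auto simp: differentiable_def frechet_derivative_at[symmetric])
qed

lemma C_k_translate: "C_k k f \<Longrightarrow> C_k k (\<lambda>x. f (x - c))"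
proof (induction k arbitrary: f)
  case 0
  have "continuous_on UNIV (f \<circ> (\<lambda>x. x - c))"
    using 0 by (intro continuous_on_compose continuous_intros) (auto intro: continuous_on_subset)
  then show ?case by (simp add: o_def)
next
  case (Suc k)
  then show ?case by (auto simp: frechet_derivative_translate)
qed

text \<open>
  A smooth function of one variable is given as the sequence of its derivatives, so that
  smoothness in several variables follows by induction without iterating derivatives.
\<close>

lemma C_k_compose_coordinate:
  assumes "\<And>n s. (\<beta> n has_real_derivative \<beta> (Suc n) s) (at s)"
  shows "C_k k (\<lambda>x::'a::euclidean_space. \<beta> n (c * (x \<bullet> i) + d))"
proof (induction k arbitrary: n)
  case 0
  have "continuous_on UNIV (\<beta> n)"
    using assms[of n] by (meson DERIV_isCont continuous_at_imp_continuous_on)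
  then have "continuous_on UNIV (\<beta> n \<circ> (\<lambda>x::'a. c * (x \<bullet> i) + d))"
    by (intro continuous_on_compose continuous_intros) (auto intro: continuous_on_subset)
  then show ?case by (simp add: o_def)
next
  case (Suc k)
  have D: "((\<lambda>x::'a. \<beta> n (c * (x \<bullet> i) + d)) has_derivative
      (\<lambda>h. \<beta> (Suc n) (c * (x \<bullet> i) + d) * (c * (h \<bullet> i)))) (at x)" for x
  proof -
    have "((\<lambda>x::'a. c * (x \<bullet> i) + d) has_derivative (\<lambda>h. c * (h \<bullet> i))) (at x)"
      by (auto intro!: derivative_eq_intros)
    from has_derivative_compose[OF this assms[of n, THEN has_field_derivative_imp_has_derivative]]
    show ?thesis by simp
  qed
  have "C_k k (\<lambda>x::'a. \<beta> (Suc n) (c * (x \<bullet> i) + d) * (c * (j \<bullet> i)))" for j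
    by (intro C_k_mult C_k_const Suc.IH)
  moreover have "frechet_derivative (\<lambda>x::'a. \<beta> n (c * (x \<bullet> i) + d)) (at x) j
      = \<beta> (Suc n) (c * (x \<bullet> i) + d) * (c * (j \<bullet> i))" for x j
    using frechet_derivative_at[OF D[of x], symmetric] by simp
  ultimately show ?case using D by (simp add: differentiable_def) blast
qed

lemma C_k_prod: "finite I \<Longrightarrow> (\<And>i. i \<in> I \<Longrightarrow> C_k k (f i)) \<Longrightarrow> C_k k (\<lambda>x. \<Prod>i\<in>I. f i x)"
  by (induction I rule: finite_induct) (auto intro: C_k_const C_k_mult)

section \<open>A smooth step and bumps on boxes\<close>

fun step_poly :: "nat \<Rightarrow> real poly" where
  "step_poly 0 = 1"
| "step_poly (Suc n) = [:0, 0, 1:] * (step_poly n - pderiv (step_poly n))"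

text \<open>
  \<open>step_deriv 0\<close> is \<open>exp (- 1 / s)\<close> extended by zero, and \<open>step_deriv n\<close> is its \<open>n\<close>-th derivative;
  the recursion of \<open>step_poly\<close> is the chain rule written in the variable \<open>1 / s\<close>.
\<close>

definition step_deriv :: "nat \<Rightarrow> real \<Rightarrow> real" where
  "step_deriv n s = (if s > 0 then poly (step_poly n) (1 / s) * exp (- (1 / s)) else 0)"

lemma poly_times_exp_tendsto_0: "((\<lambda>x::real. poly p x * exp (- x)) \<longlongrightarrow> 0) at_top"
proof -
  have "((\<lambda>x::real. x ^ k * poly p x * exp (- x)) \<longlongrightarrow> 0) at_top" for k
  proof (induction p arbitrary: k)
    case 0
    then show ?case by simp
  next
    case (pCons a p)
    have "((\<lambda>x::real. a * (x ^ k / exp x) + x ^ Suc k * poly p x * exp (- x)) \<longlongrightarrow> a * 0 + 0) at_top"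
      by (intro tendsto_intros tendsto_power_div_exp_0 pCons.IH)
    then show ?case by (simp add: algebra_simps exp_minus divide_inverse)
  qed
  from this[of 0] show ?thesis by simp
qed

lemma step_deriv_has_derivative: "(step_deriv n has_real_derivative step_deriv (Suc n) s) (at s)"
proof -
  consider "s > 0" | "s < 0" | "s = 0" by linarith
  then show ?thesis
  proof cases
    case 1
    have "((\<lambda>s. poly (step_poly n) (1 / s) * exp (- (1 / s))) has_real_derivative step_deriv (Suc n) s) (at s)"
      using 1 by (auto intro!: derivative_eq_intros DERIV_chain'[OF _ poly_DERIV]
          simp: step_deriv_def field_simps power2_eq_square)
    moreover have "\<forall>\<^sub>F x in nhds s. step_deriv n x = poly (step_poly n) (1 / x) * exp (- (1 / x))"
      using eventually_nhds_in_open[of "{0<..}" s] 1 by (auto elim!: eventually_mono simp: step_deriv_def)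
    ultimately show ?thesis by (simp add: DERIV_cong_ev)
  next
    case 2
    have "\<forall>\<^sub>F x in nhds s. step_deriv n x = 0"
      using eventually_nhds_in_open[of "{..<0}" s] 2 by (auto elim!: eventually_mono simp: step_deriv_def)
    then have "(step_deriv n has_real_derivative 0) (at s) \<longleftrightarrow> ((\<lambda>x. 0) has_real_derivative 0) (at s)"
      by (intro DERIV_cong_ev) auto
    then show ?thesis using 2 by (simp add: step_deriv_def)
  next
    case 3
    have "((\<lambda>h. step_deriv n h / h) \<longlongrightarrow> 0) (at_right 0)"
    proof -
      have "((\<lambda>h. poly (pCons 0 (step_poly n)) (inverse h) * exp (- inverse h)) \<longlongrightarrow> 0) (at_right 0)"
        by (rule filterlim_compose[OF poly_times_exp_tendsto_0 filterlim_inverse_at_top_right])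
      moreover have "\<forall>\<^sub>F h in at_right 0. poly (pCons 0 (step_poly n)) (inverse h) * exp (- inverse h) = step_deriv n h / h"
        using eventually_at_right_less[of "0::real"]
        by eventually_elim (simp add: step_deriv_def divide_inverse)
      ultimately show ?thesis by (simp add: tendsto_cong)
    qed
    moreover have "((\<lambda>h. step_deriv n h / h) \<longlongrightarrow> 0) (at_left 0)"
    proof -
      have "\<forall>\<^sub>F h in at_left 0. step_deriv n h / h = 0"
        by (auto simp: eventually_at_filter step_deriv_def)
      then show ?thesis by (simp add: tendsto_eventually)
    qed
    ultimately have "((\<lambda>h. step_deriv n h / h) \<longlongrightarrow> 0) (at 0)"
      by (simp add: filterlim_at_split)
    then show ?thesis using 3 by (simp add: DERIV_def step_deriv_def)
  qed
qed

text \<open>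
  The parameter \<open>m\<close> controls the steepness: as \<open>m\<close> grows the bump tends to the indicator of the box.
\<close>

definition box_bump :: "'a::euclidean_space \<Rightarrow> 'a \<Rightarrow> real \<Rightarrow> 'a \<Rightarrow> real" where
  "box_bump a b m x =
     (\<Prod>i\<in>Basis. step_deriv 0 (m * (x \<bullet> i - a \<bullet> i)) * step_deriv 0 (m * (b \<bullet> i - x \<bullet> i)))"

lemma step_nonneg: "0 \<le> step_deriv 0 s" and step_le_1: "step_deriv 0 s \<le> 1"
  and step_pos_iff: "0 < step_deriv 0 s \<longleftrightarrow> 0 < s"
  by (auto simp: step_deriv_def)

lemma box_bump_nonneg: "0 \<le> box_bump a b m x"
  unfolding box_bump_def by (intro prod_nonneg mult_nonneg_nonneg) (auto simp: step_nonneg)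

lemma box_bump_le_1: "box_bump a b m x \<le> 1"
  unfolding box_bump_def by (rule prod_le_1) (simp add: step_nonneg step_le_1 mult_le_one)

lemma box_bump_pos_iff:
  assumes "m > 0" shows "0 < box_bump a b m x \<longleftrightarrow> x \<in> box a b"
proof
  assume pos: "0 < box_bump a b m x"
  show "x \<in> box a b"
    unfolding mem_box
  proof
    fix i :: 'a assume i: "i \<in> Basis"
    have "step_deriv 0 (m * (x \<bullet> i - a \<bullet> i)) * step_deriv 0 (m * (b \<bullet> i - x \<bullet> i)) \<noteq> 0"
    proof
      assume "step_deriv 0 (m * (x \<bullet> i - a \<bullet> i)) * step_deriv 0 (m * (b \<bullet> i - x \<bullet> i)) = 0"
      then have "box_bump a b m x = 0"
        unfolding box_bump_def by (intro prod_zero finite_Basis bexI[OF _ i])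
      then show False using pos by simp
    qed
    then have "0 < step_deriv 0 (m * (x \<bullet> i - a \<bullet> i))" "0 < step_deriv 0 (m * (b \<bullet> i - x \<bullet> i))"
      using step_nonneg[of "m * (x \<bullet> i - a \<bullet> i)"] step_nonneg[of "m * (b \<bullet> i - x \<bullet> i)"]
      by (simp_all add: order_less_le)
    then show "a \<bullet> i < x \<bullet> i \<and> x \<bullet> i < b \<bullet> i"
      using assms by (simp add: step_pos_iff zero_less_mult_iff)
  qed
next
  assume "x \<in> box a b"
  then show "0 < box_bump a b m x"
    unfolding box_bump_def using assms by (intro prod_pos mult_pos_pos) (auto simp: step_pos_iff mem_box)
qed

lemma box_bump_tendsto_indicator: "(\<lambda>n. box_bump a b (real (Suc n)) x) \<longlonglongrightarrow> indicat_real (box a b) x"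
proof (cases "x \<in> box a b")
  case True
  have lim: "(\<lambda>n. step_deriv 0 (real (Suc n) * t)) \<longlonglongrightarrow> 1" if "t > 0" for t
  proof -
    have "(\<lambda>n. exp (- (inverse (real (Suc n)) * inverse t))) \<longlonglongrightarrow> exp (- (0 * inverse t))"
      by (intro tendsto_intros LIMSEQ_inverse_real_of_nat)
    moreover have "step_deriv 0 (real (Suc n) * t) = exp (- (inverse (real (Suc n)) * inverse t))" for n
      using that by (simp add: step_deriv_def divide_inverse)
    ultimately show ?thesis by simp
  qed
  have "(\<lambda>n. box_bump a b (real (Suc n)) x) \<longlonglongrightarrow> (\<Prod>i\<in>(Basis::'a set). 1 * 1)"
    unfolding box_bump_def by (intro tendsto_prod tendsto_mult lim) (use True in \<open>auto simp: mem_box\<close>)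
  then show ?thesis using True by simp
next
  case False
  then have "box_bump a b (real (Suc n)) x = 0" for n
    using box_bump_pos_iff[of "real (Suc n)" a b x] box_bump_nonneg[of a b "real (Suc n)" x] by simp
  then show ?thesis using False by simp
qed

lemma C_k_box_bump: "C_k k (box_bump a b m)"
proof -
  note coord = C_k_compose_coordinate[where \<beta>=step_deriv and n=0, OF step_deriv_has_derivative]
  have "C_k k (\<lambda>x. \<Prod>i\<in>Basis. step_deriv 0 (m * (x \<bullet> i) + (- m * (a \<bullet> i))) * step_deriv 0 ((-m) * (x \<bullet> i) + m * (b \<bullet> i)))"
    by (rule C_k_prod[OF finite_Basis], rule C_k_mult[OF coord coord])
  moreover have "box_bump a b m =
      (\<lambda>x. \<Prod>i\<in>Basis. step_deriv 0 (m * (x \<bullet> i) + (- m * (a \<bullet> i))) * step_deriv 0 ((-m) * (x \<bullet> i) + m * (b \<bullet> i)))"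
    unfolding box_bump_def by (rule ext, rule prod.cong) (simp_all add: right_diff_distrib)
  ultimately show ?thesis by simp
qed

section \<open>Test functions\<close>

abbreviation partial :: "('a::euclidean_space \<Rightarrow> real) \<Rightarrow> 'a \<Rightarrow> 'a \<Rightarrow> real" where
  "partial f i x \<equiv> frechet_derivative f (at x) i"

lemma test_function_differentiable: "test_function \<phi> \<Longrightarrow> \<phi> differentiable (at x)"
  unfolding test_function_def by (metis C_k.simps(2))

lemma test_function_continuous: "test_function \<phi> \<Longrightarrow> continuous_on UNIV \<phi>"
  unfolding test_function_def using C_k_continuous by blast

lemma test_function_measurable[measurable_dest]: "test_function \<phi> \<Longrightarrow> \<phi> \<in> borel_measurable borel"
  by (intro borel_measurable_continuous_onI test_function_continuous)

lemma test_function_iff: "test_function f \<longleftrightarrow> (\<forall>k. C_k k f) \<and> bounded {x. f x \<noteq> 0}"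
  by (simp add: test_function_def)

lemma test_function_add:
  assumes "test_function f" "test_function g" shows "test_function (\<lambda>x. f x + g x)"
proof -
  have "bounded {x. f x + g x \<noteq> 0}"
    by (rule bounded_subset[of "{x. f x \<noteq> 0} \<union> {x. g x \<noteq> 0}"])
       (use assms in \<open>auto simp: test_function_iff\<close>)
  then show ?thesis
    using assms by (auto simp: test_function_iff intro: C_k_add)
qed

lemma test_function_mult:
  assumes "test_function f" "\<And>k. C_k k g" shows "test_function (\<lambda>x. f x * g x)"
proof -
  have "bounded {x. f x * g x \<noteq> 0}"
    by (rule bounded_subset[of "{x. f x \<noteq> 0}"]) (use assms in \<open>auto simp: test_function_iff\<close>)
  then show ?thesis
    using assms by (auto simp: test_function_iff intro: C_k_mult)
qed

lemma test_function_C_k: "test_function f \<Longrightarrow> C_k k f"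
  by (simp add: test_function_def)

lemma test_function_cmult: "test_function f \<Longrightarrow> test_function (\<lambda>x. c * f x)"
  using test_function_mult[of f "\<lambda>x. c"] by (simp add: C_k_const mult.commute)

lemma test_function_zero: "test_function (\<lambda>x. 0)"
  by (simp add: test_function_def C_k_const)

lemma test_function_partial:
  assumes "test_function f" "i \<in> Basis" shows "test_function (partial f i)"
proof -
  have zero: "partial f i x = 0" if "x \<notin> closure {x. f x \<noteq> 0}" for x
  proof -
    have "(f has_derivative (\<lambda>h. 0)) (at x)"
    proof (rule has_derivative_transform_within_open[where f="\<lambda>x. 0" and s="- closure {x. f x \<noteq> 0}"])
      show "0 = f y" if "y \<in> - closure {x. f x \<noteq> 0}" for y
        using that closure_subset[of "{x. f x \<noteq> 0}"] by auto
    qed (use that in auto)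
    then show ?thesis by (simp add: frechet_derivative_at[symmetric])
  qed
  have "{x. partial f i x \<noteq> 0} \<subseteq> closure {x. f x \<noteq> 0}"
    using zero by blast
  moreover have "bounded (closure {x. f x \<noteq> 0})"
    using assms(1) by (intro bounded_closure) (simp add: test_function_iff)
  ultimately have "bounded {x. partial f i x \<noteq> 0}" by (rule bounded_subset[rotated])
  moreover have "C_k k (partial f i)" for k
    using test_function_C_k[OF assms(1), of "Suc k"] assms(2) by simp
  ultimately show ?thesis by (simp add: test_function_iff)
qed

lemma test_function_translate:
  assumes "test_function f" shows "test_function (\<lambda>x. f (x - c))"
proof -
  have "bounded ((+) c ` {x. f x \<noteq> 0})"
    using assms by (intro bounded_translation) (simp add: test_function_iff)
  moreover have "{x. f (x - c) \<noteq> 0} \<subseteq> (+) c ` {x. f x \<noteq> 0}"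
    by (auto intro!: image_eqI[of _ _ "_ - c"])
  ultimately have "bounded {x. f (x - c) \<noteq> 0}" by (rule bounded_subset)
  then show ?thesis
    using assms by (simp add: test_function_iff C_k_translate)
qed

lemma test_function_box_bump:
  assumes "m > 0" shows "test_function (box_bump a b m)"
proof -
  have "{x. box_bump a b m x \<noteq> 0} \<subseteq> box a b"
    using box_bump_pos_iff[OF assms, of a b] box_bump_nonneg[of a b m] by (auto simp: order_less_le)
  then have "bounded {x. box_bump a b m x \<noteq> 0}" using bounded_box bounded_subset by blast
  then show ?thesis by (simp add: test_function_def C_k_box_bump)
qed

lemma test_function_bounded:
  assumes "test_function f" obtains B where "B > 0" "\<And>x. \<bar>f x\<bar> \<le> B"
proof -
  have "compact (f ` closure {x. f x \<noteq> 0})"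
    by (rule compact_continuous_image)
       (use assms test_function_continuous[OF assms] in \<open>auto simp: test_function_iff intro: continuous_on_subset\<close>)
  then obtain B where B: "\<And>y. y \<in> f ` closure {x. f x \<noteq> 0} \<Longrightarrow> norm y \<le> B"
    by (meson bounded_iff compact_imp_bounded)
  have "\<bar>f x\<bar> \<le> max B 1" for x
    using B[of "f x"] closure_subset[of "{x. f x \<noteq> 0}"] by (cases "f x = 0") fastforce+
  then show thesis by (intro that[of "max B 1"]) auto
qed

lemma test_function_support:
  assumes "test_function f" obtains R where "R > 0" "\<And>x. norm x > R \<Longrightarrow> f x = 0"
proof -
  have "bounded {x. f x \<noteq> 0}"
    using assms by (simp add: test_function_iff)
  then obtain R where "R > 0" "\<And>x. x \<in> {x. f x \<noteq> 0} \<Longrightarrow> norm x \<le> R"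
    by (metis bounded_pos)
  then show thesis by (intro that[of R]) force+
qed

lemma locally_integrable_cball:
  "locally_integrable u \<Longrightarrow> integrable lborel (\<lambda>x. indicator (cball 0 R) x *\<^sub>R u x)"
  unfolding locally_integrable_def set_integrable_def by simp

lemma locally_integrable_measurable[measurable_dest]: "locally_integrable u \<Longrightarrow> u \<in> borel_measurable borel"
  by (simp add: locally_integrable_def)

lemma integrable_mult_bounded_support:
  fixes u \<psi> :: "'a::euclidean_space \<Rightarrow> real"
  assumes "locally_integrable u" "\<psi> \<in> borel_measurable borel" "\<And>x. \<bar>\<psi> x\<bar> \<le> B" "\<And>x. norm x > R \<Longrightarrow> \<psi> x = 0"
  shows "integrable lborel (\<lambda>x. u x * \<psi> x)"
proof (rule Bochner_Integration.integrable_bound)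
  show "integrable lborel (\<lambda>x. B * (indicator (cball 0 R) x *\<^sub>R u x))"
    by (intro integrable_mult_right locally_integrable_cball assms)
  show "(\<lambda>x. u x * \<psi> x) \<in> borel_measurable lborel"
    using assms(2) locally_integrable_measurable[OF assms(1)] by simp
  have "norm (u x * \<psi> x) \<le> norm (B * (indicator (cball 0 R) x *\<^sub>R u x))" for x
  proof (cases "norm x > R")
    case False
    then have "norm (u x * \<psi> x) \<le> \<bar>u x\<bar> * \<bar>B\<bar>"
      using assms(3)[of x] by (auto simp: abs_mult intro: mult_left_mono)
    then show ?thesis using False by (simp add: abs_mult mult.commute)
  qed (simp add: assms(4))
  then show "AE x in lborel. norm (u x * \<psi> x) \<le> norm (B * (indicator (cball 0 R) x *\<^sub>R u x))"
    by simp
qed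

lemma integrable_mult_test_function:
  fixes u :: "'a::euclidean_space \<Rightarrow> real"
  assumes "locally_integrable u" "test_function \<phi>"
  shows "integrable lborel (\<lambda>x. u x * \<phi> x)"
proof -
  obtain B where "\<And>x. \<bar>\<phi> x\<bar> \<le> B" using test_function_bounded[OF assms(2)] by auto
  moreover obtain R where "\<And>x. norm x > R \<Longrightarrow> \<phi> x = 0" using test_function_support[OF assms(2)] by auto
  ultimately show ?thesis
    by (rule integrable_mult_bounded_support[OF assms(1) test_function_measurable[OF assms(2)]])
qed

lemma locally_integrable_const: "locally_integrable (\<lambda>x::'a::euclidean_space. c :: real)"
proof -
  have "integrable lborel (indicat_real K)" if "compact K" for K :: "'a set"
    using that by (simp add: integrable_indicator_iff borel_compact emeasure_compact_finite[unfolded infinity_ennreal_def])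
  then show ?thesis by (simp add: locally_integrable_def set_integrable_def)
qed

lemma locally_integrable_bound:
  fixes u :: "'a::euclidean_space \<Rightarrow> 'b::euclidean_space" and w :: "'a \<Rightarrow> 'c::euclidean_space"
  assumes "locally_integrable u" "w \<in> borel_measurable borel" "AE x in lborel. norm (w x) \<le> norm (u x)"
  shows "locally_integrable w"
  unfolding locally_integrable_def set_integrable_def
proof (intro conjI allI impI)
  fix K :: "'a set" assume K: "compact K"
  then have [measurable]: "K \<in> sets borel" by (simp add: borel_compact)
  show "integrable lborel (\<lambda>x. indicator K x *\<^sub>R w x)"
  proof (rule Bochner_Integration.integrable_bound)
    show "integrable lborel (\<lambda>x. indicator K x *\<^sub>R u x)"
      using assms(1) K by (simp add: locally_integrable_def set_integrable_def)
    show "(\<lambda>x. indicator K x *\<^sub>R w x) \<in> borel_measurable lborel" using assms(2) by simp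
    show "AE x in lborel. norm (indicator K x *\<^sub>R w x) \<le> norm (indicator K x *\<^sub>R u x)"
      using assms(3) by eventually_elim (simp add: mult_left_mono)
  qed
qed (use assms in simp)

lemma locally_integrable_diff:
  assumes "locally_integrable u" "locally_integrable w" shows "locally_integrable (\<lambda>x. u x - w x)"
  using assms by (auto simp: locally_integrable_def intro!: set_integral_diff)

lemma locally_integrable_add:
  assumes "locally_integrable u" "locally_integrable w" shows "locally_integrable (\<lambda>x. u x + w x)"
  using assms by (auto simp: locally_integrable_def intro!: set_integral_add)

lemma locally_integrable_scaleR:
  assumes "locally_integrable u" shows "locally_integrable (\<lambda>x. c *\<^sub>R u x)"
  using assms by (auto simp: locally_integrable_def intro!: set_integrable_scaleR_right)

lemma L2_locally_integrable:
  assumes "L2 lborel (f :: 'a::euclidean_space \<Rightarrow> 'b::euclidean_space)" shows "locally_integrable f"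
  unfolding locally_integrable_def set_integrable_def
proof (intro conjI allI impI)
  fix K :: "'a set" assume K: "compact K"
  then have [measurable]: "K \<in> sets borel" by (simp add: borel_compact)
  have fm[measurable]: "f \<in> borel_measurable borel" using assms by (simp add: L2_def)
  show "integrable lborel (\<lambda>x. indicator K x *\<^sub>R f x)"
  proof (rule Bochner_Integration.integrable_bound)
    have "integrable lborel (indicat_real K)"
      using K by (simp add: integrable_indicator_iff borel_compact emeasure_compact_finite[unfolded infinity_ennreal_def])
    then show "integrable lborel (\<lambda>x. indicat_real K x + (norm (f x))\<^sup>2)"
      using assms by (simp add: L2_def)
    show "AE x in lborel. norm (indicator K x *\<^sub>R f x) \<le> norm (indicat_real K x + (norm (f x))\<^sup>2)"
    proof (rule AE_I2)
      fix x
      have "norm (f x) \<le> 1 + (norm (f x))\<^sup>2"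
        using sum_squares_bound[of "norm (f x)" 1, simplified] norm_ge_zero[of "f x"] by linarith
      then show "norm (indicator K x *\<^sub>R f x) \<le> norm (indicat_real K x + (norm (f x))\<^sup>2)"
        by (auto simp: indicator_def)
    qed
  qed simp
qed (use assms in \<open>simp add: L2_def\<close>)

lemma bounded_support_L2:
  fixes \<psi> :: "'a::euclidean_space \<Rightarrow> real"
  assumes "\<psi> \<in> borel_measurable borel" "\<And>x. \<bar>\<psi> x\<bar> \<le> B" "\<And>x. norm x > R \<Longrightarrow> \<psi> x = 0"
  shows "L2 lborel \<psi>"
proof -
  have "\<bar>\<psi> x\<bar> \<le> \<bar>B\<bar>" for x using assms(2)[of x] by linarith
  then have "locally_integrable \<psi>"
    by (intro locally_integrable_bound[OF locally_integrable_const[of B]] assms(1)) simp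
  from integrable_mult_bounded_support[OF this assms] show ?thesis
    using assms(1) by (simp add: L2_def power2_eq_square)
qed

lemma test_function_L2:
  fixes \<phi> :: "'a::euclidean_space \<Rightarrow> real"
  assumes "test_function \<phi>" shows "L2 lborel \<phi>"
proof -
  obtain B where "\<And>x. \<bar>\<phi> x\<bar> \<le> B" using test_function_bounded[OF assms] by auto
  moreover obtain R where "\<And>x. norm x > R \<Longrightarrow> \<phi> x = 0" using test_function_support[OF assms] by auto
  ultimately show ?thesis by (rule bounded_support_L2[OF test_function_measurable[OF assms]])
qed

section \<open>The fundamental lemma and density of test functions\<close>

lemma test_orthogonal_imp_box_integral_0:
  fixes h :: "'a::euclidean_space \<Rightarrow> real"
  assumes h: "locally_integrable h" and orth: "\<And>\<phi>. test_function \<phi> \<Longrightarrow> (LINT x|lborel. h x * \<phi> x) = 0"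
  shows "(LINT x|lborel. h x * indicator (box a b) x) = 0"
proof -
  have [measurable]: "h \<in> borel_measurable borel" using h by (rule locally_integrable_measurable)
  have T: "test_function (box_bump a b (real (Suc n)))" for n by (intro test_function_box_bump) simp
  note [measurable] = test_function_measurable[OF T]
  have "(\<lambda>n. LINT x|lborel. h x * box_bump a b (real (Suc n)) x) \<longlonglongrightarrow> (LINT x|lborel. h x * indicator (box a b) x)"
  proof (rule integral_dominated_convergence)
    show "AE x in lborel. (\<lambda>n. h x * box_bump a b (real (Suc n)) x) \<longlonglongrightarrow> h x * indicator (box a b) x"
      by (intro AE_I2 tendsto_mult tendsto_const box_bump_tendsto_indicator)
    show "integrable lborel (\<lambda>x. norm (indicator (cbox a b) x *\<^sub>R h x))"
      using h compact_cbox[of a b] by (intro integrable_norm) (simp add: locally_integrable_def set_integrable_def)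
    show "AE x in lborel. norm (h x * box_bump a b (real (Suc n)) x) \<le> norm (indicator (cbox a b) x *\<^sub>R h x)" for n
    proof (rule AE_I2)
      fix x
      show "norm (h x * box_bump a b (real (Suc n)) x) \<le> norm (indicator (cbox a b) x *\<^sub>R h x)"
      proof (cases "x \<in> box a b")
        case True
        then have "x \<in> cbox a b" using box_subset_cbox by blast
        then show ?thesis using box_bump_nonneg[of a b "real (Suc n)" x] box_bump_le_1[of a b "real (Suc n)" x]
          by (simp add: abs_mult mult_left_le)
      next
        case False
        then have "box_bump a b (real (Suc n)) x = 0"
          using box_bump_pos_iff[of "real (Suc n)" a b x] box_bump_nonneg[of a b "real (Suc n)" x] by simp
        then show ?thesis by simp
      qed
    qed
  qed measurable
  moreover have "(\<lambda>n. LINT x|lborel. h x * box_bump a b (real (Suc n)) x) = (\<lambda>n. 0)"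
    using orth[OF T] by simp
  ultimately show ?thesis by (simp add: LIMSEQ_const_iff)
qed

text \<open>
  Boxes are stable under intersection and generate the Borel sets, so vanishing of the integral
  spreads from boxes to all Borel sets. Support in a box makes the whole space behave like a box,
  as closure under complements requires.
\<close>

lemma box_integrals_0_imp_AE_0:
  fixes h :: "'a::euclidean_space \<Rightarrow> real"
  assumes h: "integrable lborel h" and box: "\<And>a b. (LINT x|lborel. h x * indicator (box a b) x) = 0"
    and supp: "\<And>x. x \<notin> box c d \<Longrightarrow> h x = 0"
  shows "AE x in lborel. h x = 0"
proof (rule density_unique_real[OF h])
  have int: "integrable lborel (\<lambda>x. h x * indicator A x)" if "A \<in> sets borel" for A
    using integrable_real_mult_indicator[OF _ h] that by simp
  fix A :: "'a set" assume "A \<in> sets lborel"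
  then have sig: "A \<in> sigma_sets UNIV (range (\<lambda>(a, b). box a b))"
    by (simp add: borel_eq_box)
  have stable: "Int_stable (range (\<lambda>(a, b). box a b :: 'a set))"
    by (auto simp: Int_stable_def box_Int_box)
  have pow: "range (\<lambda>(a, b). box a b :: 'a set) \<subseteq> Pow UNIV" by simp
  from stable pow sig
  have "(LINT x|lborel. h x * indicator A x) = 0"
  proof (induction rule: sigma_sets_induct_disjoint)
    case (basic A)
    then show ?case using box by auto
  next
    case empty
    then show ?case by simp
  next
    case (compl A)
    then have A: "A \<in> sets borel" by (simp add: borel_eq_box)
    have "(LINT x|lborel. h x * indicator (UNIV - A) x) = (LINT x|lborel. h x - h x * indicator A x)"
      by (intro Bochner_Integration.integral_cong) (auto simp: indicator_def)
    also have "\<dots> = (LINT x|lborel. h x) - 0"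
      using compl int[OF A] h by simp
    also have "(LINT x|lborel. h x) = (LINT x|lborel. h x * indicator (box c d) x)"
      using supp by (intro Bochner_Integration.integral_cong) (auto simp: indicator_def)
    finally show ?case using box by simp
  next
    case (union A)
    then have A: "range A \<subseteq> sets borel" by (simp add: borel_eq_box)
    have "(LINT x|lborel. h x * indicator (\<Union>i. A i) x) = (\<Sum>i. LINT x:A i|lborel. h x)"
      using lebesgue_integral_countable_add[of A lborel h] A union.hyps(1) int[of "\<Union>(range A)"]
      by (auto simp: set_lebesgue_integral_def set_integrable_def mult.commute disjoint_family_on_def)
    also have "\<dots> = 0" using union by (simp add: set_lebesgue_integral_def mult.commute)
    finally show ?case .
  qed
  then show "(LINT x:A|lborel. h x) = (LINT x:A|lborel. 0)"
    by (simp add: set_lebesgue_integral_def mult.commute)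
qed simp

text \<open>
  Steeper and steeper bumps tend to indicators of boxes, so the integral of \<open>h\<close> over every
  box vanishes; localizing to an exhausting sequence of boxes makes \<open>h\<close> integrable.
\<close>

theorem fundamental_lemma:
  fixes h :: "'a::euclidean_space \<Rightarrow> real"
  assumes h: "locally_integrable h" and orth: "\<And>\<phi>. test_function \<phi> \<Longrightarrow> (LINT x|lborel. h x * \<phi> x) = 0"
  shows "AE x in lborel. h x = 0"
proof -
  define B :: "nat \<Rightarrow> 'a set" where "B k = box (- (real k *\<^sub>R One)) (real k *\<^sub>R One)" for k
  have "AE x in lborel. h x * indicator (B k) x = 0" for k
  proof (rule box_integrals_0_imp_AE_0)
    have "integrable lborel (\<lambda>x. indicator (cbox (- (real k *\<^sub>R One)) (real k *\<^sub>R One)) x *\<^sub>R h x)"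
      using h compact_cbox unfolding locally_integrable_def set_integrable_def by blast
    then have "integrable lborel (\<lambda>x. indicator (B k) x *\<^sub>R (indicator (cbox (- (real k *\<^sub>R One)) (real k *\<^sub>R One)) x *\<^sub>R h x))"
      by (rule integrable_mult_indicator[rotated]) (simp add: B_def)
    moreover have "indicator (B k) x *\<^sub>R (indicator (cbox (- (real k *\<^sub>R One)) (real k *\<^sub>R One)) x *\<^sub>R h x) = h x * indicator (B k) x" for x
      using box_subset_cbox by (auto simp: B_def indicator_def)
    ultimately show "integrable lborel (\<lambda>x. h x * indicator (B k) x)" by (simp only:)
    show "h x * indicator (B k) x = 0" if "x \<notin> box (- (real k *\<^sub>R One)) (real k *\<^sub>R One)" for x
      using that by (simp add: B_def)
    fix a b :: 'a
    have "\<exists>c d. box a b \<inter> B k = box c d" unfolding B_def box_Int_box by blast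
    then obtain c d where "box a b \<inter> B k = box c d" by blast
    then have "(\<lambda>x. h x * indicator (B k) x * indicator (box a b) x) = (\<lambda>x. h x * indicator (box c d) x)"
      by (metis (no_types, lifting) indicator_inter_arith mult.assoc mult.commute)
    then show "(LINT x|lborel. h x * indicator (B k) x * indicator (box a b) x) = 0"
      using test_orthogonal_imp_box_integral_0[OF assms] by simp
  qed
  then have "AE x in lborel. \<forall>k. h x * indicator (B k) x = 0"
    unfolding AE_all_countable by blast
  then show ?thesis
  proof eventually_elim
    case (elim x)
    obtain k where k: "norm x < real k" using reals_Archimedean2 by blast
    have "x \<in> B k"
      unfolding B_def mem_box
    proof
      fix i :: 'a assume i: "i \<in> Basis"
      have "\<bar>x \<bullet> i\<bar> < real k" using Basis_le_norm[OF i, of x] k by linarith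
      then show "- (real k *\<^sub>R One) \<bullet> i < x \<bullet> i \<and> x \<bullet> i < (real k *\<^sub>R One) \<bullet> i"
        using i by simp linarith
    qed
    then show ?case using elim by (metis indicator_simps(1) mult.right_neutral)
  qed
qed

lemma locally_integrable_component:
  "locally_integrable g \<Longrightarrow> locally_integrable (\<lambda>x. g x \<bullet> i)" if "i \<in> Basis"
  by (rule locally_integrable_bound[of g]) (auto simp: locally_integrable_measurable Basis_le_norm that)

lemma weak_gradient_unique:
  assumes g: "is_weak_gradient u g" and k: "is_weak_gradient u k"
  shows "AE x in lborel. g x = k x"
proof -
  have "AE x in lborel. (g x - k x) \<bullet> i = 0" if i: "i \<in> Basis" for i
  proof (rule fundamental_lemma)
    have li: "locally_integrable g" "locally_integrable k"
      using g k by (auto simp: is_weak_gradient_def)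
    then show "locally_integrable (\<lambda>x. (g x - k x) \<bullet> i)"
      by (intro locally_integrable_component locally_integrable_diff i)
    fix \<phi> :: "'a \<Rightarrow> real" assume \<phi>: "test_function \<phi>"
    then have "(LINT x|lborel. (g x \<bullet> i) * \<phi> x) = (LINT x|lborel. (k x \<bullet> i) * \<phi> x)"
      using g k i unfolding is_weak_gradient_def by (metis neg_equal_iff_equal)
    then show "(LINT x|lborel. (g x - k x) \<bullet> i * \<phi> x) = 0"
      using integrable_mult_test_function[OF locally_integrable_component[OF i li(1)] \<phi>]
        integrable_mult_test_function[OF locally_integrable_component[OF i li(2)] \<phi>]
      by (simp add: inner_diff_left left_diff_distrib)
  qed
  then have "AE x in lborel. \<forall>i\<in>Basis. (g x - k x) \<bullet> i = 0"
    by (intro AE_finite_allI) auto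
  then show ?thesis by eventually_elim (metis euclidean_all_zero_iff right_minus_eq)
qed

text \<open>
  The part of \<open>\<psi>\<close> orthogonal to all test functions vanishes by the fundamental lemma.
\<close>

theorem test_functions_dense_L2:
  fixes \<psi> :: "'a::euclidean_space \<Rightarrow> real"
  assumes \<psi>: "L2 lborel \<psi>"
  obtains s where "\<And>n. test_function (s n)" "(\<lambda>n. normsq lborel (\<lambda>x. s n x - \<psi> x)) \<longlonglongrightarrow> 0"
proof -
  obtain g s where g: "L2 lborel g" and s: "\<And>n. s n \<in> Collect test_function"
    "(\<lambda>n. normsq lborel (\<lambda>x. s n x - g x)) \<longlonglongrightarrow> 0"
    and orth: "\<And>f. f \<in> Collect test_function \<Longrightarrow> (LINT x|lborel. (\<psi> x - g x) \<bullet> f x) = 0"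
    by (rule L2_projection[OF \<psi>, of "Collect test_function"])
      (auto simp: test_function_L2 test_function_zero test_function_add test_function_cmult)
  have "AE x in lborel. \<psi> x - g x = 0"
    using orth by (intro fundamental_lemma L2_locally_integrable L2_diff \<psi> g) simp
  then have "normsq lborel (\<lambda>x. s n x - g x) = normsq lborel (\<lambda>x. s n x - \<psi> x)" for n
    unfolding normsq_def using g \<psi> test_function_L2[of "s n"] s(1)[of n]
    by (intro integral_cong_AE) (auto simp: L2_def)
  with s that[of s] show thesis by simp
qed

section \<open>Translations and integration by parts\<close>

lemma lborel_integral_translate:
  fixes f :: "'a::euclidean_space \<Rightarrow> real"
  assumes "f \<in> borel_measurable borel"
  shows "(LINT x|lborel. f (x + c)) = (LINT x|lborel. f x)"
proof -
  have "(LINT x|lborel. f x) = (LINT x|distr lborel borel ((+) c). f x)"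
    by (simp add: lborel_distr_plus)
  also have "\<dots> = (LINT x|lborel. f (c + x))" using assms by (subst integral_distr) auto
  finally show ?thesis by (simp add: add.commute)
qed

lemma lborel_integrable_translate:
  fixes f :: "'a::euclidean_space \<Rightarrow> real"
  assumes "integrable lborel f"
  shows "integrable lborel (\<lambda>x. f (x + c))"
proof -
  have "integrable (distr lborel borel ((+) c)) f" using assms by (simp add: lborel_distr_plus)
  then have "integrable lborel (\<lambda>x. f (c + x))" using assms by (subst (asm) integrable_distr_eq) auto
  then show ?thesis by (simp add: add.commute)
qed

lemma test_function_line_derivative:
  assumes "test_function \<phi>"
  shows "((\<lambda>t. \<phi> (x - t *\<^sub>R e)) has_real_derivative - partial \<phi> e (x - t *\<^sub>R e)) (at t)"
proof -
  let ?D = "frechet_derivative \<phi> (at (x - t *\<^sub>R e))"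
  have D: "(\<phi> has_derivative ?D) (at (x - t *\<^sub>R e))"
    using test_function_differentiable[OF assms] by (simp add: frechet_derivative_works)
  have "((\<lambda>t. x - t *\<^sub>R e) has_derivative (\<lambda>h. - (h *\<^sub>R e))) (at t)"
    by (auto intro!: derivative_eq_intros)
  from has_derivative_compose[OF this D]
  have "((\<lambda>t. \<phi> (x - t *\<^sub>R e)) has_derivative (\<lambda>h. ?D (- (h *\<^sub>R e)))) (at t)" .
  moreover have "(\<lambda>h. ?D (- (h *\<^sub>R e))) = (*) (- ?D e)"
    using has_derivative_bounded_linear[OF D]
    by (auto simp: linear_cmul linear_neg bounded_linear.linear)
  ultimately show ?thesis by (simp add: has_field_derivative_def)
qed

lemma test_function_line_Lipschitz:
  assumes \<phi>: "test_function \<phi>" and B: "\<And>y. \<bar>partial \<phi> e y\<bar> \<le> B"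
  shows "\<bar>\<phi> (x - s *\<^sub>R e) - \<phi> (x - t *\<^sub>R e)\<bar> \<le> B * \<bar>s - t\<bar>"
proof -
  have "norm (\<phi> (x - s *\<^sub>R e) - \<phi> (x - t *\<^sub>R e)) \<le> B * norm (s - t)"
    by (rule field_differentiable_bound[where S=UNIV and f'="\<lambda>t. - partial \<phi> e (x - t *\<^sub>R e)"])
      (use test_function_line_derivative[OF \<phi>] B in auto)
  then show ?thesis by simp
qed

text \<open>
  Translating the test function turns weak derivatives into ordinary derivatives in one real
  parameter, to which the mean value theorem applies. The dominating function comes from
  the Lipschitz bound for \<open>\<phi>\<close> and from the common bounded support of the translates.
\<close>

lemma derivative_integral_translate:
  fixes u :: "'a::euclidean_space \<Rightarrow> real"
  assumes u: "locally_integrable u" and \<phi>: "test_function \<phi>" and e: "e \<in> Basis"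
  shows "((\<lambda>t. LINT x|lborel. u x * \<phi> (x - t *\<^sub>R e)) has_real_derivative
      - (LINT x|lborel. u x * partial \<phi> e (x - t *\<^sub>R e))) (at t)"
proof -
  have [measurable]: "u \<in> borel_measurable borel" using u by (rule locally_integrable_measurable)
  have T: "test_function (\<lambda>x. \<phi> (x - c))" for c by (rule test_function_translate[OF \<phi>])
  note [measurable] = test_function_measurable[OF T]
  have [measurable]: "(\<lambda>x. partial \<phi> e (x - c)) \<in> borel_measurable borel" for c
    by (intro test_function_measurable test_function_translate test_function_partial \<phi> e)
  obtain B where B: "B > 0" "\<And>y. \<bar>partial \<phi> e y\<bar> \<le> B"
    using test_function_bounded[OF test_function_partial[OF \<phi> e]] by auto
  obtain R where R: "R > 0" "\<And>x. norm x > R \<Longrightarrow> \<phi> x = 0"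
    using test_function_support[OF \<phi>] by auto
  define q where "q h x = (\<phi> (x - (t + h) *\<^sub>R e) - \<phi> (x - t *\<^sub>R e)) / h" for h x
  have qlim: "((\<lambda>h. q h x) \<longlongrightarrow> - partial \<phi> e (x - t *\<^sub>R e)) (at 0)" for x
    using test_function_line_derivative[OF \<phi>, of x e t] by (simp add: DERIV_def q_def)
  have qB: "\<bar>q h x\<bar> \<le> B" if "h \<noteq> 0" for h x
    using test_function_line_Lipschitz[OF \<phi> B(2), of x "t + h" t] that
    by (simp add: q_def divide_le_eq)
  have eq: "((LINT x|lborel. u x * \<phi> (x - (t + h) *\<^sub>R e)) - (LINT x|lborel. u x * \<phi> (x - t *\<^sub>R e))) / h
      = (LINT x|lborel. u x * q h x)" for h
  proof -
    have "(LINT x|lborel. u x * q h x) = (LINT x|lborel. (u x * \<phi> (x - (t + h) *\<^sub>R e) - u x * \<phi> (x - t *\<^sub>R e)) / h)"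
      by (rule Bochner_Integration.integral_cong) (simp_all add: q_def right_diff_distrib)
    also have "\<dots> = (LINT x|lborel. u x * \<phi> (x - (t + h) *\<^sub>R e) - u x * \<phi> (x - t *\<^sub>R e)) / h"
      by (rule integral_divide_zero)
    finally show ?thesis
      using Bochner_Integration.integral_diff[OF integrable_mult_test_function[OF u T, of "(t + h) *\<^sub>R e"]
        integrable_mult_test_function[OF u T, of "t *\<^sub>R e"]] by (simp only:)
  qed
  have "((\<lambda>h. LINT x|lborel. u x * q h x) \<longlongrightarrow> (LINT x|lborel. u x * - partial \<phi> e (x - t *\<^sub>R e))) (at 0)"
    unfolding tendsto_at_iff_sequentially o_def
  proof (intro allI impI)
    fix X :: "nat \<Rightarrow> real" assume X: "\<forall>i. X i \<in> UNIV - {0}" "X \<longlonglongrightarrow> 0"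
    obtain K where K: "\<And>n. \<bar>X n\<bar> \<le> K"
      using convergent_imp_Bseq[of X] X(2) by (auto simp: convergent_def Bseq_def)
    define r where "r = R + \<bar>t\<bar> + K"
    have q0: "q (X n) x = 0" if "norm x > r" for n x
    proof -
      have *: "norm (x - c *\<^sub>R e) > R" if "\<bar>c\<bar> \<le> \<bar>t\<bar> + K" for c
        using norm_triangle_ineq2[of x "c *\<^sub>R e"] \<open>norm x > r\<close> that e by (simp add: r_def)
      have "\<phi> (x - (t + X n) *\<^sub>R e) = 0" "\<phi> (x - t *\<^sub>R e) = 0"
        using K[of n] by (auto intro!: R(2) *)
      then show ?thesis by (simp add: q_def)
    qed
    show "(\<lambda>n. LINT x|lborel. u x * q (X n) x) \<longlonglongrightarrow> (LINT x|lborel. u x * - partial \<phi> e (x - t *\<^sub>R e))"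
    proof (rule integral_dominated_convergence)
      show "integrable lborel (\<lambda>x. B * norm (indicator (cball 0 r) x *\<^sub>R u x))"
        by (intro integrable_mult_right integrable_norm locally_integrable_cball u)
      show "AE x in lborel. (\<lambda>n. u x * q (X n) x) \<longlonglongrightarrow> u x * - partial \<phi> e (x - t *\<^sub>R e)"
        using qlim[unfolded tendsto_at_iff_sequentially o_def] X
        by (intro AE_I2 tendsto_mult tendsto_const) blast
      show "AE x in lborel. norm (u x * q (X n) x) \<le> B * norm (indicator (cball 0 r) x *\<^sub>R u x)" for n
      proof (rule AE_I2)
        fix x
        show "norm (u x * q (X n) x) \<le> B * norm (indicator (cball 0 r) x *\<^sub>R u x)"
        proof (cases "norm x > r")
          case False
          then show ?thesis using mult_right_mono[OF qB[of "X n" x] abs_ge_zero[of "u x"]] X(1)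
            by (simp add: abs_mult mult.commute)
        qed (simp add: q0)
      qed
      show "(\<lambda>x. u x * - partial \<phi> e (x - t *\<^sub>R e)) \<in> borel_measurable lborel" by measurable
      show "(\<lambda>x. u x * q (X n) x) \<in> borel_measurable lborel" for n unfolding q_def by measurable
    qed
  qed
  then show ?thesis unfolding DERIV_def eq by simp
qed

text \<open>
  The integral of a translate does not depend on the translation.
\<close>

lemma integral_partial_0:
  fixes \<phi> :: "'a::euclidean_space \<Rightarrow> real"
  assumes \<phi>: "test_function \<phi>" and e: "e \<in> Basis"
  shows "(LINT x|lborel. partial \<phi> e x) = 0"
proof -
  have "(LINT x|lborel. \<phi> (x - t *\<^sub>R e)) = (LINT x|lborel. \<phi> x)" for t
    using lborel_integral_translate[OF test_function_measurable[OF \<phi>], of "- (t *\<^sub>R e)"] by simp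
  then have "((\<lambda>t. LINT x|lborel. \<phi> (x - t *\<^sub>R e)) has_real_derivative 0) (at 0)" by simp
  moreover have "((\<lambda>t. LINT x|lborel. \<phi> (x - t *\<^sub>R e)) has_real_derivative - (LINT x|lborel. partial \<phi> e x)) (at 0)"
    using derivative_integral_translate[OF locally_integrable_const[of 1] \<phi> e, of 0] by simp
  ultimately show ?thesis using DERIV_unique by fastforce
qed

lemma test_function_weak_gradient:
  fixes \<phi> :: "'a::euclidean_space \<Rightarrow> real"
  assumes \<phi>: "test_function \<phi>"
  shows "is_weak_gradient \<phi> (\<lambda>x. \<Sum>i\<in>Basis. partial \<phi> i x *\<^sub>R i)"
    "L2 lborel (\<lambda>x. \<Sum>i\<in>Basis. partial \<phi> i x *\<^sub>R i)"
proof -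
  have P: "test_function (partial \<phi> i)" if "i \<in> Basis" for i
    using \<phi> that by (rule test_function_partial)
  have fin: "L2 lborel (\<lambda>x. \<Sum>i\<in>A. partial \<phi> i x *\<^sub>R i)" if "finite A" "A \<subseteq> Basis" for A
    using that
  proof (induction A rule: finite_induct)
    case empty
    then show ?case by (simp add: L2_def)
  next
    case (insert i A)
    then have "L2 lborel (\<lambda>x. partial \<phi> i x *\<^sub>R i)"
      using test_function_L2[OF P, of i] by (auto simp: L2_def power_mult_distrib)
    with insert show ?case by (auto intro: L2_add)
  qed
  then show L: "L2 lborel (\<lambda>x. \<Sum>i\<in>Basis. partial \<phi> i x *\<^sub>R i)" by simp
  have "(LINT x|lborel. \<phi> x * partial \<psi> i x) = - (LINT x|lborel. partial \<phi> i x * \<psi> x)"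
    if \<psi>: "test_function \<psi>" and i: "i \<in> Basis" for \<psi> i
  proof -
    have "integrable lborel (\<lambda>x. \<phi> x * partial \<psi> i x)" "integrable lborel (\<lambda>x. partial \<phi> i x * \<psi> x)"
      by (intro integrable_mult_test_function L2_locally_integrable test_function_L2 P \<phi> \<psi> i test_function_partial)+
    moreover have "(LINT x|lborel. \<phi> x * partial \<psi> i x + partial \<phi> i x * \<psi> x) = 0"
      using integral_partial_0[OF test_function_mult[OF \<phi> test_function_C_k[OF \<psi>]] i]
      by (simp add: frechet_derivative_mult_real test_function_differentiable \<phi> \<psi>)
    ultimately show ?thesis by simp
  qed
  then show "is_weak_gradient \<phi> (\<lambda>x. \<Sum>i\<in>Basis. partial \<phi> i x *\<^sub>R i)"
    unfolding is_weak_gradient_def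
    using L test_function_L2[OF \<phi>] by (auto simp: L2_locally_integrable)
qed

section \<open>Difference quotients converge weakly\<close>

definition diff_quot :: "real \<Rightarrow> 'a::euclidean_space \<Rightarrow> ('a \<Rightarrow> real) \<Rightarrow> 'a \<Rightarrow> real" where
  "diff_quot t e v x = (v (x + t *\<^sub>R e) - v x) / t"

lemma L2_translate:
  fixes v :: "'a::euclidean_space \<Rightarrow> real"
  assumes "L2 lborel v" shows "L2 lborel (\<lambda>x. v (x + c))"
  using assms lborel_integrable_translate[of "\<lambda>x. (norm (v x))\<^sup>2" c]
  by (auto simp: L2_def)

lemma normsq_translate:
  fixes v :: "'a::euclidean_space \<Rightarrow> real"
  assumes "v \<in> borel_measurable borel" shows "normsq lborel (\<lambda>x. v (x + c)) = normsq lborel v"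
  unfolding normsq_def using assms by (intro lborel_integral_translate) simp

lemma L2_diff_quot:
  assumes "L2 lborel v" shows "L2 lborel (diff_quot t e v)"
proof -
  have "L2 lborel (\<lambda>x. (1/t) *\<^sub>R (v (x + t *\<^sub>R e) - v x))"
    by (intro L2_scaleR L2_diff L2_translate assms)
  then show ?thesis by (simp add: diff_quot_def[abs_def])
qed

lemma integral_diff_quot_test:
  fixes v :: "'a::euclidean_space \<Rightarrow> real"
  assumes v: "locally_integrable v" and \<phi>: "test_function \<phi>"
  shows "integrable lborel (\<lambda>x. diff_quot t e v x * \<phi> x)"
    "(LINT x|lborel. diff_quot t e v x * \<phi> x) =
      ((LINT x|lborel. v x * \<phi> (x - t *\<^sub>R e)) - (LINT x|lborel. v x * \<phi> (x - 0 *\<^sub>R e))) / t"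
proof -
  have [measurable]: "v \<in> borel_measurable borel" using v by (rule locally_integrable_measurable)
  have i1: "integrable lborel (\<lambda>x. v x * \<phi> (x - t *\<^sub>R e))"
    by (intro integrable_mult_test_function v test_function_translate \<phi>)
  have i2: "integrable lborel (\<lambda>x. v x * \<phi> x)"
    by (intro integrable_mult_test_function v \<phi>)
  have i3: "integrable lborel (\<lambda>x. v (x + t *\<^sub>R e) * \<phi> x)"
    using lborel_integrable_translate[OF i1, of "t *\<^sub>R e"] by simp
  have e3: "(LINT x|lborel. v (x + t *\<^sub>R e) * \<phi> x) = (LINT x|lborel. v x * \<phi> (x - t *\<^sub>R e))"
    using lborel_integral_translate[OF borel_measurable_integrable[OF i1, simplified], of "t *\<^sub>R e"] by simp
  have eq: "diff_quot t e v x * \<phi> x = (v (x + t *\<^sub>R e) * \<phi> x - v x * \<phi> x) / t" for x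
    by (simp add: diff_quot_def left_diff_distrib)
  show "integrable lborel (\<lambda>x. diff_quot t e v x * \<phi> x)"
    unfolding eq by (intro integrable_divide Bochner_Integration.integrable_diff i3 i2)
  show "(LINT x|lborel. diff_quot t e v x * \<phi> x) =
      ((LINT x|lborel. v x * \<phi> (x - t *\<^sub>R e)) - (LINT x|lborel. v x * \<phi> (x - 0 *\<^sub>R e))) / t"
    unfolding eq integral_divide_zero Bochner_Integration.integral_diff[OF i3 i2] e3 by simp
qed

lemma diff_quot_test_limit:
  fixes v :: "'a::euclidean_space \<Rightarrow> real"
  assumes v: "locally_integrable v" and \<phi>: "test_function \<phi>" and e: "e \<in> Basis"
  shows "((\<lambda>t. LINT x|lborel. diff_quot t e v x * \<phi> x) \<longlongrightarrow> - (LINT x|lborel. v x * partial \<phi> e x)) (at 0)"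
  using derivative_integral_translate[OF v \<phi> e, of 0]
  by (simp add: DERIV_def integral_diff_quot_test(2)[OF v \<phi>])

lemma normsq_tendsto:
  assumes "\<And>n. L2 M (s n)" "L2 M g" "(\<lambda>n. normsq M (\<lambda>x. s n x - g x)) \<longlonglongrightarrow> 0"
  shows "(\<lambda>n. normsq M (s n)) \<longlonglongrightarrow> normsq M g"
proof -
  have D: "L2 M (\<lambda>x. s n x - g x)" for n by (intro L2_diff assms)
  have "(\<lambda>n. normsq M (\<lambda>x. (s n x - g x) - 0)) \<longlonglongrightarrow> 0" using assms(3) by simp
  then have "(\<lambda>n. LINT x|M. (s n x - g x) \<bullet> g x) \<longlonglongrightarrow> (LINT x|M. 0 \<bullet> g x)"
    by (intro L2_inner_tendsto D assms(2)) (auto simp: L2_def)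
  then have "(\<lambda>n. LINT x|M. (s n x - g x) \<bullet> g x) \<longlonglongrightarrow> 0" by simp
  then have "(\<lambda>n. normsq M (\<lambda>x. s n x - g x) + 2 * 1 * (LINT x|M. (s n x - g x) \<bullet> g x) + 1\<^sup>2 * normsq M g)
      \<longlonglongrightarrow> 0 + 2 * 1 * 0 + 1\<^sup>2 * normsq M g"
    by (intro tendsto_intros assms(3))
  then show ?thesis using normsq_add[OF D assms(2), of _ 1] by simp
qed

text \<open>
  The pairing of a difference quotient with a test function is, by the mean value theorem, the
  pairing of the weak derivative with some translate of the test function. Translations preserve
  the norm, and density of the test functions turns this into a norm bound.
\<close>

lemma normsq_diff_quot_le:
  fixes v :: "'a::euclidean_space \<Rightarrow> real"
  assumes v: "L2 lborel v" and w: "is_weak_gradient v g" and e: "e \<in> Basis"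
    and \<gamma>: "L2 lborel (\<lambda>x. g x \<bullet> e)" and t: "t \<noteq> 0"
  shows "normsq lborel (diff_quot t e v) \<le> normsq lborel (\<lambda>x. g x \<bullet> e)"
proof -
  note li = L2_locally_integrable[OF v]
  have key: "(LINT x|lborel. diff_quot t e v x * \<phi> x)\<^sup>2 \<le> normsq lborel \<phi> * normsq lborel (\<lambda>x. g x \<bullet> e)"
    if \<phi>: "test_function \<phi>" for \<phi>
  proof -
    define f where "f t = (LINT x|lborel. v x * \<phi> (x - t *\<^sub>R e))" for t
    define f' where "f' t = (LINT x|lborel. (g x \<bullet> e) * \<phi> (x - t *\<^sub>R e))" for t
    have der: "(f has_real_derivative f' t) (at t)" for t
    proof -
      have "test_function (\<lambda>x. \<phi> (x - t *\<^sub>R e))" by (rule test_function_translate[OF \<phi>])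
      then have "(LINT x|lborel. v x * partial (\<lambda>x. \<phi> (x - t *\<^sub>R e)) e x) = - f' t"
        using w e unfolding is_weak_gradient_def f'_def by blast
      then have "(LINT x|lborel. v x * partial \<phi> e (x - t *\<^sub>R e)) = - f' t"
        by (simp add: frechet_derivative_translate(2) test_function_differentiable \<phi>)
      then show ?thesis
        using derivative_integral_translate[OF li \<phi> e, of t] by (simp add: f_def[abs_def])
    qed
    have "\<exists>z. f t - f 0 = t * f' z"
    proof (cases "t > 0")
      case True
      from MVT2[OF True der] show ?thesis by auto
    next
      case False
      then have "t < 0" using t by simp
      from MVT2[OF this der] obtain z where "f 0 - f t = (0 - t) * f' z" by auto
      then show ?thesis by (intro exI[of _ z]) simp
    qed
    then obtain z where z: "f t - f 0 = t * f' z" ..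
    then have "(LINT x|lborel. diff_quot t e v x * \<phi> x) = f' z"
      using t by (simp add: integral_diff_quot_test(2)[OF li \<phi>] f_def)
    moreover have "(f' z)\<^sup>2 \<le> normsq lborel (\<lambda>x. g x \<bullet> e) * normsq lborel (\<lambda>x. \<phi> (x - z *\<^sub>R e))"
      using L2_Cauchy_Schwarz[OF \<gamma> test_function_L2[OF test_function_translate[OF \<phi>, of "z *\<^sub>R e"]]]
      by (simp add: f'_def)
    moreover have "normsq lborel (\<lambda>x. \<phi> (x - z *\<^sub>R e)) = normsq lborel \<phi>"
      using normsq_translate[OF test_function_measurable[OF \<phi>], of "- (z *\<^sub>R e)"] by simp
    ultimately show ?thesis by (simp add: mult.commute)
  qed
  note D = L2_diff_quot[OF v, of t e]
  obtain s where s: "\<And>n. test_function (s n)" "(\<lambda>n. normsq lborel (\<lambda>x. s n x - diff_quot t e v x)) \<longlonglongrightarrow> 0"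
    using test_functions_dense_L2[OF D] by blast
  have "(\<lambda>n. LINT x|lborel. s n x \<bullet> diff_quot t e v x) \<longlonglongrightarrow> (LINT x|lborel. diff_quot t e v x \<bullet> diff_quot t e v x)"
    by (intro L2_inner_tendsto test_function_L2 s D)
  then have l1: "(\<lambda>n. (LINT x|lborel. diff_quot t e v x * s n x)\<^sup>2) \<longlonglongrightarrow> (normsq lborel (diff_quot t e v))\<^sup>2"
    by (intro tendsto_power) (simp add: normsq_def power2_eq_square mult.commute)
  have l2: "(\<lambda>n. normsq lborel (s n) * normsq lborel (\<lambda>x. g x \<bullet> e)) \<longlonglongrightarrow>
      normsq lborel (diff_quot t e v) * normsq lborel (\<lambda>x. g x \<bullet> e)"
    by (intro tendsto_mult tendsto_const normsq_tendsto test_function_L2 s D)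
  have "(normsq lborel (diff_quot t e v))\<^sup>2 \<le> normsq lborel (diff_quot t e v) * normsq lborel (\<lambda>x. g x \<bullet> e)"
    using LIMSEQ_le[OF l1 l2] key s(1) by blast
  then show ?thesis
    using normsq_nonneg[of lborel "diff_quot t e v"] normsq_nonneg[of lborel "\<lambda>x. g x \<bullet> e"]
    by (cases "normsq lborel (diff_quot t e v) = 0") (auto simp: power2_eq_square mult_le_cancel_left)
qed

text \<open>
  Against test functions this is the definition of the weak derivative. The uniform bound on the
  difference quotients extends it to every square integrable \<open>\<psi>\<close>.
\<close>

lemma diff_quot_weak_limit:
  fixes v :: "'a::euclidean_space \<Rightarrow> real"
  assumes v: "L2 lborel v" and w: "is_weak_gradient v g" and e: "e \<in> Basis"
    and \<gamma>: "L2 lborel (\<lambda>x. g x \<bullet> e)" and \<psi>: "L2 lborel \<psi>"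
    and X: "\<And>n. X n \<noteq> 0" "X \<longlonglongrightarrow> 0"
  shows "(\<lambda>n. LINT x|lborel. diff_quot (X n) e v x * \<psi> x) \<longlonglongrightarrow> (LINT x|lborel. (g x \<bullet> e) * \<psi> x)"
proof (rule LIMSEQ_I)
  fix r :: real assume r: "r > 0"
  define C where "C = normsq lborel (\<lambda>x. g x \<bullet> e)"
  have C: "C \<ge> 0" by (simp add: C_def normsq_nonneg)
  define d where "d n x = diff_quot (X n) e v x - g x \<bullet> e" for n x
  have dL: "L2 lborel (d n)" for n
    unfolding d_def by (intro L2_diff L2_diff_quot v \<gamma>)
  have dC: "normsq lborel (d n) \<le> 4 * C" for n
  proof -
    have "normsq lborel (\<lambda>x. diff_quot (X n) e v x - g x \<bullet> e) \<le>
       2 * normsq lborel (\<lambda>x. diff_quot (X n) e v x - 0) + 2 * normsq lborel (\<lambda>x. 0 - g x \<bullet> e)"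
      by (intro normsq_triangle L2_diff_quot v \<gamma>) (simp add: L2_def)
    moreover have "normsq lborel (\<lambda>x. 0 - g x \<bullet> e) = C" by (simp add: normsq_def C_def)
    moreover have "normsq lborel (\<lambda>x. diff_quot (X n) e v x - 0) \<le> C"
      using normsq_diff_quot_le[OF v w e \<gamma> X(1)] by (simp add: C_def)
    ultimately show ?thesis unfolding d_def by linarith
  qed
  define \<delta> where "\<delta> = (r / 2)\<^sup>2 / (4 * C + 1)"
  have \<delta>: "\<delta> > 0" using r C by (simp add: \<delta>_def)
  obtain s where s: "\<And>n. test_function (s n)" "(\<lambda>n. normsq lborel (\<lambda>x. s n x - \<psi> x)) \<longlonglongrightarrow> 0"
    using test_functions_dense_L2[OF \<psi>] by blast
  obtain m where m: "normsq lborel (\<lambda>x. s m x - \<psi> x) < \<delta>"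
    using order_tendstoD(2)[OF s(2) \<delta>] by (auto simp: eventually_sequentially)
  define \<phi> where "\<phi> = s m"
  have \<phi>: "test_function \<phi>" "L2 lborel \<phi>" using s(1) test_function_L2 by (auto simp: \<phi>_def)
  have small: "\<bar>LINT x|lborel. d n x * (\<psi> x - \<phi> x)\<bar> \<le> r / 2" for n
  proof -
    have "(LINT x|lborel. d n x * (\<psi> x - \<phi> x))\<^sup>2 \<le> normsq lborel (d n) * normsq lborel (\<lambda>x. \<psi> x - \<phi> x)"
      using L2_Cauchy_Schwarz[OF dL L2_diff[OF \<psi> \<phi>(2)]] by simp
    also have "\<dots> \<le> (4 * C) * \<delta>"
      using m C \<delta> dC by (intro mult_mono) (auto simp: normsq_nonneg \<phi>_def normsq_diff_comm[of _ \<psi>])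
    also have "\<dots> \<le> (r / 2)\<^sup>2"
      using C by (simp add: \<delta>_def divide_simps) (simp add: algebra_simps)
    finally show ?thesis using r by (simp add: abs_le_square_iff[symmetric])
  qed
  have "(\<lambda>n. LINT x|lborel. diff_quot (X n) e v x * \<phi> x) \<longlonglongrightarrow> - (LINT x|lborel. v x * partial \<phi> e x)"
    using diff_quot_test_limit[OF L2_locally_integrable[OF v] \<phi>(1) e] X
    unfolding tendsto_at_iff_sequentially o_def by blast
  moreover have "- (LINT x|lborel. v x * partial \<phi> e x) = (LINT x|lborel. (g x \<bullet> e) * \<phi> x)"
    using w e \<phi>(1) unfolding is_weak_gradient_def by (metis minus_minus)
  ultimately have lim: "(\<lambda>n. LINT x|lborel. diff_quot (X n) e v x * \<phi> x) \<longlonglongrightarrow> (LINT x|lborel. (g x \<bullet> e) * \<phi> x)"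
    by (simp only:)
  have "\<forall>\<^sub>F n in sequentially. \<bar>(LINT x|lborel. diff_quot (X n) e v x * \<phi> x) - (LINT x|lborel. (g x \<bullet> e) * \<phi> x)\<bar> < r / 2"
    using tendstoD[OF lim half_gt_zero[OF r]] by (simp add: dist_real_def)
  then obtain n0 where n0: "\<And>n. n \<ge> n0 \<Longrightarrow>
      \<bar>(LINT x|lborel. diff_quot (X n) e v x * \<phi> x) - (LINT x|lborel. (g x \<bullet> e) * \<phi> x)\<bar> < r / 2"
    by (auto simp: eventually_sequentially)
  have "norm ((LINT x|lborel. diff_quot (X n) e v x * \<psi> x) - (LINT x|lborel. (g x \<bullet> e) * \<psi> x)) < r" if "n \<ge> n0" for n
  proof -
    have i: "integrable lborel (\<lambda>x. diff_quot (X n) e v x * f x)" "integrable lborel (\<lambda>x. (g x \<bullet> e) * f x)"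
      if "L2 lborel f" for f
      by (intro L2_mult_integrable L2_diff_quot v \<gamma> that)+
    have "(LINT x|lborel. d n x * (\<psi> x - \<phi> x)) =
        ((LINT x|lborel. diff_quot (X n) e v x * \<psi> x) - (LINT x|lborel. (g x \<bullet> e) * \<psi> x))
        - ((LINT x|lborel. diff_quot (X n) e v x * \<phi> x) - (LINT x|lborel. (g x \<bullet> e) * \<phi> x))"
      using i[OF \<psi>] i[OF \<phi>(2)] by (simp add: d_def left_diff_distrib right_diff_distrib)
    then show ?thesis using small[of n] n0[OF that] by (simp add: abs_if split: if_splits)
  qed
  then show "\<exists>n0. \<forall>n\<ge>n0. norm ((LINT x|lborel. diff_quot (X n) e v x * \<psi> x) - (LINT x|lborel. (g x \<bullet> e) * \<psi> x)) < r"
    by blast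
qed

section \<open>Truncations of weakly differentiable functions\<close>

text \<open>
  The subgradient inequality for the convex function \<open>max 0 (s - c)\<close>, with the subgradient chosen
  to be zero at the kink.
\<close>

lemma truncation_convex:
  "indicator {c<..} a * (b - a) \<le> max 0 (b - c) - max 0 (a - c)" for a b c :: real
  by (auto simp: indicator_def)

text \<open>
  For a nonnegative test function the subgradient inequality compares the difference quotients of
  the truncation with the cut-off difference quotients of \<open>v\<close>. Dividing by a positive or by a
  negative increment gives opposite inequalities with the same limit. A general test function
  is a difference of two nonnegative ones.
\<close>

lemma truncation_weak_gradient:
  fixes v :: "'a::euclidean_space \<Rightarrow> real"
  assumes v: "L2 lborel v" and w: "is_weak_gradient v g" and g: "L2 lborel g"
  shows "is_weak_gradient (\<lambda>x. max 0 (v x - c)) (\<lambda>x. indicator {c<..} (v x) *\<^sub>R g x)"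
proof -
  let ?w = "\<lambda>x. max 0 (v x - c)" and ?I = "\<lambda>x. indicat_real {c<..} (v x)"
  have vm[measurable]: "v \<in> borel_measurable borel" and gm[measurable]: "g \<in> borel_measurable borel"
    using v g by (auto simp: L2_def)
  have Im[measurable]: "?I \<in> borel_measurable borel" by simp
  have "locally_integrable (\<lambda>x. v x - c)"
    by (intro locally_integrable_diff L2_locally_integrable v locally_integrable_const)
  then have lw: "locally_integrable ?w"
    by (rule locally_integrable_bound) auto
  have lg: "locally_integrable (\<lambda>x. ?I x *\<^sub>R g x)"
    by (rule locally_integrable_bound[OF L2_locally_integrable[OF g]]) (auto simp: indicator_def)
  have nonneg: "(LINT x|lborel. ?w x * partial \<phi> e x) = - (LINT x|lborel. (?I x *\<^sub>R g x \<bullet> e) * \<phi> x)"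
    if \<phi>: "test_function \<phi>" and e: "e \<in> Basis" and pos: "\<And>x. \<phi> x \<ge> 0" for \<phi> e
  proof -
    have [measurable]: "\<phi> \<in> borel_measurable borel" by (rule test_function_measurable[OF \<phi>])
    have ge: "L2 lborel (\<lambda>x. g x \<bullet> e)"
      by (rule L2_bound[of _ _ "\<lambda>x. (norm (g x))\<^sup>2"])
        (use g e in \<open>auto simp: L2_def Basis_le_norm intro!: power_mono abs_le_square_iff[THEN iffD1]\<close>)
    have \<psi>: "L2 lborel (\<lambda>x. ?I x * \<phi> x)"
      by (rule L2_bound[of _ _ "\<lambda>x. (norm (\<phi> x))\<^sup>2"])
        (use test_function_L2[OF \<phi>] in \<open>auto simp: L2_def indicator_def\<close>)
    have lim1: "(\<lambda>n. LINT x|lborel. diff_quot (X n) e ?w x * \<phi> x) \<longlonglongrightarrow> - (LINT x|lborel. ?w x * partial \<phi> e x)"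
      if "\<And>n. X n \<noteq> 0" "X \<longlonglongrightarrow> 0" for X
      using diff_quot_test_limit[OF lw \<phi> e] that
      unfolding tendsto_at_iff_sequentially o_def by blast
    have lim2: "(\<lambda>n. LINT x|lborel. diff_quot (X n) e v x * (?I x * \<phi> x)) \<longlonglongrightarrow> (LINT x|lborel. (g x \<bullet> e) * (?I x * \<phi> x))"
      if "\<And>n. X n \<noteq> 0" "X \<longlonglongrightarrow> 0" for X
      by (rule diff_quot_weak_limit[OF v w e ge \<psi> that])
    have int: "integrable lborel (\<lambda>x. diff_quot t e ?w x * \<phi> x)"
      "integrable lborel (\<lambda>x. diff_quot t e v x * (?I x * \<phi> x))" for t
      by (rule integral_diff_quot_test(1)[OF lw \<phi>], intro L2_mult_integrable L2_diff_quot v \<psi>)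
    have up: "(LINT x|lborel. diff_quot t e v x * (?I x * \<phi> x)) \<le> (LINT x|lborel. diff_quot t e ?w x * \<phi> x)"
      if "t > 0" for t
    proof (rule integral_mono[OF int(2,1)])
      fix x
      have "?I x * diff_quot t e v x \<le> diff_quot t e ?w x"
        using truncation_convex[of c "v x" "v (x + t *\<^sub>R e)"] that by (simp add: diff_quot_def divide_right_mono)
      from mult_right_mono[OF this pos[of x]]
      show "diff_quot t e v x * (?I x * \<phi> x) \<le> diff_quot t e ?w x * \<phi> x" by (simp add: ac_simps)
    qed
    have down: "(LINT x|lborel. diff_quot t e ?w x * \<phi> x) \<le> (LINT x|lborel. diff_quot t e v x * (?I x * \<phi> x))"
      if "t < 0" for t
    proof (rule integral_mono[OF int(1,2)])
      fix x
      have "diff_quot t e ?w x \<le> ?I x * diff_quot t e v x"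
        using divide_right_mono_neg[OF truncation_convex[of c "v x" "v (x + t *\<^sub>R e)"], of t] that
        by (simp add: diff_quot_def)
      from mult_right_mono[OF this pos[of x]]
      show "diff_quot t e ?w x * \<phi> x \<le> diff_quot t e v x * (?I x * \<phi> x)" by (simp add: ac_simps)
    qed
    define X where "X = (\<lambda>n. inverse (real (Suc n)))"
    have X: "X n > 0" "X n \<noteq> 0" "- X n \<noteq> 0" "X \<longlonglongrightarrow> 0" "(\<lambda>n. - X n) \<longlonglongrightarrow> 0" for n
      using LIMSEQ_inverse_real_of_nat tendsto_minus[OF LIMSEQ_inverse_real_of_nat] by (auto simp: X_def)
    have "(LINT x|lborel. (g x \<bullet> e) * (?I x * \<phi> x)) \<le> - (LINT x|lborel. ?w x * partial \<phi> e x)"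
      by (rule LIMSEQ_le[OF lim2[OF X(2,4)] lim1[OF X(2,4)]]) (use up X in auto)
    moreover have "- (LINT x|lborel. ?w x * partial \<phi> e x) \<le> (LINT x|lborel. (g x \<bullet> e) * (?I x * \<phi> x))"
      by (rule LIMSEQ_le[OF lim1[OF X(3,5)] lim2[OF X(3,5)]]) (use down X in auto)
    ultimately show ?thesis by (simp add: ac_simps)
  qed
  have "(LINT x|lborel. ?w x * partial \<phi> e x) = - (LINT x|lborel. (?I x *\<^sub>R g x \<bullet> e) * \<phi> x)"
    if \<phi>: "test_function \<phi>" and e: "e \<in> Basis" for \<phi> e
  proof -
    obtain B where B: "B > 0" "\<And>x. \<bar>\<phi> x\<bar> \<le> B" using test_function_bounded[OF \<phi>] by auto
    obtain R where R: "R > 0" "\<And>x. norm x > R \<Longrightarrow> \<phi> x = 0" using test_function_support[OF \<phi>] by auto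
    \<comment> \<open>A multiple of \<open>\<zeta>\<close> dominates \<open>\<bar>\<phi>\<bar>\<close>: the bump is positive on a box containing the support.\<close>
    define \<zeta> :: "'a \<Rightarrow> real" where "\<zeta> = box_bump (- ((R + 1) *\<^sub>R One)) ((R + 1) *\<^sub>R One) 1"
    have \<zeta>: "test_function \<zeta>" unfolding \<zeta>_def by (rule test_function_box_bump) simp
    have "0 < \<zeta> x" if "x \<in> cball 0 R" for x
      unfolding \<zeta>_def box_bump_pos_iff[OF zero_less_one] mem_box
    proof
      fix i :: 'a assume i: "i \<in> Basis"
      have "\<bar>x \<bullet> i\<bar> < R + 1" using Basis_le_norm[OF i, of x] that by simp
      then show "- ((R + 1) *\<^sub>R One) \<bullet> i < x \<bullet> i \<and> x \<bullet> i < ((R + 1) *\<^sub>R One) \<bullet> i"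
        using i by simp linarith
    qed
    moreover obtain x0 where x0: "x0 \<in> cball 0 R" "\<And>x. x \<in> cball 0 R \<Longrightarrow> \<zeta> x0 \<le> \<zeta> x"
      using continuous_attains_inf[OF compact_cball, of "0::'a" R \<zeta>] R(1)
        continuous_on_subset[OF test_function_continuous[OF \<zeta>] subset_UNIV]
      by (metis cball_eq_empty less_le_not_le)
    ultimately have m: "\<zeta> x0 > 0" by blast
    define C where "C = B / \<zeta> x0"
    have C: "C > 0" using B m by (simp add: C_def)
    have \<zeta>pos: "\<zeta> x \<ge> 0" for x by (simp add: \<zeta>_def box_bump_nonneg)
    have C\<zeta>: "test_function (\<lambda>x. C * \<zeta> x)" by (rule test_function_cmult[OF \<zeta>])
    have sum: "test_function (\<lambda>x. \<phi> x + C * \<zeta> x)" by (rule test_function_add[OF \<phi> C\<zeta>])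
    have ge: "\<phi> x + C * \<zeta> x \<ge> 0" for x
    proof (cases "x \<in> cball 0 R")
      case True
      have "B = C * \<zeta> x0" using m by (simp add: C_def)
      also have "\<dots> \<le> C * \<zeta> x" using x0(2)[OF True] C by simp
      finally show ?thesis using B(2)[of x] by linarith
    next
      case False
      then show ?thesis using R(2)[of x] C \<zeta>pos[of x] by simp
    qed
    note A = nonneg[OF sum e ge]
    note A2 = nonneg[OF C\<zeta> e mult_nonneg_nonneg[OF less_imp_le[OF C] \<zeta>pos]]
    have p: "partial (\<lambda>x. \<phi> x + C * \<zeta> x) e x = partial \<phi> e x + partial (\<lambda>x. C * \<zeta> x) e x" for x
      using frechet_derivative_at[OF has_derivative_add[OF
        iffD1[OF frechet_derivative_works test_function_differentiable[OF \<phi>]]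
        iffD1[OF frechet_derivative_works test_function_differentiable[OF C\<zeta>]]], of x, symmetric]
      by simp
    have I1: "integrable lborel (\<lambda>x. ?w x * partial f e x)" if "test_function f" for f
      by (intro integrable_mult_test_function lw test_function_partial that e)
    have I2: "integrable lborel (\<lambda>x. (?I x *\<^sub>R g x \<bullet> e) * f x)" if "test_function f" for f
      by (rule integrable_mult_test_function[OF locally_integrable_component[OF e lg] that])
    have "(LINT x|lborel. ?w x * partial (\<lambda>x. \<phi> x + C * \<zeta> x) e x) =
        (LINT x|lborel. ?w x * partial \<phi> e x) + (LINT x|lborel. ?w x * partial (\<lambda>x. C * \<zeta> x) e x)"
      unfolding p distrib_left by (rule Bochner_Integration.integral_add[OF I1[OF \<phi>] I1[OF C\<zeta>]])
    moreover have "(LINT x|lborel. (?I x *\<^sub>R g x \<bullet> e) * (\<phi> x + C * \<zeta> x)) =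
        (LINT x|lborel. (?I x *\<^sub>R g x \<bullet> e) * \<phi> x) + (LINT x|lborel. (?I x *\<^sub>R g x \<bullet> e) * (C * \<zeta> x))"
      unfolding distrib_left by (rule Bochner_Integration.integral_add[OF I2[OF \<phi>] I2[OF C\<zeta>]])
    ultimately show ?thesis using A A2 by linarith
  qed
  then show ?thesis unfolding is_weak_gradient_def using lw lg by blast
qed

section \<open>The linear problem with a confining potential\<close>

locale confining_potential =
  fixes V :: "'a::euclidean_space \<Rightarrow> real" and V0 :: real
  assumes V_continuous: "continuous_on UNIV V"
    and V0_pos: "V0 > 0"
    and V_ge: "V0 \<le> V x"
    and inverse_V_integrable: "integrable lborel (\<lambda>x. 1 / V x)"
begin

lemma V_pos: "V x > 0"
  using V0_pos V_ge[of x] by linarith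

lemma V_measurable[measurable]: "V \<in> borel_measurable borel"
  by (rule borel_measurable_continuous_onI[OF V_continuous])

text \<open>
  The pair of a function and its weak gradient is carried along explicitly, so that sums,
  limits and truncations come with a definite gradient.
\<close>

definition finite_energy :: "('a \<Rightarrow> real) \<Rightarrow> ('a \<Rightarrow> 'a) \<Rightarrow> bool" where
  "finite_energy u g \<longleftrightarrow> is_weak_gradient u g \<and> L2 lborel g \<and> integrable lborel (\<lambda>x. V x * (u x)\<^sup>2)"

definition form :: "('a \<Rightarrow> real) \<Rightarrow> ('a \<Rightarrow> 'a) \<Rightarrow> ('a \<Rightarrow> real) \<Rightarrow> ('a \<Rightarrow> 'a) \<Rightarrow> real" where
  "form u g \<eta> \<gamma> = (LINT x|lborel. g x \<bullet> \<gamma> x) + (LINT x|lborel. V x * u x * \<eta> x)"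

definition solves :: "('a \<Rightarrow> real) \<Rightarrow> ('a \<Rightarrow> 'a) \<Rightarrow> ('a \<Rightarrow> real) \<Rightarrow> bool" where
  "solves u g h \<longleftrightarrow> finite_energy u g \<and>
     (\<forall>\<eta> \<gamma>. finite_energy \<eta> \<gamma> \<longrightarrow> form u g \<eta> \<gamma> = (LINT x|lborel. h x * \<eta> x))"

lemma finite_energy_measurable[measurable_dest]: "finite_energy u g \<Longrightarrow> u \<in> borel_measurable borel"
  by (simp add: finite_energy_def is_weak_gradient_def locally_integrable_measurable)

lemma finite_energy_L2_weighted:
  assumes "finite_energy u g" shows "L2 lborel (\<lambda>x. sqrt (V x) * u x)"
proof -
  note [measurable] = finite_energy_measurable[OF assms]
  have "(norm (sqrt (V x) * u x))\<^sup>2 = V x * (u x)\<^sup>2" for x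
    using V_pos[of x] by (simp add: power_mult_distrib)
  then show ?thesis using assms by (simp add: L2_def finite_energy_def)
qed

lemma finite_energy_L2:
  assumes "finite_energy u g" shows "L2 lborel u"
proof (rule L2_bound)
  show "u \<in> borel_measurable lborel" using finite_energy_measurable[OF assms] by simp
  show "integrable lborel (\<lambda>x. (V x * (u x)\<^sup>2) / V0)"
    using assms by (intro integrable_divide) (simp add: finite_energy_def)
  have "V0 * (u x)\<^sup>2 \<le> V x * (u x)\<^sup>2" for x by (rule mult_right_mono[OF V_ge zero_le_power2])
  then show "AE x in lborel. (norm (u x))\<^sup>2 \<le> (V x * (u x)\<^sup>2) / V0"
    using V0_pos by (intro AE_I2) (simp add: pos_le_divide_eq mult.commute)
qed

text \<open>
  Integrability of \<open>1 / V\<close> puts bounded functions into the dual of the energy space.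
\<close>

lemma L2_weight_inverse:
  assumes [measurable]: "h \<in> borel_measurable borel" and "\<And>x. \<bar>h x\<bar> \<le> H"
  shows "L2 lborel (\<lambda>x. h x / sqrt (V x))"
proof (rule L2_bound)
  show "integrable lborel (\<lambda>x. H\<^sup>2 * (1 / V x))"
    by (intro integrable_mult_right inverse_V_integrable)
  have "(h x)\<^sup>2 \<le> H\<^sup>2" for x using assms(2)[of x] by (simp add: abs_le_square_iff[symmetric])
  then show "AE x in lborel. (norm (h x / sqrt (V x)))\<^sup>2 \<le> H\<^sup>2 * (1 / V x)"
    using V_pos by (intro AE_I2) (simp add: power_divide divide_right_mono less_imp_le)
qed measurable

lemma bounded_mult_integrable:
  assumes "h \<in> borel_measurable borel" "\<And>x. \<bar>h x\<bar> \<le> H" "finite_energy \<eta> \<gamma>"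
  shows "integrable lborel (\<lambda>x. h x * \<eta> x)"
proof -
  have "integrable lborel (\<lambda>x. (h x / sqrt (V x)) * (sqrt (V x) * \<eta> x))"
    by (intro L2_mult_integrable L2_weight_inverse[OF assms(1,2)] finite_energy_L2_weighted[OF assms(3)])
  moreover have "(h x / sqrt (V x)) * (sqrt (V x) * \<eta> x) = h x * \<eta> x" for x
    using V_pos[of x] by simp
  ultimately show ?thesis by simp
qed

lemma form_integrable:
  assumes "finite_energy u g" "finite_energy \<eta> \<gamma>"
  shows "integrable lborel (\<lambda>x. g x \<bullet> \<gamma> x)" "integrable lborel (\<lambda>x. V x * u x * \<eta> x)"
proof -
  show "integrable lborel (\<lambda>x. g x \<bullet> \<gamma> x)"
    using assms by (auto simp: finite_energy_def intro: L2_inner_integrable)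
  have "integrable lborel (\<lambda>x. (sqrt (V x) * u x) * (sqrt (V x) * \<eta> x))"
    by (intro L2_mult_integrable finite_energy_L2_weighted[OF assms(1)] finite_energy_L2_weighted[OF assms(2)])
  moreover have "(sqrt (V x) * u x) * (sqrt (V x) * \<eta> x) = V x * u x * \<eta> x" for x
    using V_pos[of x] by (simp add: algebra_simps)
  ultimately show "integrable lborel (\<lambda>x. V x * u x * \<eta> x)" by simp
qed

lemma finite_energyI:
  assumes "is_weak_gradient u g" "L2 lborel g" "L2 lborel (\<lambda>x. sqrt (V x) * u x)"
  shows "finite_energy u g"
proof -
  have "(norm (sqrt (V x) * u x))\<^sup>2 = V x * (u x)\<^sup>2" for x
    using V_pos[of x] by (simp add: power_mult_distrib)
  with assms show ?thesis by (simp add: finite_energy_def L2_def)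
qed

lemma finite_energy_zero: "finite_energy (\<lambda>x. 0) (\<lambda>x. 0)"
  by (simp add: finite_energy_def is_weak_gradient_def L2_def locally_integrable_def set_integrable_def)

lemma finite_energy_lincomb:
  assumes "finite_energy u g" "finite_energy w k"
  shows "finite_energy (\<lambda>x. u x + c * w x) (\<lambda>x. g x + c *\<^sub>R k x)"
proof (rule finite_energyI)
  have w: "is_weak_gradient u g" "is_weak_gradient w k" and L: "L2 lborel g" "L2 lborel k"
    using assms by (auto simp: finite_energy_def)
  then show "L2 lborel (\<lambda>x. g x + c *\<^sub>R k x)" by (intro L2_add L2_scaleR)
  have "L2 lborel (\<lambda>x. sqrt (V x) * u x + c *\<^sub>R (sqrt (V x) * w x))"
    by (intro L2_add L2_scaleR finite_energy_L2_weighted[OF assms(1)] finite_energy_L2_weighted[OF assms(2)])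
  then show "L2 lborel (\<lambda>x. sqrt (V x) * (u x + c * w x))" by (simp add: algebra_simps)
  have li: "locally_integrable u" "locally_integrable w" "locally_integrable g" "locally_integrable k"
    using w by (auto simp: is_weak_gradient_def)
  have "(LINT x|lborel. (u x + c * w x) * partial \<phi> i x) = - (LINT x|lborel. ((g x + c *\<^sub>R k x) \<bullet> i) * \<phi> x)"
    if \<phi>: "test_function \<phi>" and i: "i \<in> Basis" for \<phi> i
  proof -
    have I: "integrable lborel (\<lambda>x. u x * partial \<phi> i x)" "integrable lborel (\<lambda>x. w x * partial \<phi> i x)"
      "integrable lborel (\<lambda>x. (g x \<bullet> i) * \<phi> x)" "integrable lborel (\<lambda>x. (k x \<bullet> i) * \<phi> x)"
      by (intro integrable_mult_test_function li test_function_partial \<phi> i locally_integrable_component)+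
    have "(LINT x|lborel. u x * partial \<phi> i x) = - (LINT x|lborel. (g x \<bullet> i) * \<phi> x)"
      "(LINT x|lborel. w x * partial \<phi> i x) = - (LINT x|lborel. (k x \<bullet> i) * \<phi> x)"
      using w \<phi> i by (auto simp: is_weak_gradient_def)
    then show ?thesis using I by (simp add: algebra_simps)
  qed
  then show "is_weak_gradient (\<lambda>x. u x + c * w x) (\<lambda>x. g x + c *\<^sub>R k x)"
    using locally_integrable_add[OF li(1) locally_integrable_scaleR[OF li(2), of c]]
      locally_integrable_add[OF li(3) locally_integrable_scaleR[OF li(4), of c]]
    by (simp add: is_weak_gradient_def)
qed

lemma finite_energy_diff:
  assumes "finite_energy u g" "finite_energy w k"
  shows "finite_energy (\<lambda>x. u x - w x) (\<lambda>x. g x - k x)"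
  using finite_energy_lincomb[OF assms, of "-1"] by simp

lemma finite_energy_truncation:
  assumes u: "finite_energy u g" and c: "c \<ge> 0"
  shows "finite_energy (\<lambda>x. max 0 (u x - c)) (\<lambda>x. indicator {c<..} (u x) *\<^sub>R g x)"
  unfolding finite_energy_def
proof (intro conjI)
  note [measurable] = finite_energy_measurable[OF u]
  have g: "L2 lborel g" "is_weak_gradient u g" using u by (auto simp: finite_energy_def)
  then have [measurable]: "g \<in> borel_measurable borel" by (simp add: L2_def)
  show "is_weak_gradient (\<lambda>x. max 0 (u x - c)) (\<lambda>x. indicator {c<..} (u x) *\<^sub>R g x)"
    by (rule truncation_weak_gradient[OF finite_energy_L2[OF u] g(2,1)])
  show "L2 lborel (\<lambda>x. indicator {c<..} (u x) *\<^sub>R g x)"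
    by (rule L2_bound[of _ _ "\<lambda>x. (norm (g x))\<^sup>2"]) (use g in \<open>auto simp: L2_def indicator_def\<close>)
  show "integrable lborel (\<lambda>x. V x * (max 0 (u x - c))\<^sup>2)"
  proof (rule Bochner_Integration.integrable_bound)
    show "integrable lborel (\<lambda>x. V x * (u x)\<^sup>2)" using u by (simp add: finite_energy_def)
    have "(max 0 (u x - c))\<^sup>2 \<le> (u x)\<^sup>2" for x
      using c by (auto simp: abs_le_square_iff[symmetric])
    then show "AE x in lborel. norm (V x * (max 0 (u x - c))\<^sup>2) \<le> norm (V x * (u x)\<^sup>2)"
      using V_pos by (intro AE_I2) (simp add: abs_mult mult_left_mono)
  qed measurable
qed

lemma is_weak_gradient_L2_limit:
  fixes u :: "nat \<Rightarrow> 'a \<Rightarrow> real"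
  assumes w: "\<And>n. is_weak_gradient (u n) (g n)" and L: "\<And>n. L2 lborel (u n)" "\<And>n. L2 lborel (g n)"
    and l: "L2 lborel u'" "L2 lborel g'"
    and lim: "(\<lambda>n. normsq lborel (\<lambda>x. u n x - u' x)) \<longlonglongrightarrow> 0" "(\<lambda>n. normsq lborel (\<lambda>x. g n x - g' x)) \<longlonglongrightarrow> 0"
  shows "is_weak_gradient u' g'"
  unfolding is_weak_gradient_def
proof (intro conjI allI impI ballI L2_locally_integrable l)
  fix \<phi> :: "'a \<Rightarrow> real" and i :: 'a assume \<phi>: "test_function \<phi>" and i: "i \<in> Basis"
  have "L2 lborel (\<lambda>x. \<phi> x *\<^sub>R i)"
    using test_function_L2[OF \<phi>] i by (auto simp: L2_def)
  then have "(\<lambda>n. LINT x|lborel. g n x \<bullet> (\<phi> x *\<^sub>R i)) \<longlonglongrightarrow> (LINT x|lborel. g' x \<bullet> (\<phi> x *\<^sub>R i))"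
    by (intro L2_inner_tendsto L l lim)
  then have a: "(\<lambda>n. - (LINT x|lborel. (g n x \<bullet> i) * \<phi> x)) \<longlonglongrightarrow> - (LINT x|lborel. (g' x \<bullet> i) * \<phi> x)"
    by (intro tendsto_minus) (simp add: mult.commute)
  have "(\<lambda>n. LINT x|lborel. u n x \<bullet> partial \<phi> i x) \<longlonglongrightarrow> (LINT x|lborel. u' x \<bullet> partial \<phi> i x)"
    by (intro L2_inner_tendsto L l lim test_function_L2 test_function_partial \<phi> i)
  moreover have "(LINT x|lborel. u n x \<bullet> partial \<phi> i x) = - (LINT x|lborel. (g n x \<bullet> i) * \<phi> x)" for n
    using w \<phi> i by (simp add: is_weak_gradient_def)
  ultimately show "(LINT x|lborel. u' x * partial \<phi> i x) = - (LINT x|lborel. (g' x \<bullet> i) * \<phi> x)"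
    using LIMSEQ_unique[OF a] by simp
qed

text \<open>
  An isometry of the energy space into a space of square integrable maps; solving the linear
  problem means projecting onto its range.
\<close>

definition embed :: "('a \<Rightarrow> real) \<Rightarrow> ('a \<Rightarrow> 'a) \<Rightarrow> 'a \<Rightarrow> real \<times> 'a" where
  "embed u g = (\<lambda>x. (sqrt (V x) * u x, g x))"

lemma normsq_pair:
  assumes "L2 M a" "L2 M b"
  shows "L2 M (\<lambda>x. (a x, b x))" "normsq M (\<lambda>x. (a x, b x)) = normsq M a + normsq M b"
  using assms by (auto simp: L2_def normsq_def norm_Pair)

lemma L2_fst_snd:
  fixes f :: "'d \<Rightarrow> 'b::euclidean_space \<times> 'c::euclidean_space"
  assumes "L2 M f" shows "L2 M (\<lambda>x. fst (f x))" "L2 M (\<lambda>x. snd (f x))"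
proof -
  have [measurable]: "f \<in> borel_measurable M" using assms by (simp add: L2_def)
  have i: "integrable M (\<lambda>x. (norm (f x))\<^sup>2)" using assms by (simp add: L2_def)
  have m: "(\<lambda>x. fst (f x)) \<in> borel_measurable M" "(\<lambda>x. snd (f x)) \<in> borel_measurable M"
    using measurable_compose[OF _ borel_measurable_continuous_onI[OF continuous_on_fst[OF continuous_on_id]], of f M]
      measurable_compose[OF _ borel_measurable_continuous_onI[OF continuous_on_snd[OF continuous_on_id]], of f M]
    by auto
  have n: "norm (fst z) \<le> norm z" "norm (snd z) \<le> norm z" for z :: "'b \<times> 'c"
    using norm_fst_le[of "fst z" "snd z"] norm_snd_le[of "snd z" "fst z"] by auto
  show "L2 M (\<lambda>x. fst (f x))"
    by (rule L2_bound[OF m(1) i], rule AE_I2, rule power_mono[OF n(1) norm_ge_zero])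
  show "L2 M (\<lambda>x. snd (f x))"
    by (rule L2_bound[OF m(2) i], rule AE_I2, rule power_mono[OF n(2) norm_ge_zero])
qed

text \<open>
  The projection of \<open>(h / sqrt V, 0)\<close> onto the range of the embedding is again in the range, because
  weak gradients are stable under mean square limits; orthogonality is the weak equation.
\<close>

theorem linear_problem_solvable:
  assumes h[measurable]: "h \<in> borel_measurable borel" and H: "\<And>x. \<bar>h x\<bar> \<le> H"
  obtains u g where "solves u g h"
proof -
  define S where "S = {embed u g | u g. finite_energy u g}"
  have emb: "L2 lborel (embed u g)" if "finite_energy u g" for u g
    unfolding embed_def using that finite_energy_L2_weighted[OF that]
    by (intro normsq_pair(1)) (auto simp: finite_energy_def)
  have "L2 lborel (\<lambda>x. 0 :: 'a)" by (simp add: L2_def)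
  then have "L2 lborel (\<lambda>x. (h x / sqrt (V x), 0 :: 'a))"
    by (intro normsq_pair(1) L2_weight_inverse[OF h H])
  then obtain G s where G: "L2 lborel G" and s: "\<And>n. s n \<in> S"
    and lim: "(\<lambda>n. normsq lborel (\<lambda>x. s n x - G x)) \<longlonglongrightarrow> 0"
    and orth: "\<And>f. f \<in> S \<Longrightarrow> (LINT x|lborel. ((h x / sqrt (V x), 0) - G x) \<bullet> f x) = 0"
  proof (rule L2_projection[of lborel _ S])
    show "(\<lambda>x. 0) \<in> S" unfolding S_def using finite_energy_zero by (force simp: embed_def zero_prod_def)
    show "(\<lambda>x. f x + k x) \<in> S" if fk: "f \<in> S" "k \<in> S" for f k
    proof -
      obtain u g w l where *: "finite_energy u g" "f = embed u g" "finite_energy w l" "k = embed w l"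
        using fk unfolding S_def by blast
      have "(\<lambda>x. f x + k x) = embed (\<lambda>x. u x + 1 * w x) (\<lambda>x. g x + 1 *\<^sub>R l x)"
        by (simp add: * embed_def algebra_simps)
      then show ?thesis unfolding S_def using finite_energy_lincomb[OF *(1,3), of 1] by blast
    qed
    show "(\<lambda>x. c *\<^sub>R f x) \<in> S" if f: "f \<in> S" for f c
    proof -
      obtain u g where *: "finite_energy u g" "f = embed u g"
        using f unfolding S_def by blast
      have "(\<lambda>x. c *\<^sub>R f x) = embed (\<lambda>x. 0 + c * u x) (\<lambda>x. 0 + c *\<^sub>R g x)"
        by (simp add: * embed_def algebra_simps)
      then show ?thesis unfolding S_def using finite_energy_lincomb[OF finite_energy_zero *(1), of c] by blast
    qed
  qed (auto simp: S_def emb)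
  have "\<forall>n. \<exists>u g. finite_energy u g \<and> s n = embed u g" using s unfolding S_def by blast
  then obtain un gn where sn: "\<And>n. finite_energy (un n) (gn n)" "\<And>n. s n = embed (un n) (gn n)" by metis
  define u where "u x = fst (G x) / sqrt (V x)" for x
  define g where "g x = snd (G x)" for x
  have Gx: "G x = (sqrt (V x) * u x, g x)" for x
    using V_pos[of x] by (simp add: u_def g_def)
  have L: "L2 lborel (\<lambda>x. sqrt (V x) * u x)" "L2 lborel g"
    using L2_fst_snd[OF G] by (simp_all add: Gx)
  have um[measurable]: "u \<in> borel_measurable borel"
    using L2_fst_snd(1)[OF G] unfolding u_def[abs_def] L2_def by auto
  have uL: "L2 lborel u"
  proof (rule L2_bound)
    show "integrable lborel (\<lambda>x. (norm (sqrt (V x) * u x))\<^sup>2 / V0)" using L(1) by (simp add: L2_def)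
    have "V0 * (u x)\<^sup>2 \<le> V x * (u x)\<^sup>2" for x by (rule mult_right_mono[OF V_ge zero_le_power2])
    then show "AE x in lborel. (norm (u x))\<^sup>2 \<le> (norm (sqrt (V x) * u x))\<^sup>2 / V0"
      using V0_pos V_pos
      by (intro AE_I2) (simp add: pos_le_divide_eq mult.commute power_mult_distrib less_imp_le)
  qed simp
  have gL: "L2 lborel (gn n)" for n using sn(1) by (simp add: finite_energy_def)
  have split: "normsq lborel (\<lambda>x. s n x - G x) =
      normsq lborel (\<lambda>x. sqrt (V x) * un n x - sqrt (V x) * u x) + normsq lborel (\<lambda>x. gn n x - g x)" for n
    using normsq_pair(2)[OF L2_diff[OF finite_energy_L2_weighted[OF sn(1)] L(1)] L2_diff[OF gL L(2)]]
    by (simp add: sn(2) embed_def Gx)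
  have le: "normsq lborel (\<lambda>x. un n x - u x) \<le> normsq lborel (\<lambda>x. s n x - G x) / V0" for n
  proof -
    have D: "L2 lborel (\<lambda>x. sqrt (V x) * un n x - sqrt (V x) * u x)"
      by (rule L2_diff[OF finite_energy_L2_weighted[OF sn(1)] L(1)])
    have "normsq lborel (\<lambda>x. un n x - u x) \<le> (LINT x|lborel. (norm (sqrt (V x) * un n x - sqrt (V x) * u x))\<^sup>2 / V0)"
      unfolding normsq_def
    proof (rule integral_mono)
      show "integrable lborel (\<lambda>x. (norm (un n x - u x))\<^sup>2)"
        using L2_diff[OF finite_energy_L2[OF sn(1)] uL] by (simp add: L2_def)
      show "integrable lborel (\<lambda>x. (norm (sqrt (V x) * un n x - sqrt (V x) * u x))\<^sup>2 / V0)"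
        using D by (simp add: L2_def)
      show "(norm (un n x - u x))\<^sup>2 \<le> (norm (sqrt (V x) * un n x - sqrt (V x) * u x))\<^sup>2 / V0" for x
      proof -
        have "V0 * (un n x - u x)\<^sup>2 \<le> V x * (un n x - u x)\<^sup>2"
          by (rule mult_right_mono[OF V_ge zero_le_power2])
        also have "\<dots> = (norm (sqrt (V x) * un n x - sqrt (V x) * u x))\<^sup>2"
          using V_pos[of x] by (simp add: power_mult_distrib flip: right_diff_distrib)
        finally show ?thesis using V0_pos by (simp add: pos_le_divide_eq mult.commute)
      qed
    qed
    also have "\<dots> = normsq lborel (\<lambda>x. sqrt (V x) * un n x - sqrt (V x) * u x) / V0"
      by (simp add: normsq_def)
    also have "\<dots> \<le> normsq lborel (\<lambda>x. s n x - G x) / V0"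
      using V0_pos by (intro divide_right_mono) (simp_all add: split normsq_nonneg)
    finally show ?thesis .
  qed
  have "is_weak_gradient u g"
  proof (rule is_weak_gradient_L2_limit)
    show "is_weak_gradient (un n) (gn n)" for n using sn(1) by (simp add: finite_energy_def)
    show "L2 lborel (un n)" for n by (rule finite_energy_L2[OF sn(1)])
    show "(\<lambda>n. normsq lborel (\<lambda>x. un n x - u x)) \<longlonglongrightarrow> 0"
    proof (rule tendsto_sandwich[OF _ _ tendsto_const])
      show "(\<lambda>n. normsq lborel (\<lambda>x. s n x - G x) / V0) \<longlonglongrightarrow> 0"
        using tendsto_divide[OF lim tendsto_const[of V0]] V0_pos by simp
    qed (use le normsq_nonneg in \<open>auto intro!: always_eventually\<close>)
    show "(\<lambda>n. normsq lborel (\<lambda>x. gn n x - g x)) \<longlonglongrightarrow> 0"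
    proof (rule tendsto_sandwich[OF _ _ tendsto_const lim])
      show "\<forall>\<^sub>F n in sequentially. normsq lborel (\<lambda>x. gn n x - g x) \<le> normsq lborel (\<lambda>x. s n x - G x)"
        by (intro always_eventually allI) (simp add: split normsq_nonneg)
    qed (simp add: normsq_nonneg)
  qed (use uL L gL in auto)
  then have fe: "finite_energy u g" by (rule finite_energyI[OF _ L(2,1)])
  have "form u g \<eta> \<gamma> = (LINT x|lborel. h x * \<eta> x)" if \<eta>: "finite_energy \<eta> \<gamma>" for \<eta> \<gamma>
  proof -
    have "embed \<eta> \<gamma> \<in> S" using \<eta> by (auto simp: S_def)
    then have "0 = (LINT x|lborel. ((h x / sqrt (V x), 0) - G x) \<bullet> embed \<eta> \<gamma> x)" using orth by simp
    also have "\<dots> = (LINT x|lborel. h x * \<eta> x - (V x * u x * \<eta> x + g x \<bullet> \<gamma> x))"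
    proof (rule Bochner_Integration.integral_cong)
      fix x
      have "sqrt (V x) * sqrt (V x) = V x" using V_pos[of x] by simp
      then show "((h x / sqrt (V x), 0) - G x) \<bullet> embed \<eta> \<gamma> x = h x * \<eta> x - (V x * u x * \<eta> x + g x \<bullet> \<gamma> x)"
        using V_pos[of x] by (simp add: Gx embed_def algebra_simps)
    qed simp
    also have "\<dots> = (LINT x|lborel. h x * \<eta> x) - form u g \<eta> \<gamma>"
      using form_integrable[OF fe \<eta>] bounded_mult_integrable[OF h H \<eta>] by (simp add: form_def)
    finally show ?thesis by simp
  qed
  then have "solves u g h" using fe by (simp add: solves_def)
  then show thesis by (rule that)
qed

section \<open>Comparison, bounds and stability\<close>

lemma form_diff_left:
  assumes "finite_energy u g" "finite_energy w k" "finite_energy \<eta> \<gamma>"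
  shows "form (\<lambda>x. u x - w x) (\<lambda>x. g x - k x) \<eta> \<gamma> = form u g \<eta> \<gamma> - form w k \<eta> \<gamma>"
  using form_integrable[OF assms(1,3)] form_integrable[OF assms(2,3)]
  by (simp add: form_def inner_diff_left left_diff_distrib right_diff_distrib)

text \<open>
  Testing with the positive part of \<open>v = u - w\<close>: the gradient term is \<open>\<integral> \<bar>\<nabla>v\<bar>^2\<close> over \<open>{v > 0}\<close>,
  hence nonnegative, and the potential term is \<open>\<integral> V (max 0 v)^2\<close>, so it must vanish.
\<close>

theorem comparison_principle:
  assumes u: "finite_energy u g" and w: "finite_energy w k"
    and le: "\<And>\<eta> \<gamma>. finite_energy \<eta> \<gamma> \<Longrightarrow> (\<And>x. \<eta> x \<ge> 0) \<Longrightarrow> form u g \<eta> \<gamma> \<le> form w k \<eta> \<gamma>"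
  shows "AE x in lborel. u x \<le> w x"
proof -
  define v l where "v x = u x - w x" and "l x = g x - k x" for x
  have vl: "finite_energy v l" unfolding v_def[abs_def] l_def[abs_def] by (rule finite_energy_diff[OF u w])
  define \<eta> \<gamma> where "\<eta> x = max 0 (v x - 0)" and "\<gamma> x = indicat_real {0<..} (v x) *\<^sub>R l x" for x
  have \<eta>: "finite_energy \<eta> \<gamma>"
    unfolding \<eta>_def[abs_def] \<gamma>_def[abs_def] by (rule finite_energy_truncation[OF vl]) simp
  have "form v l \<eta> \<gamma> \<le> 0"
    using le[OF \<eta>] form_diff_left[OF u w \<eta>] by (simp add: v_def[abs_def] l_def[abs_def] \<eta>_def)
  moreover have "0 \<le> (LINT x|lborel. l x \<bullet> \<gamma> x)"
    by (intro Bochner_Integration.integral_nonneg) (simp add: \<gamma>_def)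
  moreover have nn: "0 \<le> V x * v x * \<eta> x" for x
    using V_pos[of x] by (simp add: \<eta>_def max_def)
  moreover have "0 \<le> (LINT x|lborel. V x * v x * \<eta> x)"
    by (intro Bochner_Integration.integral_nonneg nn)
  ultimately have "(LINT x|lborel. V x * v x * \<eta> x) = 0" unfolding form_def by linarith
  then have "AE x in lborel. V x * v x * \<eta> x = 0"
    using integral_nonneg_eq_0_iff_AE[OF form_integrable(2)[OF vl \<eta>]] nn by simp
  then show ?thesis
  proof eventually_elim
    case (elim x)
    then have "v x = 0 \<or> \<eta> x = 0" using V_pos[of x] by auto
    then show ?case by (auto simp: \<eta>_def v_def max_def split: if_splits)
  qed
qed

lemma solves_mono:
  assumes u: "solves u g h" and w: "solves w k h'"
    and [measurable]: "h \<in> borel_measurable borel" "h' \<in> borel_measurable borel"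
    and H: "\<And>x. \<bar>h x\<bar> \<le> H" "\<And>x. \<bar>h' x\<bar> \<le> H" and le: "AE x in lborel. h x \<le> h' x"
  shows "AE x in lborel. u x \<le> w x"
proof (rule comparison_principle)
  show "finite_energy u g" "finite_energy w k" using u w by (auto simp: solves_def)
  fix \<eta> \<gamma> assume \<eta>: "finite_energy \<eta> \<gamma>" "\<And>x. \<eta> x \<ge> (0::real)"
  have "(LINT x|lborel. h x * \<eta> x) \<le> (LINT x|lborel. h' x * \<eta> x)"
  proof (rule integral_mono_AE)
    show "integrable lborel (\<lambda>x. h x * \<eta> x)" "integrable lborel (\<lambda>x. h' x * \<eta> x)"
      by (rule bounded_mult_integrable[OF _ H(1) \<eta>(1)], simp, rule bounded_mult_integrable[OF _ H(2) \<eta>(1)], simp)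
    show "AE x in lborel. h x * \<eta> x \<le> h' x * \<eta> x"
      using le by eventually_elim (simp add: mult_right_mono \<eta>)
  qed
  then show "form u g \<eta> \<gamma> \<le> form w k \<eta> \<gamma>" using u w \<eta>(1) by (simp add: solves_def)
qed

text \<open>
  A positive constant \<open>M\<close> is a supersolution of infinite energy, which keeps it out of reach of the
  comparison principle; testing with \<open>max 0 (u - M)\<close>, whose energy is finite, has the same effect.
\<close>

lemma solves_upper_bound:
  assumes u: "solves u g h" and [measurable]: "h \<in> borel_measurable borel"
    and H: "\<And>x. \<bar>h x\<bar> \<le> V0 * M"
  shows "AE x in lborel. u x \<le> M"
proof -
  have "0 \<le> V0 * M" using H[of undefined] by linarith
  then have M: "M \<ge> 0" using V0_pos by (simp add: zero_le_mult_iff)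
  have fu: "finite_energy u g" using u by (simp add: solves_def)
  define \<eta> \<gamma> where "\<eta> x = max 0 (u x - M)" and "\<gamma> x = indicat_real {M<..} (u x) *\<^sub>R g x" for x
  have \<eta>: "finite_energy \<eta> \<gamma>"
    unfolding \<eta>_def[abs_def] \<gamma>_def[abs_def] by (rule finite_energy_truncation[OF fu M])
  have hi: "integrable lborel (\<lambda>x. h x * \<eta> x)"
    by (rule bounded_mult_integrable[OF _ H \<eta>]) simp
  have Vi: "integrable lborel (\<lambda>x. V x * u x * \<eta> x)" by (rule form_integrable(2)[OF fu \<eta>])
  have "0 \<le> (LINT x|lborel. g x \<bullet> \<gamma> x)"
    by (intro Bochner_Integration.integral_nonneg) (simp add: \<gamma>_def)
  moreover have "form u g \<eta> \<gamma> = (LINT x|lborel. h x * \<eta> x)" using u \<eta> by (simp add: solves_def)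
  ultimately have le: "(LINT x|lborel. V x * u x * \<eta> x - h x * \<eta> x) \<le> 0"
    using hi Vi by (simp add: form_def)
  have pos: "V0 * (\<eta> x)\<^sup>2 \<le> V x * u x * \<eta> x - h x * \<eta> x" for x
  proof (cases "u x > M")
    case True
    have "V0 * u x \<le> V x * u x" using V_ge[of x] M True by (intro mult_right_mono) auto
    then have "V0 * (u x - M) \<le> V x * u x - h x" using H[of x] by (simp add: algebra_simps)
    from mult_right_mono[OF this, of "\<eta> x"] show ?thesis
      using True by (simp add: \<eta>_def power2_eq_square algebra_simps)
  qed (simp add: \<eta>_def)
  have nn: "0 \<le> V x * u x * \<eta> x - h x * \<eta> x" for x
    using pos[of x] V0_pos by (smt (verit) zero_le_mult_iff zero_le_power2)
  have "(LINT x|lborel. V x * u x * \<eta> x - h x * \<eta> x) = 0"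
    using le nn by (intro antisym Bochner_Integration.integral_nonneg)
  then have "AE x in lborel. V x * u x * \<eta> x - h x * \<eta> x = 0"
    using integral_nonneg_eq_0_iff_AE[OF Bochner_Integration.integrable_diff[OF Vi hi]] nn by simp
  then show ?thesis
  proof eventually_elim
    case (elim x)
    then have "V0 * (\<eta> x)\<^sup>2 \<le> 0" using pos[of x] by linarith
    then have "\<eta> x = 0" using V0_pos by (simp add: mult_le_0_iff)
    then show ?case by (simp add: \<eta>_def max_def split: if_splits)
  qed
qed

text \<open>
  Testing the difference of the two equations with \<open>u - w\<close>, followed by the Cauchy-Schwarz inequality.
\<close>

lemma solves_stability:
  assumes u: "solves u g h" and w: "solves w k h'"
    and [measurable]: "h \<in> borel_measurable borel" "h' \<in> borel_measurable borel"
    and H: "\<And>x. \<bar>h x\<bar> \<le> H" "\<And>x. \<bar>h' x\<bar> \<le> H"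
  shows "normsq lborel (\<lambda>x. sqrt (V x) * (u x - w x)) \<le> normsq lborel (\<lambda>x. (h x - h' x) / sqrt (V x))"
proof -
  have fu: "finite_energy u g" and fw: "finite_energy w k" using u w by (auto simp: solves_def)
  define v l where "v x = u x - w x" and "l x = g x - k x" for x
  have vl: "finite_energy v l" unfolding v_def[abs_def] l_def[abs_def] by (rule finite_energy_diff[OF fu fw])
  let ?N = "normsq lborel (\<lambda>x. sqrt (V x) * v x)" and ?A = "normsq lborel (\<lambda>x. (h x - h' x) / sqrt (V x))"
  have hv: "integrable lborel (\<lambda>x. h x * v x)" "integrable lborel (\<lambda>x. h' x * v x)"
    by (rule bounded_mult_integrable[OF _ H(1) vl], simp, rule bounded_mult_integrable[OF _ H(2) vl], simp)
  have sq: "sqrt (V x) * sqrt (V x) = V x" for x using V_pos[of x] by simp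
  have "?N = (LINT x|lborel. V x * v x * v x)"
    unfolding normsq_def
    by (rule Bochner_Integration.integral_cong)
      (use V_pos in \<open>simp_all add: power_mult_distrib less_imp_le power2_eq_square[of "v _"] mult.assoc\<close>)
  also have "\<dots> \<le> form v l v l"
    unfolding form_def by (simp add: Bochner_Integration.integral_nonneg)
  also have "form v l v l = (LINT x|lborel. h x * v x) - (LINT x|lborel. h' x * v x)"
    using form_diff_left[OF fu fw vl] u w vl by (simp add: solves_def v_def[abs_def] l_def[abs_def])
  also have "\<dots> = (LINT x|lborel. ((h x - h' x) / sqrt (V x)) \<bullet> (sqrt (V x) * v x))"
    unfolding Bochner_Integration.integral_diff[OF hv, symmetric]
  proof (rule Bochner_Integration.integral_cong)
    show "h x * v x - h' x * v x = ((h x - h' x) / sqrt (V x)) \<bullet> (sqrt (V x) * v x)" for x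
      using V_pos[of x] by (simp add: field_simps)
  qed simp
  finally have le: "?N \<le> (LINT x|lborel. ((h x - h' x) / sqrt (V x)) \<bullet> (sqrt (V x) * v x))" .
  have "\<bar>h x - h' x\<bar> \<le> 2 * H" for x using H(1)[of x] H(2)[of x] by linarith
  then have "L2 lborel (\<lambda>x. (h x - h' x) / sqrt (V x))" by (intro L2_weight_inverse) auto
  from L2_Cauchy_Schwarz[OF this finite_energy_L2_weighted[OF vl]]
  have "?N\<^sup>2 \<le> ?A * ?N"
    using power_mono[OF le normsq_nonneg, of 2] by linarith
  then have "?N \<le> ?A"
    using normsq_nonneg[of lborel "\<lambda>x. sqrt (V x) * v x"] normsq_nonneg[of lborel "\<lambda>x. (h x - h' x) / sqrt (V x)"]
    by (cases "?N = 0") (auto simp: power2_eq_square)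
  then show ?thesis by (simp add: v_def)
qed

end

section \<open>Subsolutions supported in a box\<close>

lemma test_function_power: "test_function f \<Longrightarrow> test_function (\<lambda>x. f x ^ Suc n)"
proof (induction n)
  case (Suc n)
  show ?case using test_function_mult[OF Suc.prems test_function_C_k[OF Suc.IH[OF Suc.prems]]] by simp
qed simp

lemma partial_power:
  fixes f :: "'a::euclidean_space \<Rightarrow> real"
  assumes "f differentiable (at x)"
  shows "partial (\<lambda>x. f x ^ n) i x = real n * partial f i x * f x ^ (n - 1)"
  using frechet_derivative_at[OF has_derivative_power[OF
      iffD1[OF frechet_derivative_works assms]], of n, symmetric]
  by simp

lemma partial_cmult:
  fixes f :: "'a::euclidean_space \<Rightarrow> real"
  assumes "f differentiable (at x)"
  shows "partial (\<lambda>x. c * f x) i x = c * partial f i x"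
  using frechet_derivative_at[OF has_derivative_mult_right[OF
      iffD1[OF frechet_derivative_works assms]], of c, symmetric]
  by simp

text \<open>
  Two derivatives lower the exponent by at most two; all other factors are bounded.
\<close>

lemma second_partial_power_bound:
  fixes f :: "'a::euclidean_space \<Rightarrow> real"
  assumes f: "test_function f" and f01: "\<And>x. 0 \<le> f x" "\<And>x. f x \<le> 1" and i: "i \<in> Basis"
  shows "\<exists>D\<ge>0. \<forall>x. \<bar>partial (partial (\<lambda>x. f x ^ (n + 2)) i) i x\<bar> \<le> D * f x ^ n"
proof -
  have df: "f differentiable (at x)" for x by (rule test_function_differentiable[OF f])
  have fi: "test_function (partial f i)" by (rule test_function_partial[OF f i])
  have dfi: "partial f i differentiable (at x)" for x by (rule test_function_differentiable[OF fi])
  obtain B1 where B1: "B1 > 0" "\<And>x. \<bar>partial f i x\<bar> \<le> B1" using test_function_bounded[OF fi] by auto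
  obtain B2 where B2: "B2 > 0" "\<And>x. \<bar>partial (partial f i) i x\<bar> \<le> B2"
    using test_function_bounded[OF test_function_partial[OF fi i]] by auto
  have p1: "partial (\<lambda>x. f x ^ (n + 2)) i = (\<lambda>x. real (n + 2) * (partial f i x * f x ^ (n + 1)))"
    by (rule ext, subst partial_power[OF df]) (simp add: mult.assoc)
  have dp: "(\<lambda>x. f x ^ (n + 1)) differentiable (at x)" for x
    using test_function_differentiable[OF test_function_power[OF f, of n]] by simp
  have dm: "(\<lambda>x. partial f i x * f x ^ (n + 1)) differentiable (at x)" for x
    by (intro differentiable_mult dfi dp)
  have p2: "partial (partial (\<lambda>x. f x ^ (n + 2)) i) i x =
      real (n + 2) * (partial f i x * (real (n + 1) * partial f i x * f x ^ n) + partial (partial f i) i x * f x ^ (n + 1))" for x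
    unfolding p1 unfolding partial_cmult[OF dm] unfolding frechet_derivative_mult_real[OF dfi dp]
    unfolding partial_power[OF df] by simp
  define D where "D = real (n + 2) * (real (n + 1) * (B1 * B1) + B2)"
  have "\<bar>partial (partial (\<lambda>x. f x ^ (n + 2)) i) i x\<bar> \<le> D * f x ^ n" for x
  proof -
    have fn: "0 \<le> f x ^ n" using f01 by simp
    have a: "\<bar>partial f i x * partial f i x\<bar> \<le> B1 * B1"
      unfolding abs_mult using B1 by (intro mult_mono) auto
    have b: "\<bar>partial (partial f i) i x * f x\<bar> \<le> B2 * 1"
      unfolding abs_mult using B2 f01 by (intro mult_mono) auto
    have "partial (partial (\<lambda>x. f x ^ (n + 2)) i) i x =
        real (n + 2) * (real (n + 1) * (partial f i x * partial f i x) + partial (partial f i) i x * f x) * f x ^ n"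
      unfolding p2 by (simp add: algebra_simps)
    also have "\<bar>\<dots>\<bar> = real (n + 2) * \<bar>real (n + 1) * (partial f i x * partial f i x) + partial (partial f i) i x * f x\<bar> * f x ^ n"
      using fn by (simp only: abs_mult abs_of_nonneg[OF fn] abs_of_nat)
    also have "\<dots> \<le> D * f x ^ n"
    proof (intro mult_right_mono fn)
      have "\<bar>real (n + 1) * (partial f i x * partial f i x) + partial (partial f i) i x * f x\<bar>
          \<le> real (n + 1) * \<bar>partial f i x * partial f i x\<bar> + \<bar>partial (partial f i) i x * f x\<bar>"
        by (rule order_trans[OF abs_triangle_ineq]) (simp add: abs_mult)
      also have "\<dots> \<le> real (n + 1) * (B1 * B1) + B2"
        using a b by (intro add_mono mult_left_mono) auto
      finally show "real (n + 2) * \<bar>real (n + 1) * (partial f i x * partial f i x) + partial (partial f i) i x * f x\<bar> \<le> D"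
        unfolding D_def by (rule mult_left_mono) simp
    qed
    finally show ?thesis .
  qed
  moreover have "D \<ge> 0" using B1 B2 by (simp add: D_def)
  ultimately show ?thesis by blast
qed

context confining_potential
begin

lemma test_function_finite_energy:
  assumes \<phi>: "test_function \<phi>"
  shows "finite_energy \<phi> (\<lambda>x. \<Sum>i\<in>Basis. partial \<phi> i x *\<^sub>R i)"
proof (rule finite_energyI)
  note [measurable] = test_function_measurable[OF \<phi>]
  obtain B where B: "\<And>x. \<bar>\<phi> x\<bar> \<le> B" using test_function_bounded[OF \<phi>] by auto
  obtain R where R: "\<And>x. norm x > R \<Longrightarrow> \<phi> x = 0" using test_function_support[OF \<phi>] by auto
  have "compact (V ` cball 0 R)"
    by (intro compact_continuous_image compact_cball continuous_on_subset[OF V_continuous subset_UNIV])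
  then have "bounded (V ` cball 0 R)" by (rule compact_imp_bounded)
  then obtain K where "\<forall>y \<in> V ` cball 0 R. norm y \<le> K" unfolding bounded_iff by blast
  then have "norm (V x) \<le> K" if "x \<in> cball 0 R" for x using that by blast
  then have K: "V x \<le> K" if "x \<in> cball 0 R" for x using that by (metis abs_le_D1 real_norm_def)
  show "L2 lborel (\<lambda>x. sqrt (V x) * \<phi> x)"
  proof (rule bounded_support_L2)
    show "\<bar>sqrt (V x) * \<phi> x\<bar> \<le> sqrt (max K 0) * \<bar>B\<bar>" for x
    proof (cases "x \<in> cball 0 R")
      case True
      have "sqrt (V x) \<le> sqrt (max K 0)" using K[OF True] by simp
      moreover have "\<bar>\<phi> x\<bar> \<le> \<bar>B\<bar>" using B[of x] by linarith
      ultimately show ?thesis unfolding abs_mult using V_pos[of x] by (intro mult_mono) auto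
    qed (use R in simp)
    show "sqrt (V x) * \<phi> x = 0" if "norm x > R" for x using R[OF that] by simp
  qed measurable
qed (use test_function_weak_gradient[OF \<phi>] in auto)

text \<open>
  The partial derivatives of \<open>\<phi>\<close> are test functions themselves, so the weak gradient of \<open>\<eta>\<close> can
  be moved onto them by its definition.
\<close>

lemma form_test_function:
  assumes \<phi>: "test_function \<phi>" and \<eta>: "finite_energy \<eta> \<gamma>"
  shows "integrable lborel (\<lambda>x. (V x * \<phi> x - (\<Sum>i\<in>Basis. partial (partial \<phi> i) i x)) * \<eta> x)"
    "form \<phi> (\<lambda>x. \<Sum>i\<in>Basis. partial \<phi> i x *\<^sub>R i) \<eta> \<gamma> =
      (LINT x|lborel. (V x * \<phi> x - (\<Sum>i\<in>Basis. partial (partial \<phi> i) i x)) * \<eta> x)"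
proof -
  have wg: "is_weak_gradient \<eta> \<gamma>" using \<eta> by (simp add: finite_energy_def)
  then have li: "locally_integrable \<eta>" "locally_integrable \<gamma>" by (auto simp: is_weak_gradient_def)
  have P: "test_function (partial \<phi> i)" if "i \<in> Basis" for i by (rule test_function_partial[OF \<phi> that])
  have I1: "integrable lborel (\<lambda>x. \<eta> x * partial (partial \<phi> i) i x)" if "i \<in> Basis" for i
    by (intro integrable_mult_test_function li test_function_partial P that)
  have I2: "integrable lborel (\<lambda>x. (\<gamma> x \<bullet> i) * partial \<phi> i x)" if "i \<in> Basis" for i
    by (intro integrable_mult_test_function locally_integrable_component li P that)
  note I3 = form_integrable(2)[OF test_function_finite_energy[OF \<phi>] \<eta>]
  have eq: "(V x * \<phi> x - (\<Sum>i\<in>Basis. partial (partial \<phi> i) i x)) * \<eta> x =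
      V x * \<phi> x * \<eta> x - (\<Sum>i\<in>Basis. \<eta> x * partial (partial \<phi> i) i x)" for x
    unfolding left_diff_distrib sum_distrib_right by (simp add: mult.commute)
  have IS: "integrable lborel (\<lambda>x. \<Sum>i\<in>Basis. \<eta> x * partial (partial \<phi> i) i x)"
    by (intro Bochner_Integration.integrable_sum I1)
  show "integrable lborel (\<lambda>x. (V x * \<phi> x - (\<Sum>i\<in>Basis. partial (partial \<phi> i) i x)) * \<eta> x)"
    unfolding eq by (intro Bochner_Integration.integrable_diff I3 IS)
  have "(\<Sum>i\<in>Basis. partial \<phi> i x *\<^sub>R i) \<bullet> \<gamma> x = (\<Sum>i\<in>Basis. (\<gamma> x \<bullet> i) * partial \<phi> i x)" for x
    unfolding inner_sum_left by (rule sum.cong) (simp_all add: inner_commute)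
  then have "(LINT x|lborel. (\<Sum>i\<in>Basis. partial \<phi> i x *\<^sub>R i) \<bullet> \<gamma> x) =
      (LINT x|lborel. (\<Sum>i\<in>Basis. (\<gamma> x \<bullet> i) * partial \<phi> i x))"
    by simp
  also have "\<dots> = (\<Sum>i\<in>Basis. (LINT x|lborel. (\<gamma> x \<bullet> i) * partial \<phi> i x))"
    by (rule Bochner_Integration.integral_sum) (rule I2)
  also have "\<dots> = (\<Sum>i\<in>Basis. - (LINT x|lborel. \<eta> x * partial (partial \<phi> i) i x))"
    using wg P by (intro sum.cong) (auto simp: is_weak_gradient_def)
  also have "\<dots> = - (LINT x|lborel. (\<Sum>i\<in>Basis. \<eta> x * partial (partial \<phi> i) i x))"
    by (subst Bochner_Integration.integral_sum) (auto intro: I1 simp: sum_negf)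
  finally show "form \<phi> (\<lambda>x. \<Sum>i\<in>Basis. partial \<phi> i x *\<^sub>R i) \<eta> \<gamma> =
      (LINT x|lborel. (V x * \<phi> x - (\<Sum>i\<in>Basis. partial (partial \<phi> i) i x)) * \<eta> x)"
    unfolding form_def eq Bochner_Integration.integral_diff[OF I3 IS] by simp
qed

text \<open>
  With \<open>F = \<zeta> ^ (n + 2)\<close> for a bump \<open>\<zeta>\<close> the expression \<open>V F - \<Delta>F\<close> is of order \<open>\<zeta> ^ n\<close>, and
  \<open>\<zeta> ^ n \<le> F powr \<theta>\<close> as soon as \<open>(n + 2) * \<theta> \<le> n\<close>. Scaling by \<open>\<epsilon>\<close> multiplies \<open>V F - \<Delta>F\<close> by \<open>\<epsilon>\<close>
  and \<open>F powr \<theta>\<close> by \<open>\<epsilon> powr \<theta>\<close>, which is much larger for small \<open>\<epsilon>\<close>.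
\<close>

theorem sublinear_subsolution:
  fixes \<theta> lam M :: real and a b :: 'a
  assumes \<theta>: "0 < \<theta>" "\<theta> < 1" and lam: "lam > 0" and M: "M > 0"
  obtains w k where "finite_energy w k" "\<And>x. 0 \<le> w x" "\<And>x. w x \<le> M" "\<And>x. x \<in> box a b \<Longrightarrow> 0 < w x"
    "\<And>\<eta> \<gamma>. finite_energy \<eta> \<gamma> \<Longrightarrow> (\<And>x. 0 \<le> \<eta> x) \<Longrightarrow>
       form w k \<eta> \<gamma> \<le> (LINT x|lborel. (lam * w x powr \<theta>) * \<eta> x)"
proof -
  define \<zeta> where "\<zeta> = box_bump a b 1"
  have \<zeta>: "test_function \<zeta>" "\<And>x. 0 \<le> \<zeta> x" "\<And>x. \<zeta> x \<le> 1" and \<zeta>pos: "\<And>x. 0 < \<zeta> x \<longleftrightarrow> x \<in> box a b"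
    unfolding \<zeta>_def by (simp_all add: test_function_box_bump box_bump_nonneg box_bump_le_1 box_bump_pos_iff)
  obtain n :: nat where n: "real n > 2 * \<theta> / (1 - \<theta>)" using reals_Archimedean2 by blast
  have "2 * \<theta> / (1 - \<theta>) > 0" using \<theta> by simp
  then have n0: "n > 0" using n by (metis less_trans of_nat_0_less_iff)
  have n\<theta>: "real (n + 2) * \<theta> \<le> real n"
    using n \<theta> by (simp add: divide_less_eq algebra_simps)
  define F where "F x = \<zeta> x ^ (n + 2)" for x
  have F: "test_function F" using test_function_power[OF \<zeta>(1), of "Suc n"] by (simp add: F_def[abs_def])
  have F01: "0 \<le> F x" "F x \<le> 1" for x
    unfolding F_def by (rule zero_le_power[OF \<zeta>(2)], rule power_le_one[OF \<zeta>(2,3)])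
  have powle: "\<zeta> x ^ n \<le> F x powr \<theta>" for x
  proof (cases "\<zeta> x = 0")
    case False
    then have pos: "0 < \<zeta> x" using \<zeta>(2)[of x] by simp
    have "\<zeta> x ^ n = \<zeta> x powr real n" using pos by (simp add: powr_realpow)
    also have "\<dots> \<le> \<zeta> x powr (real (n + 2) * \<theta>)" using pos \<zeta>(3)[of x] n\<theta> by (intro powr_mono') auto
    also have "\<dots> = F x powr \<theta>"
      unfolding F_def powr_realpow[OF pos, symmetric] by (rule powr_powr[symmetric])
    finally show ?thesis .
  qed (use n0 in \<open>simp add: power_0_left\<close>)
  have "\<forall>i\<in>Basis. \<exists>D\<ge>0. \<forall>x. \<bar>partial (partial F i) i x\<bar> \<le> D * \<zeta> x ^ n"
    unfolding F_def[abs_def] using second_partial_power_bound[OF \<zeta>] by blast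
  then obtain D where D: "\<And>i. i \<in> Basis \<Longrightarrow> D i \<ge> 0"
    "\<And>i x. i \<in> Basis \<Longrightarrow> \<bar>partial (partial F i) i x\<bar> \<le> D i * \<zeta> x ^ n" by metis
  have "compact (V ` cbox a b)"
    by (intro compact_continuous_image compact_cbox continuous_on_subset[OF V_continuous subset_UNIV])
  then have "bounded (V ` cbox a b)" by (rule compact_imp_bounded)
  then obtain K where "\<forall>y \<in> V ` cbox a b. norm y \<le> K" unfolding bounded_iff by blast
  then have "norm (V x) \<le> K" if "x \<in> cbox a b" for x using that by blast
  then have K: "V x \<le> K" if "x \<in> cbox a b" for x using that by (metis abs_le_D1 real_norm_def)
  define C where "C = \<bar>K\<bar> + (\<Sum>i\<in>Basis. D i) + 1"
  have "0 \<le> (\<Sum>i\<in>Basis. D i)" using D(1) by (rule sum_nonneg)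
  then have C: "C > 0" by (simp add: C_def)
  have bound: "V x * F x - (\<Sum>i\<in>Basis. partial (partial F i) i x) \<le> C * F x powr \<theta>" for x
  proof -
    have zn: "0 \<le> \<zeta> x ^ n" using \<zeta>(2) by simp
    have "V x * F x \<le> \<bar>K\<bar> * \<zeta> x ^ n"
    proof (cases "x \<in> box a b")
      case True
      then have "V x \<le> \<bar>K\<bar>" using K[of x] box_subset_cbox by fastforce
      moreover have "F x \<le> \<zeta> x ^ n"
        unfolding F_def using \<zeta>(2,3) by (intro power_decreasing) auto
      ultimately show ?thesis using F01(1)[of x] by (intro mult_mono) auto
    next
      case False
      then have "\<zeta> x = 0" using \<zeta>pos[of x] \<zeta>(2)[of x] by simp
      then show ?thesis using n0 by (simp add: F_def)
    qed
    moreover have "- (\<Sum>i\<in>Basis. partial (partial F i) i x) \<le> (\<Sum>i\<in>Basis. D i) * \<zeta> x ^ n"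
      unfolding sum_negf[symmetric] sum_distrib_right
      by (rule sum_mono) (use D(2) in \<open>metis abs_le_D2\<close>)
    ultimately have "V x * F x - (\<Sum>i\<in>Basis. partial (partial F i) i x) \<le> (\<bar>K\<bar> + (\<Sum>i\<in>Basis. D i)) * \<zeta> x ^ n"
      by (simp add: distrib_right)
    also have "\<dots> \<le> C * \<zeta> x ^ n" using zn by (intro mult_right_mono) (simp_all add: C_def)
    also have "\<dots> \<le> C * F x powr \<theta>" using powle C by simp
    finally show ?thesis .
  qed
  \<comment> \<open>The exponent is chosen such that \<open>\<epsilon> * C = lam * \<epsilon> powr \<theta>\<close> for the second argument of the minimum.\<close>
  define \<epsilon> where "\<epsilon> = min M ((lam / C) powr (1 / (1 - \<theta>)))"
  have \<epsilon>: "0 < \<epsilon>" "\<epsilon> \<le> M" using M lam C by (auto simp: \<epsilon>_def)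
  have "\<epsilon> powr (1 - \<theta>) \<le> ((lam / C) powr (1 / (1 - \<theta>))) powr (1 - \<theta>)"
    using \<epsilon> \<theta> by (intro powr_mono2) (auto simp: \<epsilon>_def)
  also have "\<dots> = lam / C" using \<theta> lam C by (simp add: powr_powr)
  finally have "\<epsilon> powr (1 - \<theta>) * C \<le> lam" using C by (simp add: pos_le_divide_eq)
  then have "\<epsilon> powr (1 - \<theta>) * C * \<epsilon> powr \<theta> \<le> lam * \<epsilon> powr \<theta>" by (rule mult_right_mono) simp
  moreover have "\<epsilon> powr (1 - \<theta>) * \<epsilon> powr \<theta> = \<epsilon>" using \<epsilon> by (simp flip: powr_add)
  ultimately have \<epsilon>C: "\<epsilon> * C \<le> lam * \<epsilon> powr \<theta>" by (simp add: ac_simps)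
  define w where "w x = \<epsilon> * F x" for x
  define k where "k x = (\<Sum>i\<in>Basis. partial w i x *\<^sub>R i)" for x
  have w: "test_function w" unfolding w_def[abs_def] by (rule test_function_cmult[OF F])
  have pw: "partial (partial w i) i x = \<epsilon> * partial (partial F i) i x" if "i \<in> Basis" for i x
  proof -
    have "partial w i = (\<lambda>x. \<epsilon> * partial F i x)"
      unfolding w_def[abs_def] using partial_cmult[OF test_function_differentiable[OF F]] by auto
    then show ?thesis
      using partial_cmult[OF test_function_differentiable[OF test_function_partial[OF F that]]] by simp
  qed
  have wnn: "0 \<le> w x" for x using \<epsilon> F01 by (simp add: w_def)
  have wM: "w x \<le> M" for x
    using mult_mono[OF \<epsilon>(2) F01(2)[of x]] F01(1)[of x] M by (simp add: w_def)
  have pointwise: "V x * w x - (\<Sum>i\<in>Basis. partial (partial w i) i x) \<le> lam * w x powr \<theta>" for x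
  proof -
    have "V x * w x - (\<Sum>i\<in>Basis. partial (partial w i) i x) = \<epsilon> * (V x * F x - (\<Sum>i\<in>Basis. partial (partial F i) i x))"
      by (simp add: pw right_diff_distrib sum_distrib_left) (simp add: w_def)
    also have "\<dots> \<le> \<epsilon> * (C * F x powr \<theta>)" using bound \<epsilon> by (intro mult_left_mono) auto
    also have "\<dots> \<le> (lam * \<epsilon> powr \<theta>) * F x powr \<theta>"
      using mult_right_mono[OF \<epsilon>C, of "F x powr \<theta>"] by (simp add: mult.assoc)
    also have "\<dots> = lam * w x powr \<theta>" using \<epsilon> F01 by (simp add: w_def powr_mult)
    finally show ?thesis .
  qed
  show thesis
  proof (rule that[of w k])
    show fe: "finite_energy w k" unfolding k_def[abs_def] by (rule test_function_finite_energy[OF w])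
    show "0 < w x" if "x \<in> box a b" for x
      using that \<zeta>pos[of x] \<epsilon> by (simp add: w_def F_def)
    fix \<eta> \<gamma> assume \<eta>: "finite_energy \<eta> \<gamma>" "\<And>x. (0::real) \<le> \<eta> x"
    have [measurable]: "w \<in> borel_measurable borel" by (rule test_function_measurable[OF w])
    have "\<bar>lam * w x powr \<theta>\<bar> \<le> lam * M powr \<theta>" for x
      using wnn wM lam \<theta> by (simp add: abs_mult powr_mono2)
    then have "integrable lborel (\<lambda>x. (lam * w x powr \<theta>) * \<eta> x)"
      by (intro bounded_mult_integrable[OF _ _ \<eta>(1)]) auto
    then show "form w k \<eta> \<gamma> \<le> (LINT x|lborel. (lam * w x powr \<theta>) * \<eta> x)"
      unfolding k_def[abs_def] form_test_function(2)[OF w \<eta>(1)]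
      by (intro integral_mono form_test_function(1)[OF w \<eta>(1)] mult_right_mono pointwise \<eta>(2))
  qed (rule wnn wM)+
qed

section \<open>Monotone iteration\<close>

text \<open>
  The iterates decrease from the constant \<open>M\<close> and stay above every \<open>w j\<close>, so they converge
  almost everywhere to some \<open>u\<close>. Gradients are controlled through the linear problem: with
  \<open>v\<close> the solution of the linear problem with right-hand side \<open>f u\<close>, stability gives convergence
  of the iterates to \<open>v\<close> as well, whence \<open>u = v\<close> almost everywhere.
\<close>

theorem monotone_iteration:
  fixes f :: "real \<Rightarrow> real" and w :: "nat \<Rightarrow> 'a \<Rightarrow> real"
  assumes fmono: "mono f" and fcont: "continuous_on UNIV f"
    and f0: "\<And>s. 0 \<le> f s" and fM: "\<And>s. f s \<le> V0 * M"
    and w: "\<And>j. finite_energy (w j) (k j)" and wM: "\<And>j x. w j x \<le> M"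
    and sub: "\<And>j \<eta> \<gamma>. finite_energy \<eta> \<gamma> \<Longrightarrow> (\<And>x. 0 \<le> \<eta> x) \<Longrightarrow>
      form (w j) (k j) \<eta> \<gamma> \<le> (LINT x|lborel. f (w j x) * \<eta> x)"
  obtains u g where "solves u g (\<lambda>x. f (u x))" "AE x in lborel. u x \<le> M" "\<And>j. AE x in lborel. w j x \<le> u x"
proof -
  have [measurable]: "f \<in> borel_measurable borel" by (rule borel_measurable_continuous_onI[OF fcont])
  have fB: "\<bar>f s\<bar> \<le> V0 * M" for s using f0[of s] fM[of s] by simp
  define sol where "sol h = (SOME ug. solves (fst ug) (snd ug) h)" for h
  have sol: "solves (fst (sol h)) (snd (sol h)) h" if h: "h \<in> borel_measurable borel" "\<And>x. \<bar>h x\<bar> \<le> V0 * M" for h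
  proof -
    obtain u g where "solves u g h" using linear_problem_solvable[OF h] .
    then have "\<exists>ug. solves (fst ug) (snd ug) h" by (intro exI[of _ "(u, g)"]) simp
    then show ?thesis unfolding sol_def by (rule someI_ex)
  qed
  define U where "U = rec_nat (\<lambda>x. M) (\<lambda>_ u. fst (sol (\<lambda>x. f (u x))))"
  have U0: "U 0 = (\<lambda>x. M)" and US: "U (Suc n) = fst (sol (\<lambda>x. f (U n x)))" for n
    by (simp_all add: U_def)
  have Um[measurable]: "U n \<in> borel_measurable borel" for n
  proof (induction n)
    case 0
    then show ?case by (simp add: U0)
  next
    case (Suc n)
    then have "solves (U (Suc n)) (snd (sol (\<lambda>x. f (U n x)))) (\<lambda>x. f (U n x))"
      unfolding US by (intro sol fB) measurable
    then show ?case by (auto simp: solves_def intro: finite_energy_measurable)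
  qed
  have S: "solves (U (Suc n)) (snd (sol (\<lambda>x. f (U n x)))) (\<lambda>x. f (U n x))" for n
    unfolding US by (intro sol fB) measurable
  have UM: "AE x in lborel. U n x \<le> M" for n
  proof (cases n)
    case (Suc m)
    show ?thesis unfolding Suc by (rule solves_upper_bound[OF S _ fB]) measurable
  qed (simp add: U0)
  have dec: "AE x in lborel. U (Suc n) x \<le> U n x" for n
  proof (induction n)
    case 0
    then show ?case using UM[of "Suc 0"] by (simp add: U0)
  next
    case (Suc n)
    have "AE x in lborel. f (U (Suc n) x) \<le> f (U n x)"
      using Suc by eventually_elim (rule monoD[OF fmono])
    then show ?case by (intro solves_mono[OF S S _ _ fB fB]) measurable
  qed
  have low: "AE x in lborel. w j x \<le> U n x" for j n
  proof (induction n)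
    case 0
    then show ?case using wM by (simp add: U0)
  next
    case (Suc n)
    show ?case
    proof (rule comparison_principle[OF w])
      show "finite_energy (U (Suc n)) (snd (sol (\<lambda>x. f (U n x))))" using S by (simp add: solves_def)
      fix \<eta> \<gamma> assume \<eta>: "finite_energy \<eta> \<gamma>" "\<And>x. (0::real) \<le> \<eta> x"
      note [measurable] = finite_energy_measurable[OF w]
      have "form (w j) (k j) \<eta> \<gamma> \<le> (LINT x|lborel. f (w j x) * \<eta> x)" by (rule sub[OF \<eta>])
      also have "\<dots> \<le> (LINT x|lborel. f (U n x) * \<eta> x)"
      proof (rule integral_mono_AE)
        show "integrable lborel (\<lambda>x. f (w j x) * \<eta> x)" "integrable lborel (\<lambda>x. f (U n x) * \<eta> x)"
          by (rule bounded_mult_integrable[OF _ fB \<eta>(1)], measurable)+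
        show "AE x in lborel. f (w j x) * \<eta> x \<le> f (U n x) * \<eta> x"
          using Suc by eventually_elim (intro mult_right_mono monoD[OF fmono] \<eta>(2))
      qed
      also have "\<dots> = form (U (Suc n)) (snd (sol (\<lambda>x. f (U n x)))) \<eta> \<gamma>"
        using S \<eta>(1) by (simp add: solves_def)
      finally show "form (w j) (k j) \<eta> \<gamma> \<le> form (U (Suc n)) (snd (sol (\<lambda>x. f (U n x)))) \<eta> \<gamma>" .
    qed
  qed
  define u where "u x = lim (\<lambda>n. U n x)" for x
  have um[measurable]: "u \<in> borel_measurable borel"
    unfolding u_def[abs_def] by (rule borel_measurable_lim_metric) measurable
  have lim: "AE x in lborel. (\<lambda>n. U n x) \<longlonglongrightarrow> u x"
  proof -
    have "AE x in lborel. \<forall>n. U (Suc n) x \<le> U n x" "AE x in lborel. \<forall>n. w 0 x \<le> U n x"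
      unfolding AE_all_countable using dec low by auto
    then show ?thesis
    proof eventually_elim
      case (elim x)
      have "decseq (\<lambda>n. U n x)" using elim(1) by (simp add: decseq_Suc_iff)
      then obtain L where "(\<lambda>n. U n x) \<longlonglongrightarrow> L" using elim(2) decseq_convergent by blast
      then show ?case by (simp add: u_def limI)
    qed
  qed
  define h where "h x = f (u x)" for x
  have hm[measurable]: "h \<in> borel_measurable borel" unfolding h_def[abs_def] by measurable
  have hB: "\<bar>h x\<bar> \<le> V0 * M" for x by (simp add: h_def fB)
  obtain v g where v: "solves v g h" using linear_problem_solvable[OF hm hB] .
  have fv: "finite_energy v g" using v by (simp add: solves_def)
  note [measurable] = finite_energy_measurable[OF fv]
  have rhs: "(\<lambda>n. normsq lborel (\<lambda>x. (f (U n x) - h x) / sqrt (V x))) \<longlonglongrightarrow> 0"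
  proof -
    have "(\<lambda>n. LINT x|lborel. (norm ((f (U n x) - h x) / sqrt (V x)))\<^sup>2) \<longlonglongrightarrow> (LINT x::'a|lborel. (0 :: real))"
    proof (rule integral_dominated_convergence)
      show "integrable lborel (\<lambda>x. (V0 * M)\<^sup>2 * (1 / V x))"
        by (intro integrable_mult_right inverse_V_integrable)
      show "AE x in lborel. (\<lambda>n. (norm ((f (U n x) - h x) / sqrt (V x)))\<^sup>2) \<longlonglongrightarrow> 0"
        using lim
      proof eventually_elim
        case (elim x)
        have "(\<lambda>n. f (U n x)) \<longlonglongrightarrow> h x"
          unfolding h_def using elim fcont continuous_on_tendsto_compose[of UNIV f] by auto
        then have "(\<lambda>n. (norm ((f (U n x) - h x) / sqrt (V x)))\<^sup>2) \<longlonglongrightarrow> (norm ((h x - h x) / sqrt (V x)))\<^sup>2"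
          using V_pos[of x] by (intro tendsto_intros) auto
        then show ?case by simp
      qed
      show "AE x in lborel. norm ((norm ((f (U n x) - h x) / sqrt (V x)))\<^sup>2) \<le> (V0 * M)\<^sup>2 * (1 / V x)" for n
      proof (rule AE_I2)
        fix x
        have "\<bar>f (U n x) - h x\<bar> \<le> \<bar>V0 * M\<bar>"
          using f0[of "U n x"] fM[of "U n x"] f0[of "u x"] fM[of "u x"] by (simp add: h_def)
        then have "(f (U n x) - h x)\<^sup>2 \<le> (V0 * M)\<^sup>2" by (simp only: abs_le_square_iff)
        then show "norm ((norm ((f (U n x) - h x) / sqrt (V x)))\<^sup>2) \<le> (V0 * M)\<^sup>2 * (1 / V x)"
          using V_pos[of x] by (simp add: power_divide divide_right_mono less_imp_le)
      qed
    qed measurable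
    then show ?thesis by (simp add: normsq_def)
  qed
  have stab: "normsq lborel (\<lambda>x. sqrt (V x) * (U (Suc n) x - v x)) \<le> normsq lborel (\<lambda>x. (f (U n x) - h x) / sqrt (V x))" for n
    by (rule solves_stability[OF S v _ _ fB hB]) measurable
  have L: "L2 lborel (\<lambda>x. sqrt (V x) * (U (Suc n) x - v x))" for n
    using finite_energy_L2_weighted[OF finite_energy_diff[OF _ fv]] S[of n] by (auto simp: solves_def)
  have limV: "AE x in lborel. (\<lambda>n. sqrt (V x) * (U (Suc n) x - v x)) \<longlonglongrightarrow> sqrt (V x) * (u x - v x)"
    using lim by eventually_elim (intro tendsto_intros LIMSEQ_Suc)
  have ev: "\<forall>\<^sub>F n in sequentially. normsq lborel (\<lambda>x. sqrt (V x) * (U (Suc n) x - v x)) \<le> e" if "e > 0" for e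
    using order_tendstoD(2)[OF rhs that] by eventually_elim (use stab in \<open>meson less_imp_le order_trans\<close>)
  have Lu: "L2 lborel (\<lambda>x. sqrt (V x) * (u x - v x))"
    by (rule normsq_Fatou(1)[OF L _ limV ev[OF zero_less_one]]) measurable
  have "normsq lborel (\<lambda>x. sqrt (V x) * (u x - v x)) \<le> 0 + e" if "e > 0" for e
    using normsq_Fatou(2)[OF L _ limV ev[OF that]] by simp
  then have "normsq lborel (\<lambda>x. sqrt (V x) * (u x - v x)) \<le> 0" by (rule field_le_epsilon)
  then have "AE x in lborel. sqrt (V x) * (u x - v x) = 0"
    using normsq_nonneg[of lborel "\<lambda>x. sqrt (V x) * (u x - v x)"] by (intro normsq_eq_zero_AE[OF Lu]) simp
  then have uv: "AE x in lborel. u x = v x"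
    by eventually_elim (use V_pos in \<open>auto simp: less_le\<close>)
  show thesis
  proof (rule that[of v g])
    have "(LINT x|lborel. h x * \<eta> x) = (LINT x|lborel. f (v x) * \<eta> x)" if \<eta>: "finite_energy \<eta> \<gamma>" for \<eta> \<gamma>
    proof (rule integral_cong_AE)
      note [measurable] = finite_energy_measurable[OF \<eta>]
      show "(\<lambda>x. h x * \<eta> x) \<in> borel_measurable lborel" "(\<lambda>x. f (v x) * \<eta> x) \<in> borel_measurable lborel"
        by measurable
      show "AE x in lborel. h x * \<eta> x = f (v x) * \<eta> x" using uv by eventually_elim (simp add: h_def)
    qed
    then show "solves v g (\<lambda>x. f (v x))" using v by (simp add: solves_def)
    show "AE x in lborel. v x \<le> M"
      by (rule solves_upper_bound[OF v hm hB])
    show "AE x in lborel. w j x \<le> v x" for j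
    proof -
      have "AE x in lborel. \<forall>n. w j x \<le> U n x" unfolding AE_all_countable using low by blast
      with lim uv show ?thesis
      proof eventually_elim
        case (elim x)
        then show ?case using LIMSEQ_le_const[of "\<lambda>n. U n x" "u x" "w j x"] by auto
      qed
    qed
  qed
qed

end

section \<open>The truncated concave-convex nonlinearity\<close>

definition truncated_power_sum :: "real \<Rightarrow> real \<Rightarrow> real \<Rightarrow> real \<Rightarrow> real \<Rightarrow> real" where
  "truncated_power_sum p q lam M s = (min M (max 0 s)) powr (p - 1) + lam * (min M (max 0 s)) powr (q - 1)"

text \<open>
  Truncation makes the nonlinearity bounded and monotone on the whole line, so that it can be
  composed with any measurable iterate.
\<close>

lemma truncated_power_sum_props:
  fixes p q lam M :: real
  assumes q: "1 < q" and p: "1 < p" and lam: "0 \<le> lam" and M: "0 \<le> M"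
  shows "mono (truncated_power_sum p q lam M)" "continuous_on UNIV (truncated_power_sum p q lam M)"
    "0 \<le> truncated_power_sum p q lam M s"
    "truncated_power_sum p q lam M s \<le> M powr (p - 1) + lam * M powr (q - 1)"
proof -
  let ?c = "\<lambda>s. min M (max 0 s)"
  have le: "?c s \<le> ?c t" if "s \<le> t" for s t using that by (auto simp: min_def max_def)
  have c0: "0 \<le> ?c s" for s using M by simp
  show "mono (truncated_power_sum p q lam M)"
    unfolding truncated_power_sum_def
    by (intro monoI add_mono mult_left_mono powr_mono2 le c0 lam) (use p q in auto)
  show "continuous_on UNIV (truncated_power_sum p q lam M)"
    unfolding truncated_power_sum_def[abs_def]
    by (intro continuous_intros continuous_on_powr') (use p q c0 in auto)
  show "0 \<le> truncated_power_sum p q lam M s"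
    unfolding truncated_power_sum_def using lam by simp
  show "truncated_power_sum p q lam M s \<le> M powr (p - 1) + lam * M powr (q - 1)"
    unfolding truncated_power_sum_def
    by (intro add_mono mult_left_mono powr_mono2 lam c0) (use p q in auto)
qed

context confining_potential
begin

lemma finite_energy_integrable:
  assumes "finite_energy u g" shows "integrable lborel u"
  using bounded_mult_integrable[OF _ _ assms, of "\<lambda>x. 1" 1] by simp

section \<open>Weak solutions and their energy\<close>

text \<open>
  The gradient picked by \<^const>\<open>weak_grad\<close> need not be the square integrable one from the definition of
  the space; uniqueness of weak gradients shows that they agree almost everywhere.
\<close>

lemma E_space_finite_energy:
  assumes "u \<in> E_space V"
  shows "finite_energy u (weak_grad u)"
proof -
  obtain g where g: "is_weak_gradient u g" "integrable lborel (\<lambda>x. (norm (g x))\<^sup>2)"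
    and Vu: "integrable lborel (\<lambda>x. V x * \<bar>u x\<bar>\<^sup>2)"
    using assms by (auto simp: E_space_def H1_space_def)
  have wg: "is_weak_gradient u (weak_grad u)"
    unfolding weak_grad_def by (rule someI[of "is_weak_gradient u", OF g(1)])
  then have m: "weak_grad u \<in> borel_measurable lborel"
    by (simp add: is_weak_gradient_def locally_integrable_def)
  have "AE x in lborel. (norm (weak_grad u x))\<^sup>2 \<le> (norm (g x))\<^sup>2"
    using weak_gradient_unique[OF wg g(1)] by eventually_elim simp
  then have "L2 lborel (weak_grad u)" by (rule L2_bound[OF m g(2)])
  with wg Vu show ?thesis by (simp add: finite_energy_def)
qed

lemma finite_energy_E_space:
  assumes u: "finite_energy u g"
  shows "u \<in> E_space V"
proof -
  note [measurable] = finite_energy_measurable[OF u]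
  have "integrable lborel (\<lambda>x. \<bar>u x\<bar> powr 2)"
    using finite_energy_L2[OF u] by (simp add: L2_def)
  then have "u \<in> Lp_space 2" by (simp add: Lp_space_def)
  with u show ?thesis by (auto simp: E_space_def H1_space_def finite_energy_def L2_def)
qed

lemma solves_weak_grad:
  assumes u: "solves u g h"
  shows "solves u (weak_grad u) h"
proof -
  have fg: "finite_energy u g" using u by (simp add: solves_def)
  have fw: "finite_energy u (weak_grad u)"
    by (rule E_space_finite_energy[OF finite_energy_E_space[OF fg]])
  have ae: "AE x in lborel. weak_grad u x = g x"
    using fw fg by (intro weak_gradient_unique) (auto simp: finite_energy_def)
  have "form u (weak_grad u) \<eta> \<gamma> = form u g \<eta> \<gamma>" if \<eta>: "finite_energy \<eta> \<gamma>" for \<eta> \<gamma>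
  proof -
    have "(LINT x|lborel. weak_grad u x \<bullet> \<gamma> x) = (LINT x|lborel. g x \<bullet> \<gamma> x)"
    proof (rule integral_cong_AE)
      show "(\<lambda>x. weak_grad u x \<bullet> \<gamma> x) \<in> borel_measurable lborel" "(\<lambda>x. g x \<bullet> \<gamma> x) \<in> borel_measurable lborel"
        using form_integrable(1)[OF fw \<eta>] form_integrable(1)[OF fg \<eta>] by auto
      show "AE x in lborel. weak_grad u x \<bullet> \<gamma> x = g x \<bullet> \<gamma> x" using ae by eventually_elim simp
    qed
    then show ?thesis by (simp add: form_def)
  qed
  with u fw show ?thesis by (simp add: solves_def)
qed

text \<open>
  The two inequalities on \<open>M\<close> play different roles: the first makes \<open>M\<close> a supersolution, the
  second makes the energy of every positive solution bounded by \<open>M\<close> negative.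
\<close>

theorem positive_solution_negative_energy:
  fixes p q lam M :: real
  assumes q: "1 < q" "q < 2" and p: "2 < p" and lam: "0 < lam" and M: "0 < M"
    and super: "M powr (p - 1) + lam * M powr (q - 1) \<le> V0 * M"
    and small: "(1/2 - 1/p) * M powr (p - q) < lam * (1/q - 1/2)"
  shows "\<exists>u. weak_solution V p q lam u \<and> (AE x in lborel. 0 < u x) \<and> energy V p q lam u < 0"
proof -
  define f where "f = truncated_power_sum p q lam M"
  have f: "mono f" "continuous_on UNIV f" "\<And>s. 0 \<le> f s" "\<And>s. f s \<le> V0 * M"
    using truncated_power_sum_props[of q p lam M] p q lam M super
    by (auto simp: f_def intro: order_trans)
  have [measurable]: "f \<in> borel_measurable borel" by (rule borel_measurable_continuous_onI[OF f(2)])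
  have fB: "\<bar>f s\<bar> \<le> V0 * M" for s using f(3)[of s] f(4)[of s] by simp
  have f_eq: "f s = s powr (p - 1) + lam * s powr (q - 1)" if "0 \<le> s" "s \<le> M" for s
    using that by (simp add: f_def truncated_power_sum_def)
  define sub_on where "sub_on j w k \<longleftrightarrow> finite_energy w k \<and> (\<forall>x. w x \<le> M) \<and>
      (\<forall>x\<in>box (- (real j *\<^sub>R One)) (real j *\<^sub>R One). 0 < w x) \<and>
      (\<forall>\<eta> \<gamma>. finite_energy \<eta> \<gamma> \<longrightarrow> (\<forall>x. 0 \<le> \<eta> x) \<longrightarrow>
        form w k \<eta> \<gamma> \<le> (LINT x|lborel. f (w x) * \<eta> x))" for j :: nat and w k
  have "\<exists>w k. sub_on j w k" for j
  proof -
    have th: "0 < q - 1" "q - 1 < 1" using q by auto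
    obtain w k where w: "finite_energy w k" "\<And>x. 0 \<le> w x" "\<And>x. w x \<le> M"
      "\<And>x. x \<in> box (- (real j *\<^sub>R One)) (real j *\<^sub>R One) \<Longrightarrow> 0 < w x"
      "\<And>\<eta> \<gamma>. finite_energy \<eta> \<gamma> \<Longrightarrow> (\<And>x. 0 \<le> \<eta> x) \<Longrightarrow>
         form w k \<eta> \<gamma> \<le> (LINT x|lborel. (lam * w x powr (q - 1)) * \<eta> x)"
      using sublinear_subsolution[OF th lam M] by blast
    note [measurable] = finite_energy_measurable[OF w(1)]
    have "form w k \<eta> \<gamma> \<le> (LINT x|lborel. f (w x) * \<eta> x)"
      if \<eta>: "finite_energy \<eta> \<gamma>" "\<forall>x. 0 \<le> \<eta> x" for \<eta> \<gamma>
    proof -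
      have le: "lam * w x powr (q - 1) \<le> f (w x)" for x using f_eq[OF w(2,3)] by simp
      then have "\<bar>lam * w x powr (q - 1)\<bar> \<le> V0 * M" for x
        using f(4)[of "w x"] lam order_trans[OF le f(4)] by simp
      then have "integrable lborel (\<lambda>x. (lam * w x powr (q - 1)) * \<eta> x)"
        by (intro bounded_mult_integrable[OF _ _ \<eta>(1)]) auto
      moreover have "integrable lborel (\<lambda>x. f (w x) * \<eta> x)"
        by (rule bounded_mult_integrable[OF _ fB \<eta>(1)]) measurable
      ultimately have "(LINT x|lborel. (lam * w x powr (q - 1)) * \<eta> x) \<le> (LINT x|lborel. f (w x) * \<eta> x)"
        using \<eta>(2) by (intro integral_mono mult_right_mono le) auto
      then show ?thesis using w(5)[OF \<eta>(1)] \<eta>(2) by fastforce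
    qed
    then show ?thesis unfolding sub_on_def using w by blast
  qed
  then obtain w k where wk: "\<And>j. sub_on j (w j) (k j)" by metis
  have w: "\<And>j. finite_energy (w j) (k j)" "\<And>j x. w j x \<le> M"
    and wpos: "\<And>j x. x \<in> box (- (real j *\<^sub>R One)) (real j *\<^sub>R One) \<Longrightarrow> 0 < w j x"
    and sub: "\<And>j \<eta> \<gamma>. finite_energy \<eta> \<gamma> \<Longrightarrow> (\<And>x. 0 \<le> \<eta> x) \<Longrightarrow>
        form (w j) (k j) \<eta> \<gamma> \<le> (LINT x|lborel. f (w j x) * \<eta> x)"
    using wk unfolding sub_on_def by blast+
  have "\<exists>u g. solves u g (\<lambda>x. f (u x)) \<and> (AE x in lborel. u x \<le> M) \<and> (\<forall>j. AE x in lborel. w j x \<le> u x)"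
    by (rule monotone_iteration[of f M w k, OF f w sub]) blast+
  then obtain u g where ug: "solves u g (\<lambda>x. f (u x))" and uM: "AE x in lborel. u x \<le> M"
    and wu: "\<And>j. AE x in lborel. w j x \<le> u x"
    by blast
  have u: "solves u (weak_grad u) (\<lambda>x. f (u x))" by (rule solves_weak_grad[OF ug])
  have fe: "finite_energy u (weak_grad u)" using u by (simp add: solves_def)
  note [measurable] = finite_energy_measurable[OF fe]
  have "AE x in lborel. \<forall>j. w j x \<le> u x" unfolding AE_all_countable using wu by blast
  then have upos: "AE x in lborel. 0 < u x"
  proof eventually_elim
    case (elim x)
    obtain j where j: "norm x < real j" using reals_Archimedean2 by blast
    have "x \<in> box (- (real j *\<^sub>R One)) (real j *\<^sub>R One)"
      unfolding mem_box
    proof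
      fix i :: 'a assume i: "i \<in> Basis"
      have "\<bar>x \<bullet> i\<bar> < real j" using Basis_le_norm[OF i, of x] j by linarith
      then show "- (real j *\<^sub>R One) \<bullet> i < x \<bullet> i \<and> x \<bullet> i < (real j *\<^sub>R One) \<bullet> i"
        using i by simp linarith
    qed
    from wpos[OF this] elim show ?case by (meson less_le_trans)
  qed
  have pow_int: "integrable lborel (\<lambda>x. \<bar>u x\<bar> powr r)" if r: "r > 1" for r
  proof (rule Bochner_Integration.integrable_bound)
    show "integrable lborel (\<lambda>x. M powr (r - 1) * u x)"
      by (intro integrable_mult_right finite_energy_integrable[OF fe])
    show "AE x in lborel. norm (\<bar>u x\<bar> powr r) \<le> norm (M powr (r - 1) * u x)"
      using upos uM
    proof eventually_elim
      case (elim x)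
      have "\<bar>u x\<bar> powr r = u x powr (r - 1) * u x"
        using elim powr_add[of "u x" "r - 1" 1] by simp
      also have "\<dots> \<le> M powr (r - 1) * u x"
        using elim r by (intro mult_right_mono powr_mono2) auto
      finally show ?case using elim by (simp add: abs_mult)
    qed
  qed measurable
  have uV: "u \<in> V_space V p"
    using finite_energy_E_space[OF fe] pow_int[of p] p by (simp add: V_space_def Lp_space_def)
  have powers: "AE x in lborel. f (u x) = \<bar>u x\<bar> powr (p - 2) * u x + lam * \<bar>u x\<bar> powr (q - 2) * u x"
    using upos uM
  proof eventually_elim
    case (elim x)
    then show ?case
      using f_eq[of "u x"] powr_add[of "u x" "p - 2" 1] powr_add[of "u x" "q - 2" 1] by simp
  qed
  have sol: "weak_solution V p q lam u"
    unfolding weak_solution_def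
  proof (intro conjI ballI uV)
    fix \<eta> assume "\<eta> \<in> V_space V p"
    then have \<eta>: "finite_energy \<eta> (weak_grad \<eta>)" by (intro E_space_finite_energy) (simp add: V_space_def)
    note [measurable] = finite_energy_measurable[OF \<eta>]
    have "(LINT x|lborel. f (u x) * \<eta> x) =
        (LINT x|lborel. (\<bar>u x\<bar> powr (p - 2) * u x + lam * \<bar>u x\<bar> powr (q - 2) * u x) * \<eta> x)"
    proof (rule integral_cong_AE)
      show "AE x in lborel. f (u x) * \<eta> x =
          (\<bar>u x\<bar> powr (p - 2) * u x + lam * \<bar>u x\<bar> powr (q - 2) * u x) * \<eta> x"
        using powers by eventually_elim simp
    qed measurable
    then show "(LINT x|lborel. weak_grad u x \<bullet> weak_grad \<eta> x) + (LINT x|lborel. V x * u x * \<eta> x) =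
        (LINT x|lborel. (\<bar>u x\<bar> powr (p - 2) * u x + lam * \<bar>u x\<bar> powr (q - 2) * u x) * \<eta> x)"
      using u \<eta> by (simp add: solves_def form_def)
  qed
  \<comment> \<open>Testing the equation with \<open>u\<close> expresses the energy through these two integrals.\<close>
  define P Q where "P = (LINT x|lborel. \<bar>u x\<bar> powr p)" and "Q = (LINT x|lborel. \<bar>u x\<bar> powr q)"
  have Pi: "integrable lborel (\<lambda>x. \<bar>u x\<bar> powr p)" and Qi: "integrable lborel (\<lambda>x. \<bar>u x\<bar> powr q)"
    using pow_int p q by auto
  have "(LINT x|lborel. f (u x) * u x) = (LINT x|lborel. \<bar>u x\<bar> powr p + lam * \<bar>u x\<bar> powr q)"
  proof (rule integral_cong_AE)
    show "AE x in lborel. f (u x) * u x = \<bar>u x\<bar> powr p + lam * \<bar>u x\<bar> powr q"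
      using upos uM
    proof eventually_elim
      case (elim x)
      then show ?case
        using f_eq[of "u x"] powr_add[of "u x" "p - 1" 1] powr_add[of "u x" "q - 1" 1]
        by (simp add: distrib_right)
    qed
  qed measurable
  also have "\<dots> = P + lam * Q" using Pi Qi by (simp add: P_def Q_def)
  finally have PQ: "form u (weak_grad u) u (weak_grad u) = P + lam * Q"
    using u fe by (simp add: solves_def)
  have "energy V p q lam u = 1/2 * form u (weak_grad u) u (weak_grad u) - 1/p * P - lam / q * Q"
  proof -
    have Vu: "V x * \<bar>u x\<bar>\<^sup>2 = V x * u x * u x" for x by (simp add: power2_eq_square)
    show ?thesis
      unfolding energy_def form_def P_def Q_def power2_norm_eq_inner Vu by (simp add: distrib_left)
  qed
  also have "\<dots> = (1/2 - 1/p) * P - lam * (1/q - 1/2) * Q"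
    unfolding PQ by (simp add: algebra_simps add_divide_distrib)
  finally have en: "energy V p q lam u = (1/2 - 1/p) * P - lam * (1/q - 1/2) * Q" .
  have "0 < Q"
  proof -
    have "Q \<noteq> 0"
    proof
      assume "Q = 0"
      then have "AE x in lborel. \<bar>u x\<bar> powr q = 0"
        using integral_nonneg_eq_0_iff_AE[OF Qi] by (simp add: Q_def)
      with upos have "AE x in (lborel :: 'a measure). False" by eventually_elim simp
      then show False by (simp add: eventually_False ae_filter_eq_bot_iff)
    qed
    moreover have "0 \<le> Q" by (simp add: Q_def)
    ultimately show ?thesis by simp
  qed
  have "P \<le> (LINT x|lborel. M powr (p - q) * \<bar>u x\<bar> powr q)"
    unfolding P_def
  proof (rule integral_mono_AE[OF Pi])
    show "AE x in lborel. \<bar>u x\<bar> powr p \<le> M powr (p - q) * \<bar>u x\<bar> powr q"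
      using upos uM
    proof eventually_elim
      case (elim x)
      have "\<bar>u x\<bar> powr p = u x powr (p - q) * \<bar>u x\<bar> powr q"
        using elim powr_add[of "u x" "p - q" q] by simp
      also have "\<dots> \<le> M powr (p - q) * \<bar>u x\<bar> powr q"
        using elim p q by (intro mult_right_mono powr_mono2) auto
      finally show ?case .
    qed
  qed (use Qi in simp)
  also have "\<dots> = M powr (p - q) * Q" by (simp add: Q_def)
  finally have "(1/2 - 1/p) * P \<le> (1/2 - 1/p) * (M powr (p - q) * Q)"
    using p by (intro mult_left_mono) (simp_all add: field_simps)
  also have "\<dots> < lam * (1/q - 1/2) * Q"
    using mult_strict_right_mono[OF small \<open>0 < Q\<close>] by (simp add: mult.assoc)
  finally have "energy V p q lam u < 0" using en by simp
  with sol upos show ?thesis by blast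
qed

end

text \<open>
  With \<open>lam = V0 / 2 * M powr (2 - q)\<close> both inequalities reduce to an upper bound \<open>c\<close> for \<open>M powr (p - 2)\<close>.
\<close>

lemma supersolution_constant_exists:
  fixes V0 p q :: real
  assumes q: "1 < q" "q < 2" and p: "2 < p" and V0: "V0 > 0"
  obtains \<Lambda> where "\<Lambda> > 0" "\<And>lam. 0 < lam \<Longrightarrow> lam < \<Lambda> \<Longrightarrow> \<exists>M>0.
      M powr (p - 1) + lam * M powr (q - 1) \<le> V0 * M \<and> (1/2 - 1/p) * M powr (p - q) < lam * (1/q - 1/2)"
proof -
  define A B where "A = 1/2 - 1/p" and "B = 1/q - 1/2"
  have A: "A > 0" and B: "B > 0" using p q by (simp_all add: A_def B_def field_simps)
  \<comment> \<open>The first entry makes \<open>M\<close> a supersolution, the second makes the energy negative.\<close>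
  define c where "c = min (V0 / 2) (V0 / 2 * B / A)"
  have c: "c > 0" using V0 A B by (simp add: c_def)
  define M0 where "M0 = c powr (1 / (p - 2))"
  have M0: "M0 > 0" "M0 powr (p - 2) = c" using c p by (simp_all add: M0_def powr_powr)
  show thesis
  proof (rule that[of "V0 / 2 * M0 powr (2 - q)"])
    show "0 < V0 / 2 * M0 powr (2 - q)" using V0 M0 by simp
    fix lam assume lam: "0 < lam" "lam < V0 / 2 * M0 powr (2 - q)"
    define M where "M = (2 * lam / V0) powr (1 / (2 - q))"
    have M: "M > 0" "M powr (2 - q) = 2 * lam / V0" using lam V0 q by (simp_all add: M_def powr_powr)
    have lamM: "lam = V0 / 2 * M powr (2 - q)" using M V0 by simp
    have "M powr (2 - q) < M0 powr (2 - q)" using lam lamM V0 by simp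
    then have "M < M0" using M M0 q by (metis diff_gt_0_iff_gt less_le_not_le linorder_not_le powr_mono2)
    then have Mc: "M powr (p - 2) < c" using powr_less_mono2[of "p - 2" M M0] M M0 p by simp
    have e1: "M powr (p - 1) = M powr (p - 2) * M" using powr_add[of M "p - 2" 1] M by simp
    have e2: "M powr (2 - q) * M powr (q - 1) = M" using powr_add[of M "2 - q" "q - 1"] M by simp
    have e3: "M powr (p - q) = M powr (p - 2) * M powr (2 - q)" using powr_add[of M "p - 2" "2 - q"] by simp
    have "M powr (p - 1) \<le> V0 / 2 * M"
      unfolding e1 using Mc M by (intro mult_right_mono) (auto simp: c_def)
    moreover have "lam * M powr (q - 1) = V0 / 2 * M"
      unfolding lamM by (simp add: mult.assoc e2)
    ultimately have one: "M powr (p - 1) + lam * M powr (q - 1) \<le> V0 * M" by simp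
    have "A * M powr (p - 2) < A * c" using Mc A by simp
    also have "A * c \<le> A * (V0 / 2 * B / A)" using A by (intro mult_left_mono) (auto simp: c_def)
    also have "\<dots> = V0 / 2 * B" using A by simp
    finally have "A * M powr (p - 2) * M powr (2 - q) < V0 / 2 * B * M powr (2 - q)"
      using M(1) by (intro mult_strict_right_mono) auto
    then have "A * M powr (p - q) < lam * B" unfolding e3 by (subst lamM) (simp add: ac_simps)
    with one M show "\<exists>M>0. M powr (p - 1) + lam * M powr (q - 1) \<le> V0 * M \<and>
        (1/2 - 1/p) * M powr (p - q) < lam * (1/q - 1/2)"
      by (auto simp: A_def B_def)
  qed
qed

theorem theorem1p1:
  fixes V :: "real ^ 'n \<Rightarrow> real" and p q V0 :: real
  assumes "CARD('n) \<ge> 3"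
    and "1 < q" and "q < 2" and "2 < p"
    and "continuous_on UNIV V"
    and "V0 > 0" and "\<And>x. V0 \<le> V x"
    and "integrable lborel (\<lambda>x. 1 / V x)"
  shows "\<exists>\<Lambda>0>0. \<forall>lam. 0 < lam \<and> lam < \<Lambda>0 \<longrightarrow>
    (\<exists>u. weak_solution V p q lam u \<and> (AE x in lborel. u x > 0) \<and> energy V p q lam u < 0)"
proof -
  interpret confining_potential V V0 using assms by unfold_locales auto
  obtain \<Lambda> where \<Lambda>: "\<Lambda> > 0" "\<And>lam. 0 < lam \<Longrightarrow> lam < \<Lambda> \<Longrightarrow> \<exists>M>0.
      M powr (p - 1) + lam * M powr (q - 1) \<le> V0 * M \<and> (1/2 - 1/p) * M powr (p - q) < lam * (1/q - 1/2)"
    using supersolution_constant_exists[OF assms(2-4,6)] by blast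
  have "\<exists>u. weak_solution V p q lam u \<and> (AE x in lborel. u x > 0) \<and> energy V p q lam u < 0"
    if l: "0 < lam" "lam < \<Lambda>" for lam
  proof -
    obtain M where "0 < M" "M powr (p - 1) + lam * M powr (q - 1) \<le> V0 * M"
      "(1/2 - 1/p) * M powr (p - q) < lam * (1/q - 1/2)"
      using \<Lambda>(2)[OF l] by blast
    from positive_solution_negative_energy[OF assms(2-4) l(1) this] show ?thesis .
  qed
  with \<Lambda>(1) show ?thesis by blast
qed

end
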